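(* Let $n,n',d$ be positive integers and let $\mathcal{A}\subset M_{n,d}\times\{1,\ldots,n'\}$ be admissible. Then the operator $$T_{\mathcal{A}}f(u):=\int_{\mathbb{R}^n} f\Big(t,\sum_{\alpha\in\mathcal{A}_1}u_{(\alpha,1)}t^\alpha,\ldots,\sum_{\alpha\in\mathcal{A}_{n'}}u_{(\alpha,n')}t^\alpha\Big)\,dt,\qquad u\in\mathbb{R}^{\mathcal{A}},$$ maps $L^{\frac{|\mathcal{A}|+\#\mathcal{A}}{\#\mathcal{A}}}(\mathbb{R}^n\times\mathbb{R}^{n'})$ boundedly to $L^{|\mathcal{A}|+\#\mathcal{A}}(\mathbb{R}^{\mathcal{A}})$.
   Context: A multiindex of length $n$ is an $n$-tuple $\alpha=(\alpha_1,\ldots,\alpha_n)$ of nonnegative integers, of degree $\sum_j\alpha_j$; $t^\alpha:=\prod_j t_j^{\alpha_j}$. $M_{n,d}$ is the set of multiindices of length $n$ and degree at most $d$. For $\mathcal{A}\subset M_{n,d}\times\{1,\ldots,n'\}$ and $j=1,\ldots,n'$ let $\mathcal{A}_j:=\{\alpha:(\alpha,j)\in\mathcal{A}\}$. The dictionary order on multiindices: $\alpha\le\beta$ iff $\alpha=\beta$ or the smallest index $i$ with $\alpha_i\ne\beta_i$ satisfies $\alpha_i<\beta_i$. $\mathcal{A}$ is called admissible when the following four conditions hold. (1) Dimensionality: there is an integer $\#\mathcal{A}$ such that every $\mathcal{A}_j$ ($j=1,\ldots,n'$) has cardinality $\#\mathcal{A}$. (2) Scaling: there is an integer $|\mathcal{A}|$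 such that $\sum_{j=1}^{n'}\sum_{\alpha\in\mathcal{A}_j}\alpha=|\mathcal{A}|\,\mathbf{1}$, where $\mathbf{1}=(1,\ldots,1)\in\mathbb{R}^n$. (3) Strengthened spanning: if $\alpha_{1,k}<\alpha_{2,k}<\cdots<\alpha_{\#\mathcal{A},k}$ is the enumeration of $\mathcal{A}_k$ in increasing dictionary order and $\beta_j:=\sum_{k=1}^{n'}\alpha_{j,k}$ for $j=1,\ldots,\#\mathcal{A}$, then $\beta_1,\ldots,\beta_{\#\mathcal{A}}$ span $\mathbb{R}^n$ as vectors. (4) Nondegeneracy: $\mathbf{0}=(0,\ldots,0)\in\mathcal{A}_j$ for each $j=1,\ldots,n'$. *)

theory Defs
  imports "HOL-Analysis.Analysis" "HOL-Library.Fun_Lexorder"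
begin

text \<open>
  A multiindex of length \<open>n = CARD('n)\<close> has type \<^typ>\<open>nat ^ 'n\<close>. The dictionary order needs an
  ordered index type. The class \<^class>\<open>wellorder\<close> is no restriction compared to \<^class>\<open>linorder\<close>,
  because every finite linear order is a well-order; it is the class that the change of variables
  theorems for \<^typ>\<open>real ^ 'n\<close> require.
\<close>

definition multiindices :: "nat \<Rightarrow> (nat ^ 'n) set" where
  "multiindices d = {\<alpha>. (\<Sum>i\<in>UNIV. \<alpha> $ i) \<le> d}"

definition monomial :: "real ^ 'n \<Rightarrow> nat ^ 'n \<Rightarrow> real" where
  "monomial t \<alpha> = (\<Prod>i\<in>UNIV. (t $ i) ^ (\<alpha> $ i))"

definition slice :: "((nat ^ 'n) \<times> 'm) set \<Rightarrow> 'm \<Rightarrow> (nat ^ 'n) set" where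
  "slice A j = {\<alpha>. (\<alpha>, j) \<in> A}"

definition dict_less :: "nat ^ 'n::{finite,wellorder} \<Rightarrow> nat ^ 'n::_ \<Rightarrow> bool" where
  "dict_less \<alpha> \<beta> \<longleftrightarrow> less_fun (($) \<alpha>) (($) \<beta>)"

definition dict_enumerates ::
  "(nat \<Rightarrow> nat ^ 'n::{finite,wellorder}) \<Rightarrow> nat \<Rightarrow> (nat ^ 'n::_) set \<Rightarrow> bool" where
  "dict_enumerates a N S \<longleftrightarrow> monotone_on {1..N} (<) dict_less a \<and> a ` {1..N} = S"

text \<open>
  By \<open>dict_enumerates_exists\<close> and \<open>dict_enumerates_unique\<close> below, the enumerations \<open>a k\<close> exist and
  are unique on \<open>{1..N}\<close> when all slices are finite of cardinality \<open>N\<close>.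
\<close>

definition strengthened_spanning ::
  "((nat ^ 'n::{finite,wellorder}) \<times> 'm::finite) set \<Rightarrow> nat \<Rightarrow> bool" where
  "strengthened_spanning A N \<longleftrightarrow>
     (\<exists>a. (\<forall>k. dict_enumerates (a k) N (slice A k)) \<and>
          span ((\<lambda>j. (\<chi> i. real ((\<Sum>k\<in>UNIV. a k j) $ i)) :: real ^ 'n::_) ` {1..N}) = UNIV)"

text \<open>
  The parameters \<open>N\<close> and \<open>w\<close> are the integers \<open>#A\<close> and \<open>|A|\<close>; each is determined by \<open>A\<close>,
  and neither can be negative.
\<close>

definition admissible ::
  "((nat ^ 'n::{finite,wellorder}) \<times> 'm::finite) set \<Rightarrow> nat \<Rightarrow> nat \<Rightarrow> bool" where
  "admissible A N w \<longleftrightarrow>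
     (\<forall>j. card (slice A j) = N) \<and>
     (\<Sum>j\<in>UNIV. \<Sum>\<alpha>\<in>slice A j. \<alpha>) = (\<chi> i. w) \<and>
     strengthened_spanning A N \<and>
     (\<forall>j. 0 \<in> slice A j)"

text \<open>The space of \<open>u\<close> is represented by functions on \<open>A\<close>, as in \<^const>\<open>PiM\<close>.\<close>

definition T_op ::
  "((nat ^ 'n) \<times> 'm) set \<Rightarrow> ((real ^ 'n) \<times> (real ^ 'm) \<Rightarrow> complex)
     \<Rightarrow> ((nat ^ 'n) \<times> 'm \<Rightarrow> real) \<Rightarrow> complex" where
  "T_op A f u = (\<integral>t. f (t, \<chi> j. \<Sum>\<alpha>\<in>slice A j. u (\<alpha>, j) * monomial t \<alpha>) \<partial>lebesgue)"

definition coeff_measure :: "'i set \<Rightarrow> ('i \<Rightarrow> real) measure" where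
  "coeff_measure A = completion (PiM A (\<lambda>_. lborel))"

definition Lp_space :: "real \<Rightarrow> 'a measure \<Rightarrow> ('a \<Rightarrow> complex) set" where
  "Lp_space p M = {f \<in> borel_measurable M. integrable M (\<lambda>x. norm (f x) powr p)}"

definition Lp_norm :: "real \<Rightarrow> 'a measure \<Rightarrow> ('a \<Rightarrow> complex) \<Rightarrow> real" where
  "Lp_norm p M f = (\<integral>x. norm (f x) powr p \<partial>M) powr (1 / p)"

lemma linorder_dict: "class.linorder (\<lambda>\<alpha> \<beta>. \<alpha> = \<beta> \<or> dict_less \<alpha> \<beta>) dict_less"
proof -
  have total: "dict_less \<alpha> \<beta> \<or> \<alpha> = \<beta> \<or> dict_less \<beta> \<alpha>" for \<alpha> \<beta> :: "nat ^ 'n::{finite,wellorder}"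
  proof (cases "\<alpha> = \<beta>")
    case False
    define i where "i = (LEAST i. \<alpha> $ i \<noteq> \<beta> $ i)"
    have "\<exists>i. \<alpha> $ i \<noteq> \<beta> $ i"
      using False by (simp add: vec_eq_iff)
    then have "\<alpha> $ i \<noteq> \<beta> $ i"
      unfolding i_def by (rule LeastI_ex)
    moreover have "\<alpha> $ i' = \<beta> $ i'" if "i' < i" for i'
      using not_less_Least[OF that[unfolded i_def]] by simp
    ultimately show ?thesis
      unfolding dict_less_def less_fun_def by (metis linorder_neqE_nat)
  qed simp
  show ?thesis
  proof (unfold_locales, goal_cases)
    case 1 then show ?case by (metis dict_less_def less_fun_asym)
  next
    case 2 then show ?case by simp
  next
    case 3 then show ?case unfolding dict_less_def by (metis less_fun_trans)
  next
    case 4 then show ?case unfolding dict_less_def by (metis less_fun_asym)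
  next
    case 5 then show ?case using total by metis
  qed
qed

lemma dict_enumerates_exists:
  assumes "finite S" "card S = N"
  shows "\<exists>a. dict_enumerates a N S"
proof -
  interpret dict: linorder "\<lambda>\<alpha> \<beta>. \<alpha> = \<beta> \<or> dict_less \<alpha> \<beta>" dict_less
    by (rule linorder_dict)
  obtain xs where xs: "sorted_wrt dict_less xs" "set xs = S" "length xs = card S"
    using dict.sorted_list_of_set.finite_set_strict_sorted[OF assms(1)] by metis
  have "(\<lambda>j. xs ! (j - 1)) ` {1..N} = S"
  proof -
    have "{1..N} = Suc ` {..<length xs}"
      using xs assms by (auto simp: image_Suc_lessThan)
    then show ?thesis
      using xs(2) by (auto simp: image_image set_conv_nth)
  qed
  moreover have "monotone_on {1..N} (<) dict_less (\<lambda>j. xs ! (j - 1))"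
  proof (rule monotone_onI)
    fix i j assume "i \<in> {1..N}" "j \<in> {1..N}" "i < j"
    then have "i - 1 < j - 1" "j - 1 < length xs"
      using xs(3) assms(2) by auto
    then show "dict_less (xs ! (i - 1)) (xs ! (j - 1))"
      by (rule sorted_wrt_nth_less[OF xs(1)])
  qed
  ultimately show ?thesis
    unfolding dict_enumerates_def by blast
qed

lemma dict_enumerates_unique:
  assumes "dict_enumerates a N S" "dict_enumerates b N S" "j \<in> {1..N}"
  shows "a j = b j"
proof -
  interpret dict: linorder "\<lambda>\<alpha> \<beta>. \<alpha> = \<beta> \<or> dict_less \<alpha> \<beta>" dict_less
    by (rule linorder_dict)
  have sorted: "sorted_wrt dict_less (map c [1..<Suc N]) \<and> set (map c [1..<Suc N]) = S"
    if "dict_enumerates c N S" for c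
    using that
    by (auto simp: dict_enumerates_def monotone_on_def sorted_wrt_iff_nth_less atLeastLessThanSuc_atLeastAtMost simp del: upt_Suc)
  have "map a [1..<Suc N] = map b [1..<Suc N]"
    using dict.strict_sorted_equal sorted[OF assms(1)] sorted[OF assms(2)] by metis
  then show ?thesis
    using assms(3) by (auto simp: map_eq_conv simp del: upt_Suc)
qed

end

theory Submission
  imports Defs "HOL-Computational_Algebra.Fundamental_Theorem_Algebra"
begin

text \<open>
  Write \<open>N = #A\<close>, \<open>w = |A|\<close>, \<open>q = w + N\<close>, \<open>p = q / N\<close> and let \<open>V(t\<^sub>1, \<dots>, t\<^sub>N)\<close> be the product over \<open>j\<close> of the
  alternants \<open>det (t\<^sub>i\<^sup>\<alpha>)\<close> with \<open>\<alpha> \<in> A\<^sub>j\<close>. For fixed \<open>t\<close>, the map that sends \<open>u\<close> to the values of the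
  polynomials \<open>P\<^sub>u\<close> at \<open>t\<^sub>1, \<dots>, t\<^sub>N\<close> is linear between spaces of equal dimension with determinant \<open>V(t)\<close>, so
  \<open>\<integral>\<integral> \<Prod>\<^sub>i F(t\<^sub>i, P\<^sub>u(t\<^sub>i)) |V(t)| dt du \<le> (\<integral> F)\<^sup>N\<close>. With \<open>F = |f|\<^sup>p\<close> the theorem reduces to the
  inequality \<open>(\<integral> g)\<^sup>q \<le> C \<integral> \<Prod>\<^sub>i g(t\<^sub>i)\<^sup>p |V(t)| dt\<close> for functions \<open>g \<ge> 0\<close> on \<open>\<real>\<^sup>n\<close>.

  Elimination writes \<open>V\<close> as a product of \<open>N\<close> pivots; the \<open>i\<close>-th one is, as a function of \<open>t\<^sub>i\<close>, a polynomial
  with leading monomial \<open>t\<^sup>\<beta>\<close>, \<open>\<beta> = \<beta>\<^sub>i\<close>, in the dictionary order. Hence it suffices to bound \<open>(\<integral> g)\<^sup>q\<close> by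
  \<open>\<Prod>\<^sub>i \<integral> g\<^sup>p |R\<^sub>i|\<close> for all polynomials \<open>R\<^sub>i\<close> with these leading monomials. The pointwise inequality
  \<open>g \<le> g\<^sup>p \<Phi> + \<Phi> powr (- N / w)\<close> with \<open>\<Phi> = max\<^sub>i c\<^sub>i |R\<^sub>i|\<close> leaves the integral of \<open>\<Phi> powr (- N / w)\<close>.
  Integrating one coordinate at a time, the sets \<open>{|R\<^sub>i| \<le> M\<^sub>i for all i}\<close> are no larger, up to a constant, than
  those of the leading monomials, because a one-dimensional sublevel set is covered by intervals whose
  length depends only on the leading coefficient. For monomials, logarithmic coordinates and the
  spanning hypothesis give the bound.
\<close>

subsection \<open>Lebesgue measure in coordinates\<close>

text \<open>Both measures give a box the product of its side lengths, and this characterizes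
  \<open>lborel\<close>. Functions on the index type are the form in which single coordinates can be
  split off and integrated.\<close>

lemma nn_integral_lborel_vec:
  fixes f :: "real ^ 'n::finite \<Rightarrow> ennreal"
  assumes [measurable]: "f \<in> borel_measurable borel"
  shows "(\<integral>\<^sup>+x. f x \<partial>lborel) = (\<integral>\<^sup>+x. f (\<chi> i. x i) \<partial>PiM UNIV (\<lambda>_. lborel))"
proof -
  interpret P: product_sigma_finite "\<lambda>_::'n. lborel :: real measure" ..
  have m: "(\<lambda>x. \<chi> i. x i) \<in> measurable (PiM UNIV (\<lambda>_::'n. lborel :: real measure)) borel"
    by (rule borel_measurable_euclidean_space[THEN iffD2])
       (auto simp: Basis_vec_def inner_axis)
  have "lborel = distr (PiM UNIV (\<lambda>_::'n. lborel :: real measure)) borel (\<lambda>x. \<chi> i. x i)"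
  proof (rule lborel_eqI)
    fix l u :: "real ^ 'n" assume le: "\<And>b. b \<in> Basis \<Longrightarrow> l \<bullet> b \<le> u \<bullet> b"
    have le': "l $ i \<le> u $ i" for i
      using le[of "axis i 1"] by (auto simp: inner_axis axis_in_Basis_iff)
    have "(\<lambda>x. \<chi> i. x i) -` box l u \<inter> space (PiM UNIV (\<lambda>_::'n. lborel :: real measure))
        = Pi\<^sub>E UNIV (\<lambda>i. {l $ i <..< u $ i})"
      by (auto simp: space_PiM mem_box_cart PiE_iff)
    then have "emeasure (distr (PiM UNIV (\<lambda>_::'n. lborel :: real measure)) borel (\<lambda>x. \<chi> i. x i)) (box l u)
        = (\<Prod>i\<in>UNIV. emeasure lborel {l $ i <..< u $ i})"
      by (subst emeasure_distr[OF m]) (auto simp: P.emeasure_PiM)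
    also have "\<dots> = (\<Prod>i\<in>UNIV. ennreal (u $ i - l $ i))"
      by (intro prod.cong refl) (auto simp: le')
    also have "\<dots> = ennreal (\<Prod>i\<in>UNIV. u $ i - l $ i)"
      by (rule prod_ennreal) (simp add: le')
    also have "(\<Prod>i\<in>UNIV. u $ i - l $ i) = (\<Prod>b\<in>Basis. (u - l) \<bullet> b)"
    proof -
      have "bij_betw (\<lambda>i. axis i 1 :: real ^ 'n) UNIV Basis"
        by (auto simp: bij_betw_def inj_on_def axis_eq_axis Basis_vec_def)
      from prod.reindex_bij_betw[OF this, of "\<lambda>b. (u - l) \<bullet> b"] show ?thesis
        by (simp add: inner_axis)
    qed
    finally show "emeasure (distr (PiM UNIV (\<lambda>_::'n. lborel :: real measure)) borel (\<lambda>x. \<chi> i. x i)) (box l u)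
        = ennreal (\<Prod>b\<in>Basis. (u - l) \<bullet> b)" .
  qed simp
  then have "(\<integral>\<^sup>+x. f x \<partial>lborel) = (\<integral>\<^sup>+x. f x \<partial>distr (PiM UNIV (\<lambda>_::'n. lborel :: real measure)) borel (\<lambda>x. \<chi> i. x i))"
    by simp
  also have "\<dots> = (\<integral>\<^sup>+x. f (\<chi> i. x i) \<partial>PiM UNIV (\<lambda>_. lborel))"
    by (rule nn_integral_distr[OF m]) simp
  finally show ?thesis .
qed

lemma borel_measurable_vec_nth[measurable]: "(\<lambda>x::real ^ 'n::finite. x $ i) \<in> borel_measurable borel"
  by (intro borel_measurable_continuous_onI continuous_intros)

lemma borel_measurable_vec_lambda[measurable (raw)]:
  assumes "\<And>i. (\<lambda>x. f x i) \<in> borel_measurable M"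
  shows "(\<lambda>x. \<chi> i. f x i :: real ^ 'n::finite) \<in> borel_measurable M"
  by (rule borel_measurable_euclidean_space[THEN iffD2])
     (use assms in \<open>auto simp: Basis_vec_def inner_axis\<close>)

text \<open>Diagonal affine substitution. When all \<open>c j\<close> are nonzero this is an
  equality; the inequality also covers vanishing factors, where the left side is \<open>0\<close>
  even if the integral is infinite.\<close>

lemma nn_integral_lborel_vec_affine:
  fixes F :: "real ^ 'm::finite \<Rightarrow> ennreal"
  assumes [measurable]: "F \<in> borel_measurable borel"
  shows "ennreal (\<Prod>j\<in>UNIV. \<bar>c j\<bar>) * (\<integral>\<^sup>+v. F (\<chi> j. b j + c j * v $ j) \<partial>lborel) \<le> (\<integral>\<^sup>+v. F v \<partial>lborel)"
proof (cases "\<forall>j. c j \<noteq> 0")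
  case False
  then have eq: "(\<Prod>j\<in>UNIV. \<bar>c j\<bar>) = 0" by auto
  show ?thesis unfolding eq by simp
next
  case True
  have bij: "bij_betw (\<lambda>i. axis i 1 :: real ^ 'm) UNIV Basis"
    by (auto simp: bij_betw_def inj_on_def axis_eq_axis Basis_vec_def)
  \<comment> \<open>The affine formula for \<open>lborel\<close> takes its scaling factors indexed
    by basis vectors, so \<open>c\<close> is transported along \<open>axis j 1\<close>.\<close>
  define c' where "c' b = c (THE j. b = axis j 1)" for b :: "real ^ 'm"
  have c': "c' (axis j 1) = c j" for j
    by (simp add: c'_def axis_eq_axis)
  have T: "(\<chi> j. b j) + (\<Sum>e\<in>Basis. (c' e * (x \<bullet> e)) *\<^sub>R e) = (\<chi> j. b j + c j * x $ j)" for x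
  proof -
    have "(\<Sum>e\<in>Basis. (c' e * (x \<bullet> e)) *\<^sub>R e) = (\<Sum>j\<in>UNIV. (c j * x $ j) *\<^sub>R axis j 1)"
      by (subst sum.reindex_bij_betw[OF bij, symmetric]) (simp add: c' inner_axis)
    then show ?thesis
      by (simp add: vec_eq_iff axis_def if_distrib[of "\<lambda>x. _ * x"] cong: if_cong)
  qed
  have P: "(\<Prod>e\<in>Basis. \<bar>c' e\<bar>) = (\<Prod>j\<in>UNIV. \<bar>c j\<bar>)"
    by (subst prod.reindex_bij_betw[OF bij, symmetric]) (simp add: c')
  have "lborel = density (distr lborel borel (\<lambda>x. \<chi> j. b j + c j * x $ j)) (\<lambda>_. (\<Prod>j\<in>UNIV. \<bar>c j\<bar>))"
  proof -
    have "c' e \<noteq> 0" if "e \<in> Basis" for e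
      using that True by (auto simp: Basis_vec_def c')
    from lborel_affine_euclidean[of c' "\<chi> j. b j", OF this] show ?thesis
      unfolding T P .
  qed
  then have "(\<integral>\<^sup>+v. F v \<partial>lborel) = (\<integral>\<^sup>+v. F v \<partial>density (distr lborel borel (\<lambda>x. \<chi> j. b j + c j * x $ j)) (\<lambda>_. (\<Prod>j\<in>UNIV. \<bar>c j\<bar>)))"
    by simp
  also have "\<dots> = ennreal (\<Prod>j\<in>UNIV. \<bar>c j\<bar>) * (\<integral>\<^sup>+v. F (\<chi> j. b j + c j * v $ j) \<partial>lborel)"
    by (simp add: nn_integral_density nn_integral_distr nn_integral_cmult)
  finally show ?thesis by simp
qed

interpretation lborel_product: product_sigma_finite "\<lambda>_. lborel :: 'a::euclidean_space measure" ..

lemma emeasure_lborel_vec_box: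
  assumes [measurable]: "\<And>i. B i \<in> sets borel"
  shows "emeasure lborel {v :: real ^ 'm::finite. \<forall>i. v $ i \<in> B i} = (\<Prod>i\<in>UNIV. emeasure lborel (B i))"
proof -
  have [measurable]: "{v :: real ^ 'm::finite. \<forall>i. v $ i \<in> B i} \<in> sets borel"
    by measurable
  have "emeasure lborel {v :: real ^ 'm. \<forall>i. v $ i \<in> B i}
      = (\<integral>\<^sup>+v. indicator {v :: real ^ 'm. \<forall>i. v $ i \<in> B i} v \<partial>lborel)"
    by simp
  also have "\<dots> = (\<integral>\<^sup>+x. indicator (Pi\<^sub>E UNIV B) x \<partial>PiM UNIV (\<lambda>_::'m. lborel))"
  proof -
    have *: "indicator {v :: real ^ 'm. \<forall>i. v $ i \<in> B i} (\<chi> i. x i) = (indicator (Pi\<^sub>E UNIV B) x :: ennreal)" for x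
      by (auto simp: indicator_def PiE_iff)
    show ?thesis
      unfolding *[symmetric] by (rule nn_integral_lborel_vec) measurable
  qed
  also have "\<dots> = (\<Prod>i\<in>UNIV. emeasure lborel (B i))"
    by (subst nn_integral_indicator) (auto simp: lborel_product.emeasure_PiM intro!: sets_PiM_I_finite)
  finally show ?thesis .
qed

text \<open>Regroups scalar coefficients into \<open>N\<close> vectors: component \<open>j\<close>
  of the \<open>i\<close>-th vector is the coefficient at the index \<open>x\<close> with
  \<open>k x = i\<close> and \<open>snd x = j\<close>. This only relabels coordinates and therefore
  preserves the product measure, as a check on product sets shows.\<close>

lemma nn_integral_PiM_blocks:
  fixes k :: "'a \<times> 'm::finite \<Rightarrow> nat" and F :: "('a \<times> 'm \<Rightarrow> real) \<Rightarrow> ennreal"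
  assumes bij: "bij_betw (\<lambda>x. (k x, snd x)) A ({..<N} \<times> UNIV)"
    and [measurable]: "F \<in> borel_measurable (PiM A (\<lambda>_. lborel))"
  shows "(\<integral>\<^sup>+u. F u \<partial>PiM A (\<lambda>_. lborel))
    = (\<integral>\<^sup>+U. F (\<lambda>x\<in>A. (U (k x) :: real ^ 'm) $ snd x) \<partial>PiM {..<N} (\<lambda>_. lborel))"
proof -
  define \<Psi> where "\<Psi> U = (\<lambda>x\<in>A. (U (k x) :: real ^ 'm) $ snd x)" for U
  have fin: "finite A"
    using bij_betw_finite[OF bij] by simp
  have k: "k x < N" if "x \<in> A" for x
    using bij that by (auto simp: bij_betw_def)
  have \<Psi>[measurable]: "\<Psi> \<in> measurable (PiM {..<N} (\<lambda>_. lborel)) (PiM A (\<lambda>_. lborel))"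
    unfolding \<Psi>_def
  proof (intro measurable_restrict)
    fix x assume "x \<in> A"
    then have "k x \<in> {..<N}"
      by (simp add: k)
    from measurable_component_singleton[OF this, of "\<lambda>_. lborel :: (real ^ 'm) measure"]
    have "(\<lambda>U. U (k x)) \<in> borel_measurable (PiM {..<N} (\<lambda>_. lborel :: (real ^ 'm) measure))"
      by simp
    from measurable_compose[OF this borel_measurable_vec_nth[of "snd x"]]
    show "(\<lambda>U. U (k x) $ snd x) \<in> measurable (PiM {..<N} (\<lambda>_. lborel :: (real ^ 'm) measure)) lborel"
      by simp
  qed
  have "distr (PiM {..<N} (\<lambda>_. lborel)) (PiM A (\<lambda>_. lborel)) \<Psi> = PiM A (\<lambda>_. lborel)"
  proof (rule lborel_product.PiM_eqI[OF fin])
    fix B :: "'a \<times> 'm \<Rightarrow> real set" assume B: "\<And>x. x \<in> A \<Longrightarrow> B x \<in> sets lborel"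
    \<comment> \<open>Inverse of the index bijection; it names the scalar coordinate that sits at
      component \<open>j\<close> of block \<open>i\<close>.\<close>
    define g where "g = the_inv_into A (\<lambda>x. (k x, snd x))"
    have g: "g (k x, snd x) = x" if "x \<in> A" for x
      using the_inv_into_f_f[of "\<lambda>x. (k x, snd x)" A x] bij that by (auto simp: bij_betw_def g_def)
    have gA: "g (i, j) \<in> A" "k (g (i, j)) = i" "snd (g (i, j)) = j" if "i < N" for i j
    proof -
      have "(i, j) \<in> (\<lambda>x. (k x, snd x)) ` A"
        using bij that by (simp add: bij_betw_def)
      then obtain x where "x \<in> A" "(i, j) = (k x, snd x)" by (rule imageE)
      then show "g (i, j) \<in> A" "k (g (i, j)) = i" "snd (g (i, j)) = j" using g by auto
    qed
    have "\<Psi> -` Pi\<^sub>E A B \<inter> space (PiM {..<N} (\<lambda>_. lborel))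
        = Pi\<^sub>E {..<N} (\<lambda>i. {v :: real ^ 'm. \<forall>j. v $ j \<in> B (g (i, j))})" (is "?L = ?R")
    proof (intro set_eqI iffI)
      fix U assume U: "U \<in> ?L"
      have "U i $ j \<in> B (g (i, j))" if "i < N" for i j
        using U gA[OF that, of j] by (auto simp: \<Psi>_def PiE_iff dest!: bspec[where x = "g (i, j)"])
      then show "U \<in> ?R"
        using U by (auto simp: space_PiM PiE_iff)
    next
      fix U assume U: "U \<in> ?R"
      have "U (k x) $ snd x \<in> B x" if "x \<in> A" for x
      proof -
        have "U (k x) $ snd x \<in> B (g (k x, snd x))"
          using U k[OF that] by (simp add: PiE_iff)
        then show ?thesis by (simp only: g[OF that])
      qed
      then show "U \<in> ?L"
        using U by (auto simp: space_PiM PiE_iff \<Psi>_def)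
    qed
    then have "emeasure (distr (PiM {..<N} (\<lambda>_. lborel)) (PiM A (\<lambda>_. lborel)) \<Psi>) (Pi\<^sub>E A B)
        = emeasure (PiM {..<N} (\<lambda>_. lborel)) (Pi\<^sub>E {..<N} (\<lambda>i. {v :: real ^ 'm. \<forall>j. v $ j \<in> B (g (i, j))}))"
      using B fin by (subst emeasure_distr) (auto intro!: sets_PiM_I_finite)
    also have "\<dots> = (\<Prod>i<N. \<Prod>j\<in>UNIV. emeasure lborel (B (g (i, j))))"
    proof -
      have [measurable]: "B (g (i, j)) \<in> sets borel" if "i < N" for i j
        using B[OF gA(1)[OF that]] by simp
      have "{v :: real ^ 'm. \<forall>j. v $ j \<in> B (g (i, j))} \<in> sets borel" if "i < N" for i
        using that by measurable
      then show ?thesis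
        by (subst lborel_product.emeasure_PiM) (auto intro!: prod.cong emeasure_lborel_vec_box)
    qed
    also have "\<dots> = (\<Prod>p\<in>{..<N} \<times> UNIV. emeasure lborel (B (g p)))"
      by (simp add: prod.cartesian_product)
    also have "\<dots> = (\<Prod>x\<in>A. emeasure lborel (B x))"
      by (subst prod.reindex_bij_betw[OF bij, symmetric]) (simp add: g)
    finally show "emeasure (distr (PiM {..<N} (\<lambda>_. lborel)) (PiM A (\<lambda>_. lborel)) \<Psi>) (Pi\<^sub>E A B)
        = (\<Prod>x\<in>A. emeasure lborel (B x))" .
  qed simp
  then have "(\<integral>\<^sup>+u. F u \<partial>PiM A (\<lambda>_. lborel))
      = (\<integral>\<^sup>+u. F u \<partial>distr (PiM {..<N} (\<lambda>_. lborel)) (PiM A (\<lambda>_. lborel)) \<Psi>)"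
    by simp
  also have "\<dots> = (\<integral>\<^sup>+U. F (\<Psi> U) \<partial>PiM {..<N} (\<lambda>_. lborel))"
    by (rule nn_integral_distr) simp_all
  finally show ?thesis
    unfolding \<Psi>_def .
qed

subsection \<open>Elimination\<close>

text \<open>
  Newton interpolation: unless a pivot vanishes, \<open>eliminate \<phi> l s j k\<close> is the function in
  \<open>\<phi> j k + span {\<phi> j i | i < l}\<close> with zeros at \<open>s 0, \<dots>, s (l - 1)\<close>. The division by \<open>0\<close> at a vanishing pivot
  is harmless because that pivot is a factor of the weight in all estimates.
\<close>

fun eliminate :: "('m \<Rightarrow> nat \<Rightarrow> 't \<Rightarrow> real) \<Rightarrow> nat \<Rightarrow> (nat \<Rightarrow> 't) \<Rightarrow> 'm \<Rightarrow> nat \<Rightarrow> 't \<Rightarrow> real" where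
  "eliminate \<phi> 0 s j k t = \<phi> j k t"
| "eliminate \<phi> (Suc l) s j k t = eliminate \<phi> l s j k t
     - eliminate \<phi> l s j k (s l) / eliminate \<phi> l s j l (s l) * eliminate \<phi> l s j l t"

text \<open>For each \<open>j\<close>, the factors at \<open>t = s i\<close> are the diagonal
  entries of the triangular matrix that column operations make of the matrix of the
  \<open>\<phi> j k (s i)\<close>. When none of them vanishes, the product of
  \<open>pivot \<phi> i s (s i)\<close> over \<open>i\<close> is therefore the product of the
  alternants.\<close>

definition pivot :: "('m::finite \<Rightarrow> nat \<Rightarrow> 't \<Rightarrow> real) \<Rightarrow> nat \<Rightarrow> (nat \<Rightarrow> 't) \<Rightarrow> 't \<Rightarrow> real" where
  "pivot \<phi> i s t = (\<Prod>j\<in>UNIV. eliminate \<phi> i s j i t)"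

text \<open>Induction downward in \<open>l\<close>. For fixed other blocks, the argument of
  \<open>F l\<close> is a diagonal affine function of \<open>U l\<close> with determinant
  \<open>pivot \<phi> l s (s l)\<close>. Taking this argument as the new variable \<open>v\<close>
  turns the other arguments into the same expression with \<open>eliminate\<close> one stage further
  and offsets that depend on \<open>v\<close>; hence \<open>b\<close> is arbitrary.\<close>

lemma nn_integral_eliminate_le:
  fixes F :: "nat \<Rightarrow> real ^ 'm::finite \<Rightarrow> ennreal"
  assumes "\<And>i. F i \<in> borel_measurable borel" "l \<le> N"
  shows "(\<Prod>i\<in>{l..<N}. ennreal \<bar>pivot \<phi> i s (s i)\<bar>) *
      (\<integral>\<^sup>+U. (\<Prod>i\<in>{l..<N}. F i (\<chi> j. b i j + (\<Sum>k\<in>{l..<N}. U k $ j * eliminate \<phi> l s j k (s i))))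
         \<partial>PiM {l..<N} (\<lambda>_. lborel))
    \<le> (\<Prod>i\<in>{l..<N}. \<integral>\<^sup>+v. F i v \<partial>lborel)"
  using assms(2)
proof (induction l arbitrary: b rule: inc_induct)
  case base
  then show ?case by (simp add: space_PiM_empty)
next
  case (step l)
  note assms(1)[measurable]
  let ?e = "eliminate \<phi> l s"
  let ?e' = "eliminate \<phi> (Suc l) s"
  let ?I = "{Suc l..<N}"
  have I: "{l..<N} = insert l ?I" "l \<notin> ?I"
    using step.hyps by auto
  show ?case
  proof (cases "pivot \<phi> l s (s l) = 0")
    case True
    then show ?thesis by (simp add: I prod.insert_if)
  next
    case False
    then have nz: "?e j l (s l) \<noteq> 0" for j
      by (auto simp: pivot_def)
    \<comment> \<open>The offset in the \<open>i\<close>-th argument after \<open>U l\<close> has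
      been eliminated by prescribing the value \<open>v\<close> of the \<open>j\<close>-th component
      at \<open>s l\<close>.\<close>
    define c where "c i j v = b i j + (v - b l j) / ?e j l (s l) * ?e j l (s i)" for i j and v :: real
    let ?P = "\<Prod>i\<in>?I. ennreal \<bar>pivot \<phi> i s (s i)\<bar>"
    let ?G = "\<lambda>v U. \<Prod>i\<in>?I. F i (\<chi> j. c i j (v $ j) + (\<Sum>k\<in>?I. U k $ j * ?e' j k (s i)))"
    have Gm[measurable]: "(\<lambda>(U, v). ?G v U) \<in> borel_measurable (PiM ?I (\<lambda>_. lborel) \<Otimes>\<^sub>M lborel)"
      unfolding c_def by measurable
    have "(\<lambda>(v, U). ?G v U) \<in> borel_measurable (lborel \<Otimes>\<^sub>M PiM ?I (\<lambda>_. lborel))"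
      unfolding c_def by measurable
    from sigma_finite_measure.borel_measurable_nn_integral[OF lborel_product.sigma_finite this]
    have [measurable]: "(\<lambda>v. \<integral>\<^sup>+U. ?G v U \<partial>PiM ?I (\<lambda>_. lborel)) \<in> borel_measurable borel"
      by simp
    have "(\<integral>\<^sup>+U. (\<Prod>i\<in>{l..<N}. F i (\<chi> j. b i j + (\<Sum>k\<in>{l..<N}. U k $ j * ?e j k (s i))))
         \<partial>PiM {l..<N} (\<lambda>_. lborel))
       = (\<integral>\<^sup>+U. \<integral>\<^sup>+v. F l (\<chi> j. b l j + (\<Sum>k\<in>?I. U k $ j * ?e j k (s l)) + ?e j l (s l) * v $ j)
             * ?G (\<chi> j. b l j + (\<Sum>k\<in>?I. U k $ j * ?e j k (s l)) + ?e j l (s l) * v $ j) U \<partial>lborel \<partial>PiM ?I (\<lambda>_. lborel))"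
      (is "?L = ?M")
    proof -
      have *: "(\<Prod>i\<in>{l..<N}. F i (\<chi> j. b i j + (\<Sum>k\<in>{l..<N}. (U(l := v)) k $ j * ?e j k (s i))))
        = F l (\<chi> j. b l j + (\<Sum>k\<in>?I. U k $ j * ?e j k (s l)) + ?e j l (s l) * v $ j)
             * ?G (\<chi> j. b l j + (\<Sum>k\<in>?I. U k $ j * ?e j k (s l)) + ?e j l (s l) * v $ j) U" for U and v :: "real ^ 'm"
      proof -
        have sum: "(\<Sum>k\<in>{l..<N}. (U(l := v)) k $ j * ?e j k (s i)) = v $ j * ?e j l (s i) + (\<Sum>k\<in>?I. U k $ j * ?e j k (s i))" for i j
          unfolding I(1) by (simp add: sum.insert_if)
        have "c i j (b l j + (\<Sum>k\<in>?I. U k $ j * ?e j k (s l)) + ?e j l (s l) * v $ j) + (\<Sum>k\<in>?I. U k $ j * ?e' j k (s i))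
            = b i j + (v $ j * ?e j l (s i) + (\<Sum>k\<in>?I. U k $ j * ?e j k (s i)))" for i j
          using nz[of j] unfolding c_def
          by (simp add: algebra_simps sum_subtractf add_divide_distrib sum_divide_distrib sum_distrib_right sum_distrib_left)
        then show ?thesis
          unfolding sum unfolding I(1) by (simp add: prod.insert_if algebra_simps)
      qed
      show ?thesis
        unfolding *[symmetric] unfolding I(1)
        by (subst lborel_product.product_nn_integral_insert) auto
    qed
    then have "ennreal \<bar>pivot \<phi> l s (s l)\<bar> * ?L = (\<integral>\<^sup>+U. ennreal \<bar>pivot \<phi> l s (s l)\<bar> * (\<integral>\<^sup>+v. F l (\<chi> j. b l j + (\<Sum>k\<in>?I. U k $ j * ?e j k (s l)) + ?e j l (s l) * v $ j)
             * ?G (\<chi> j. b l j + (\<Sum>k\<in>?I. U k $ j * ?e j k (s l)) + ?e j l (s l) * v $ j) U \<partial>lborel) \<partial>PiM ?I (\<lambda>_. lborel))"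
      unfolding c_def by (simp add: nn_integral_cmult)
    also have "\<dots> \<le> (\<integral>\<^sup>+U. \<integral>\<^sup>+v. F l v * ?G v U \<partial>lborel \<partial>PiM ?I (\<lambda>_. lborel))"
    proof (rule nn_integral_mono)
      fix U :: "nat \<Rightarrow> real ^ 'm"
      have m: "(\<lambda>v. F l v * ?G v U) \<in> borel_measurable borel"
        unfolding c_def by measurable
      show "ennreal \<bar>pivot \<phi> l s (s l)\<bar> * (\<integral>\<^sup>+v. F l (\<chi> j. b l j + (\<Sum>k\<in>?I. U k $ j * ?e j k (s l)) + ?e j l (s l) * v $ j)
             * ?G (\<chi> j. b l j + (\<Sum>k\<in>?I. U k $ j * ?e j k (s l)) + ?e j l (s l) * v $ j) U \<partial>lborel)
        \<le> (\<integral>\<^sup>+v. F l v * ?G v U \<partial>lborel)"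
        using nn_integral_lborel_vec_affine[OF m, of "\<lambda>j. ?e j l (s l)" "\<lambda>j. b l j + (\<Sum>k\<in>?I. U k $ j * ?e j k (s l))"]
        by (simp add: pivot_def abs_prod)
    qed
    \<comment> \<open>The variable \<open>v\<close> moves outside so that the induction hypothesis
      applies to the inner integral for each fixed \<open>v\<close>, with offsets
      \<open>c i j (v $ j)\<close>.\<close>
    also have "\<dots> = (\<integral>\<^sup>+v. \<integral>\<^sup>+U. F l v * ?G v U \<partial>PiM ?I (\<lambda>_. lborel) \<partial>lborel)"
      by (rule pair_sigma_finite.Fubini'[symmetric])
         (auto intro!: pair_sigma_finite.intro lborel_product.sigma_finite sigma_finite_lborel simp: c_def)
    also have "\<dots> = (\<integral>\<^sup>+v. F l v * (\<integral>\<^sup>+U. ?G v U \<partial>PiM ?I (\<lambda>_. lborel)) \<partial>lborel)"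
      by (intro nn_integral_cong nn_integral_cmult) (simp add: c_def)
    finally have 1: "ennreal \<bar>pivot \<phi> l s (s l)\<bar> * ?L \<le> \<dots>" .
    have "?P * (ennreal \<bar>pivot \<phi> l s (s l)\<bar> * ?L) \<le> ?P * (\<integral>\<^sup>+v. F l v * (\<integral>\<^sup>+U. ?G v U \<partial>PiM ?I (\<lambda>_. lborel)) \<partial>lborel)"
      by (intro mult_left_mono 1) simp
    also have "\<dots> = (\<integral>\<^sup>+v. F l v * (?P * (\<integral>\<^sup>+U. ?G v U \<partial>PiM ?I (\<lambda>_. lborel))) \<partial>lborel)"
      by (subst nn_integral_cmult[symmetric]) (auto intro!: nn_integral_cong simp: ac_simps simp del: eliminate.simps)
    also have "\<dots> \<le> (\<integral>\<^sup>+v. F l v * (\<Prod>i\<in>?I. \<integral>\<^sup>+v. F i v \<partial>lborel) \<partial>lborel)"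
      by (intro nn_integral_mono mult_left_mono step.IH) simp
    also have "\<dots> = (\<Prod>i\<in>{l..<N}. \<integral>\<^sup>+v. F i v \<partial>lborel)"
      by (simp add: nn_integral_multc I prod.insert_if)
    finally show ?thesis
      by (simp add: I prod.insert_if ac_simps)
  qed
qed

subsection \<open>Sublevel sets of polynomials\<close>

lemma prod_mset_gt_power:
  fixes f :: "'a \<Rightarrow> real"
  assumes "r \<ge> 0" "\<And>a. a \<in># A \<Longrightarrow> r < f a"
  shows "r ^ size A \<le> (\<Prod>a\<in>#A. f a) \<and> (A \<noteq> {#} \<longrightarrow> r ^ size A < (\<Prod>a\<in>#A. f a))"
  using assms(2)
proof (induction A)
  case (add a A)
  show ?case
  proof (cases "A = {#}")
    case False
    then have "r ^ size A < (\<Prod>a\<in>#A. f a)" using add by simp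
    then have "r * r ^ size A < f a * (\<Prod>a\<in>#A. f a)"
      using assms(1) add.prems[of a] by (intro mult_strict_mono') auto
    then show ?thesis by simp
  qed (use add in auto)
qed simp

text \<open>Over the complex numbers \<open>p\<close> splits, so \<open>\<bar>poly p x\<bar>\<close>
  is \<open>\<bar>lead_coeff p\<bar>\<close> times the product of the distances from
  \<open>x\<close> to the roots. On the sublevel set some root has distance at most
  \<open>r\<close>, since otherwise the product would exceed \<open>M\<close>. Projecting the roots
  to the real line leaves at most \<open>b\<close> intervals of length \<open>2 * r\<close>.\<close>

lemma emeasure_poly_sublevel_le:
  fixes p :: "real poly"
  assumes b: "degree p = b" "b > 0" and M: "M \<ge> 0"
  shows "emeasure lborel {x. \<bar>poly p x\<bar> \<le> M} \<le> ennreal (2 * real b * root b (M / \<bar>lead_coeff p\<bar>))"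
proof -
  define r where "r = root b (M / \<bar>lead_coeff p\<bar>)"
  have r: "r \<ge> 0" using M b by (simp add: r_def)
  have p0: "p \<noteq> 0" using b by auto
  let ?q = "map_poly complex_of_real p"
  have "?q \<noteq> 0" using p0 by (simp add: map_poly_eq_0_iff)
  from alg_closed_imp_factorization[OF this] obtain A
    where A: "size A = degree ?q" "?q = smult (lead_coeff ?q) (\<Prod>x\<in>#A. [:-x, 1:])" by auto
  have deg: "degree ?q = b" using b by (simp add: degree_map_poly)
  have "{x. \<bar>poly p x\<bar> \<le> M} \<subseteq> (\<Union>a\<in>set_mset A. {Re a - r..Re a + r})"
  proof
    fix x assume "x \<in> {x. \<bar>poly p x\<bar> \<le> M}"
    then have x: "\<bar>poly p x\<bar> \<le> M" by simp
    have "complex_of_real (poly p x) = poly ?q (of_real x)"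
      by (induction p) (simp_all add: map_poly_pCons)
    also have "\<dots> = of_real (lead_coeff p) * (\<Prod>a\<in>#A. of_real x - a)"
      by (subst A(2)) (simp add: deg b poly_prod_mset coeff_map_poly image_mset.compositionality comp_def)
    finally have "cmod (complex_of_real (poly p x)) = cmod (of_real (lead_coeff p) * (\<Prod>a\<in>#A. of_real x - a))"
      by simp
    also have "\<dots> = \<bar>lead_coeff p\<bar> * (\<Prod>a\<in>#A. cmod (of_real x - a))"
    proof -
      have "cmod (\<Prod>a\<in>#B. of_real x - a) = (\<Prod>a\<in>#B. cmod (of_real x - a))" for B
        by (induction B) (auto simp: norm_mult)
      then show ?thesis by (simp add: norm_mult)
    qed
    finally have eq: "\<bar>poly p x\<bar> = \<bar>lead_coeff p\<bar> * (\<Prod>a\<in>#A. cmod (of_real x - a))" by simp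
    have "\<exists>a\<in>#A. cmod (of_real x - a) \<le> r"
    proof (rule ccontr)
      assume "\<not> ?thesis"
      then have "r ^ size A < (\<Prod>a\<in>#A. cmod (of_real x - a))"
        using prod_mset_gt_power[OF r, of A "\<lambda>a. cmod (of_real x - a)"] A(1) deg b by fastforce
      then have "\<bar>lead_coeff p\<bar> * r ^ b < \<bar>poly p x\<bar>"
        unfolding eq using p0 A(1) deg by simp
      moreover have "r ^ b = M / \<bar>lead_coeff p\<bar>"
        using b M by (simp add: r_def real_root_pow_pos2)
      ultimately show False using x p0 by simp
    qed
    then obtain a where a: "a \<in># A" "cmod (of_real x - a) \<le> r" by auto
    have "\<bar>x - Re a\<bar> \<le> r"
      using a(2) abs_Re_le_cmod[of "of_real x - a"] by simp
    then show "x \<in> (\<Union>a\<in>set_mset A. {Re a - r..Re a + r})" using a(1) by (auto simp: abs_le_iff intro!: bexI[of _ a])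
  qed
  then have "emeasure lborel {x. \<bar>poly p x\<bar> \<le> M} \<le> emeasure lborel (\<Union>a\<in>set_mset A. {Re a - r..Re a + r})"
    by (intro emeasure_mono) auto
  also have "\<dots> \<le> (\<Sum>a\<in>set_mset A. emeasure lborel {Re a - r..Re a + r})"
    by (intro emeasure_subadditive_finite) auto
  also have "\<dots> = ennreal (real (card (set_mset A)) * (2 * r))"
    using r by (simp add: ennreal_mult ennreal_of_nat_eq_real_of_nat)
  also have "\<dots> \<le> ennreal (2 * real b * r)"
  proof -
    have "card (set_mset A) \<le> b"
    proof -
      have "card (set_mset B) \<le> size B" for B :: "complex multiset"
        by (induction B) (auto simp: card_insert_if)
      then show ?thesis using A(1) deg by metis
    qed
    then have "real (card (set_mset A)) * (2 * r) \<le> real b * (2 * r)"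
      using r by (intro mult_right_mono) auto
    then show ?thesis by (intro ennreal_leI) simp
  qed
  finally show ?thesis unfolding r_def .
qed

lemma borel_measurable_poly[measurable (raw)]:
  fixes p :: "real poly"
  assumes [measurable]: "f \<in> borel_measurable M"
  shows "(\<lambda>x. poly p (f x)) \<in> borel_measurable M"
  by (rule measurable_compose[OF assms]) (intro borel_measurable_continuous_onI continuous_intros)

text \<open>If the left set is nonempty, the sublevel set of the monomials is the whole line or a
  symmetric interval whose radius is the smallest of the individual radii. The left set lies in the
  sublevel set of the one polynomial attaining this radius, so the bound for a single polynomial
  suffices.\<close>

lemma emeasure_poly_sublevels_le_monom:
  fixes p :: "'i \<Rightarrow> real poly"
  assumes I: "finite I" and deg: "\<And>i. i \<in> I \<Longrightarrow> degree (p i) \<le> b i"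
  shows "emeasure lborel {y. \<forall>i\<in>I. \<bar>poly (p i) y\<bar> \<le> M i}
    \<le> ennreal (1 + real (\<Sum>i\<in>I. b i)) * emeasure lborel {y. \<forall>i\<in>I. \<bar>coeff (p i) (b i) * y ^ b i\<bar> \<le> M i}"
    (is "emeasure _ ?L \<le> ?K * emeasure _ ?R")
proof (cases "?L = {}")
  case False
  then obtain y0 where y0: "\<forall>i\<in>I. \<bar>poly (p i) y0\<bar> \<le> M i" by auto
  have M: "M i \<ge> 0" if "i \<in> I" for i
    using y0 that abs_ge_zero order_trans by blast
  define a where "a i = coeff (p i) (b i)" for i
  \<comment> \<open>The indices whose monomial condition actually restricts
    \<open>y\<close>.\<close>
  define J where "J = {i\<in>I. b i > 0 \<and> a i \<noteq> 0}"
  define r where "r i = root (b i) (M i / \<bar>a i\<bar>)" for i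
  \<comment> \<open>For \<open>b i = 0\<close> the polynomial is a constant, already bounded by
    \<open>M i\<close> at the point \<open>y0\<close>; otherwise the coefficient \<open>a i\<close>
    is \<open>0\<close>.\<close>
  have outside: "\<bar>a i * y ^ b i\<bar> \<le> M i" if "i \<in> I - J" for i y
  proof (cases "b i = 0")
    case True
    then have "degree (p i) = 0" using deg[of i] that by auto
    then have "poly (p i) y0 = coeff (p i) 0" by (metis degree_0_id poly_const_conv)
    then show ?thesis using True y0 that by (auto simp: a_def)
  next
    case False
    then show ?thesis using M that by (auto simp: J_def)
  qed
  show ?thesis
  proof (cases "J = {}")
    case True
    \<comment> \<open>The right side is infinite here, because the summand \<open>1\<close> keeps
      the factor \<open>?K\<close> nonzero.\<close>
    then have "?R = UNIV" using outside by (auto simp: a_def)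
    then show ?thesis 
      using sum_nonneg[of I "\<lambda>i. real (b i)"] by (auto simp: ennreal_mult_eq_top_iff ennreal_mult_top)
  next
    case False
    have "finite J" using I by (simp add: J_def)
    from arg_min_if_finite[OF this False, of r]
    obtain k where k: "k \<in> J" "\<And>i. i \<in> J \<Longrightarrow> r k \<le> r i"
      by (meson not_le)
    have rk: "0 \<le> r k" using k(1) M by (auto simp: r_def J_def)
    have "{- r k..r k} \<subseteq> ?R"
    proof
      fix y assume y: "y \<in> {- r k..r k}"
      have "\<bar>a i * y ^ b i\<bar> \<le> M i" if "i \<in> J" for i
      proof -
        have "\<bar>y\<bar> ^ b i \<le> r i ^ b i"
          using y k(2)[OF that] by (intro power_mono) auto
        also have "\<dots> = M i / \<bar>a i\<bar>"
          using that M by (simp add: r_def J_def real_root_pow_pos2)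
        finally show ?thesis
          using that by (simp add: J_def abs_mult power_abs field_simps)
      qed
      then show "y \<in> ?R" using outside by (auto simp: a_def)
    qed
    then have "emeasure lborel {- r k..r k} \<le> emeasure lborel ?R"
      by (intro emeasure_mono) (use I in measurable)
    then have R: "ennreal (2 * r k) \<le> emeasure lborel ?R"
      using rk by simp
    have kI: "k \<in> I" "b k > 0" "a k \<noteq> 0" using k(1) by (auto simp: J_def)
    have dk: "degree (p k) = b k"
      using deg[OF kI(1)] kI(3) le_degree[of "p k" "b k"] by (auto simp: a_def)
    have "emeasure lborel ?L \<le> emeasure lborel {y. \<bar>poly (p k) y\<bar> \<le> M k}"
      using kI by (intro emeasure_mono) auto
    also have "\<dots> \<le> ennreal (2 * real (b k) * r k)"
      using emeasure_poly_sublevel_le[OF dk kI(2) M[OF kI(1)]] by (simp add: r_def a_def dk)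
    also have "\<dots> \<le> ennreal ((1 + real (\<Sum>i\<in>I. b i)) * (2 * r k))"
    proof (rule ennreal_leI)
      have "b k \<le> (\<Sum>i\<in>I. b i)" using I kI(1) by (intro member_le_sum) auto
      then have "real (b k) \<le> 1 + real (\<Sum>i\<in>I. b i)" by linarith
      from mult_right_mono[OF this, of "2 * r k"] rk
      show "2 * real (b k) * r k \<le> (1 + real (\<Sum>i\<in>I. b i)) * (2 * r k)" by (simp add: mult_ac)
    qed
    also have "\<dots> = ?K * ennreal (2 * r k)"
      using rk by (subst ennreal_mult) (auto intro!: add_nonneg_nonneg sum_nonneg)
    also have "\<dots> \<le> ?K * emeasure lborel ?R"
      by (intro mult_left_mono R) simp
    finally show ?thesis .
  qed
next
  case True
  then have "emeasure lborel ?L = 0" by (simp only: emeasure_empty)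
  then show ?thesis by (simp only: zero_le)
qed

section \<open>Functions with a prescribed leading monomial\<close>

text \<open>
  \<open>lead ks b f\<close>: the leading monomial of \<open>f\<close> has exponents \<open>b\<close> and coefficient \<open>1\<close>, where the variables \<open>ks\<close> are listed
  from the most to the least significant. Non-leading coefficients may be arbitrary functions of the
  remaining variables, since the estimates never see them.
\<close>

fun lead :: "'n list \<Rightarrow> ('n \<Rightarrow> nat) \<Rightarrow> (('n \<Rightarrow> real) \<Rightarrow> real) \<Rightarrow> bool" where
  "lead [] b f \<longleftrightarrow> (\<forall>x. f x = 1)"
| "lead (k # ks) b f \<longleftrightarrow>
     f \<in> borel_measurable (PiM (set (k # ks)) (\<lambda>_. lborel)) \<and>
     (\<exists>p. (\<forall>x. degree (p x) \<le> b k) \<and> (\<forall>x y. p (x(k := y)) = p x) \<and>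
          (\<forall>x. f x = poly (p x) (x k)) \<and> lead ks b (\<lambda>x. coeff (p x) (b k)))"

lemma lead_measurable:
  assumes "lead ks b f"
  shows "f \<in> borel_measurable (PiM (set ks) (\<lambda>_. lborel))"
proof (cases ks)
  case Nil
  then have "f = (\<lambda>_. 1)" using assms by auto
  then show ?thesis by simp
qed (use assms in auto)

lemma lead_one: "lead ks (\<lambda>_. 0) (\<lambda>_. 1)"
proof (induction ks)
  case (Cons k ks)
  then show ?case by (auto intro!: exI[of _ "\<lambda>_. 1"])
qed simp

text \<open>\<open>m\<close> and \<open>n\<close> are mere degree bounds, as in \<open>lead\<close>.
  In the convolution sum every index other than \<open>m\<close> exceeds one of the two
  bounds.\<close>

lemma coeff_mult_degree_le:
  assumes "degree p \<le> m" "degree q \<le> n"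
  shows "coeff (p * q) (m + n) = coeff p m * coeff q n"
proof -
  have "coeff (p * q) (m + n) = (\<Sum>i\<le>m + n. coeff p i * coeff q (m + n - i))"
    by (rule coeff_mult)
  also have "\<dots> = (\<Sum>i\<in>{m}. coeff p i * coeff q (m + n - i))"
  proof (rule sum.mono_neutral_right)
    show "\<forall>i\<in>{..m + n} - {m}. coeff p i * coeff q (m + n - i) = 0"
    proof
      fix i assume "i \<in> {..m + n} - {m}"
      then have "i > m \<or> m + n - i > n" by auto
      then show "coeff p i * coeff q (m + n - i) = 0"
        using assms by (auto simp: coeff_eq_0)
    qed
  qed auto
  finally show ?thesis by simp
qed

lemma lead_mult: "lead ks b f \<Longrightarrow> lead ks b' g \<Longrightarrow> lead ks (\<lambda>k. b k + b' k) (\<lambda>x. f x * g x)"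
proof (induction ks arbitrary: f g)
  case (Cons k ks)
  from Cons.prems(1) obtain p where p: "\<And>x. degree (p x) \<le> b k" "\<And>x y. p (x(k := y)) = p x"
    "\<And>x. f x = poly (p x) (x k)" "lead ks b (\<lambda>x. coeff (p x) (b k))" by auto
  from Cons.prems(2) obtain q where q: "\<And>x. degree (q x) \<le> b' k" "\<And>x y. q (x(k := y)) = q x"
    "\<And>x. g x = poly (q x) (x k)" "lead ks b' (\<lambda>x. coeff (q x) (b' k))" by auto
  note [measurable] = lead_measurable[OF Cons.prems(1)] lead_measurable[OF Cons.prems(2)]
  have "(\<lambda>x. f x * g x) \<in> borel_measurable (PiM (set (k # ks)) (\<lambda>_. lborel))"
    by measurable
  moreover have "degree (p x * q x) \<le> b k + b' k" for x
    using degree_mult_le[of "p x" "q x"] p(1)[of x] q(1)[of x] by linarith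
  moreover have "lead ks (\<lambda>k. b k + b' k) (\<lambda>x. coeff (p x * q x) (b k + b' k))"
    using Cons.IH[OF p(4) q(4)] by (simp add: coeff_mult_degree_le p q)
  ultimately show ?case
    by (auto intro!: exI[of _ "\<lambda>x. p x * q x"] simp: p q)
qed simp

lemma lead_prod:
  assumes "finite J" "\<And>j. j \<in> J \<Longrightarrow> lead ks (b j) (f j)"
  shows "lead ks (\<lambda>k. \<Sum>j\<in>J. b j k) (\<lambda>x. \<Prod>j\<in>J. f j x)"
  using assms by (induction J rule: finite_induct) (auto simp: lead_one intro: lead_mult)

text \<open>The strict dictionary order, by recursion on the list of variables so that inductions
  run in parallel with those on \<open>lead\<close>.\<close>

primrec lex_less :: "'n list \<Rightarrow> ('n \<Rightarrow> nat) \<Rightarrow> ('n \<Rightarrow> nat) \<Rightarrow> bool" where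
  "lex_less [] \<gamma> \<alpha> \<longleftrightarrow> False"
| "lex_less (k # ks) \<gamma> \<alpha> \<longleftrightarrow> \<gamma> k < \<alpha> k \<or> \<gamma> k = \<alpha> k \<and> lex_less ks \<gamma> \<alpha>"

lemma lex_less_hd_le: "lex_less (k # ks) \<gamma> \<alpha> \<Longrightarrow> \<gamma> k \<le> \<alpha> k"
  by auto

text \<open>In the most significant variable a lower monomial has either a smaller exponent, and
  then it does not reach the top coefficient, or the same one, and then it is lower in the remaining
  variables. So the top coefficient has the same shape with a subfamily of the lower terms, and the
  recursion of \<open>lead\<close> closes.\<close>

lemma lead_monom_plus_lower:
  assumes "finite S" "distinct ks" "\<And>s. s \<in> S \<Longrightarrow> lex_less ks (e s) \<alpha>"
  shows "lead ks \<alpha> (\<lambda>x. (\<Prod>k\<in>set ks. x k ^ \<alpha> k) + (\<Sum>s\<in>S. c s * (\<Prod>k\<in>set ks. x k ^ e s k)))"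
  using assms
proof (induction ks arbitrary: S)
  case Nil
  then have "S = {}" by auto
  then show ?case by simp
next
  case (Cons k ks)
  have k: "k \<notin> set ks" using Cons.prems by simp
  let ?m = "\<lambda>\<gamma> x. \<Prod>i\<in>set ks. (x i :: real) ^ \<gamma> i"
  define p where "p x = monom (?m \<alpha> x) (\<alpha> k) + (\<Sum>s\<in>S. monom (c s * ?m (e s) x) (e s k))" for x
  have "degree (p x) \<le> \<alpha> k" for x
    unfolding p_def using Cons.prems(1) Cons.prems(3)[THEN lex_less_hd_le]
    by (intro degree_add_le degree_sum_le degree_monom_le order_trans[OF degree_monom_le]) auto
  moreover have "p (x(k := y)) = p x" for x y
  proof -
    have "?m \<gamma> (x(k := y)) = ?m \<gamma> x" for \<gamma>
      using k by (intro prod.cong) auto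
    then show ?thesis by (simp add: p_def)
  qed
  moreover have "(\<Prod>i\<in>set (k # ks). x i ^ \<alpha> i) + (\<Sum>s\<in>S. c s * (\<Prod>i\<in>set (k # ks). x i ^ e s i))
      = poly (p x) (x k)" for x
    using k by (simp add: p_def poly_sum poly_monom mult_ac)
  moreover have "lead ks \<alpha> (\<lambda>x. coeff (p x) (\<alpha> k))"
  proof -
    have "coeff (p x) (\<alpha> k) = ?m \<alpha> x + (\<Sum>s\<in>{s \<in> S. e s k = \<alpha> k}. c s * ?m (e s) x)" for x
      using Cons.prems(1) by (simp add: p_def coeff_sum sum.inter_filter)
    moreover have "lead ks \<alpha> (\<lambda>x. ?m \<alpha> x + (\<Sum>s\<in>{s \<in> S. e s k = \<alpha> k}. c s * ?m (e s) x))"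
    proof (rule Cons.IH)
      show "lex_less ks (e s) \<alpha>" if "s \<in> {s \<in> S. e s k = \<alpha> k}" for s
        using Cons.prems(3)[of s] that by auto
    qed (use Cons.prems in auto)
    ultimately show ?thesis by simp
  qed
  moreover have "(\<lambda>x. (\<Prod>i\<in>set (k # ks). x i ^ \<alpha> i) + (\<Sum>s\<in>S. c s * (\<Prod>i\<in>set (k # ks). x i ^ e s i)))
      \<in> borel_measurable (PiM (set (k # ks)) (\<lambda>_. lborel))"
    by measurable
  ultimately show ?case
    unfolding lead.simps by blast
qed

section \<open>Sublevel sets in several variables\<close>

lemma (in product_sigma_finite) product_nn_integral_insert_cmult:
  assumes I: "finite I" "i \<notin> I" and G[measurable]: "G \<in> borel_measurable (PiM (insert i I) M)"
  shows "(\<integral>\<^sup>+y. c * (\<integral>\<^sup>+x. G (x(i := y)) \<partial>PiM I M) \<partial>M i) = c * (\<integral>\<^sup>+x. G x \<partial>PiM (insert i I) M)"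
proof -
  have "(\<lambda>(y, x). G (x(i := y))) \<in> borel_measurable (M i \<Otimes>\<^sub>M PiM I M)"
    by measurable
  from sigma_finite_measure.borel_measurable_nn_integral[OF sigma_finite[OF I(1)] this]
  show ?thesis
    unfolding product_nn_integral_insert_rev[OF I G] by (rule nn_integral_cmult)
qed

text \<open>For fixed remaining variables, the one-dimensional comparison in the variable
  \<open>k\<close> replaces each polynomial by its top term. For fixed \<open>y \<noteq> 0\<close>,
  division by \<open>\<bar>y\<bar> ^ b i k\<close> turns the new condition into a sublevel condition
  on the top coefficients in fewer variables, with changed bounds; hence \<open>M\<close> is
  arbitrary in the induction.\<close>

lemma nn_integral_sublevels_le_monom:
  assumes I: "finite I" and "distinct ks" "\<And>i. i \<in> I \<Longrightarrow> lead ks (b i) (f i)"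
  shows "(\<integral>\<^sup>+x. indicator {x. \<forall>i\<in>I. \<bar>f i x\<bar> \<le> M i} x \<partial>PiM (set ks) (\<lambda>_. lborel))
    \<le> ennreal (\<Prod>k\<in>set ks. 1 + real (\<Sum>i\<in>I. b i k)) *
      (\<integral>\<^sup>+x. indicator {x. \<forall>i\<in>I. (\<Prod>k\<in>set ks. \<bar>x k\<bar> ^ b i k) \<le> M i} x \<partial>PiM (set ks) (\<lambda>_. lborel))"
  using assms(2,3)
proof (induction ks arbitrary: f M)
  case Nil
  then show ?case by simp
next
  case (Cons k ks)
  have k: "k \<notin> set ks" using Cons.prems by simp
  define K where "K ks = (\<Prod>k\<in>set ks. 1 + real (\<Sum>i\<in>I. b i k))" for ks
  have K0: "K ks \<ge> 0" "1 + real (\<Sum>i\<in>I. b i k) \<ge> 0"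
    by (auto simp: K_def intro!: prod_nonneg add_nonneg_nonneg sum_nonneg)
  have K: "K (k # ks) = (1 + real (\<Sum>i\<in>I. b i k)) * K ks"
    using k by (simp add: K_def)
  let ?P = "PiM (set ks) (\<lambda>_. lborel :: real measure)"
  have "\<forall>i\<in>I. \<exists>p. (\<forall>x. degree (p x) \<le> b i k) \<and> (\<forall>x y. p (x(k := y)) = p x) \<and>
          (\<forall>x. f i x = poly (p x) (x k)) \<and> lead ks (b i) (\<lambda>x. coeff (p x) (b i k))"
    using Cons.prems(2) by auto
  from bchoice[OF this] obtain p where P: "\<forall>i\<in>I. (\<forall>x. degree (p i x) \<le> b i k) \<and> (\<forall>x y. p i (x(k := y)) = p i x) \<and>
          (\<forall>x. f i x = poly (p i x) (x k)) \<and> lead ks (b i) (\<lambda>x. coeff (p i x) (b i k))" ..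
  have p: "degree (p i x) \<le> b i k" "p i (x(k := y)) = p i x" "f i x = poly (p i x) (x k)"
    "lead ks (b i) (\<lambda>x. coeff (p i x) (b i k))" if "i \<in> I" for i x y
    using bspec[OF P that] by blast+
  define a where "a i x = coeff (p i x) (b i k)" for i x
  have [measurable]: "f i \<in> borel_measurable (PiM (insert k (set ks)) (\<lambda>_. lborel))"
    "a i \<in> borel_measurable ?P" if "i \<in> I" for i
    using lead_measurable[OF Cons.prems(2)[OF that]] lead_measurable[OF p(4)[OF that]] by (simp_all add: a_def[abs_def])
  have "(\<integral>\<^sup>+x. indicator {x. \<forall>i\<in>I. \<bar>f i x\<bar> \<le> M i} x \<partial>PiM (set (k # ks)) (\<lambda>_. lborel))
      = (\<integral>\<^sup>+x. \<integral>\<^sup>+y. indicator {x. \<forall>i\<in>I. \<bar>f i x\<bar> \<le> M i} (x(k := y)) \<partial>lborel \<partial>?P)"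
    unfolding set_simps using k I
    by (intro lborel_product.product_nn_integral_insert) (auto intro!: borel_measurable_indicator')
  also have "\<dots> = (\<integral>\<^sup>+x. emeasure lborel {y. \<forall>i\<in>I. \<bar>poly (p i x) y\<bar> \<le> M i} \<partial>?P)"
  proof (rule nn_integral_cong)
    fix x
    have "{y. \<forall>i\<in>I. \<bar>poly (p i x) y\<bar> \<le> M i} \<in> sets lborel" using I by measurable
    moreover have "indicator {x. \<forall>i\<in>I. \<bar>f i x\<bar> \<le> M i} (x(k := y)) = (indicator {y. \<forall>i\<in>I. \<bar>poly (p i x) y\<bar> \<le> M i} y :: ennreal)" for y
      by (auto simp: indicator_def p)
    ultimately show "(\<integral>\<^sup>+y. indicator {x. \<forall>i\<in>I. \<bar>f i x\<bar> \<le> M i} (x(k := y)) \<partial>lborel) = emeasure lborel {y. \<forall>i\<in>I. \<bar>poly (p i x) y\<bar> \<le> M i}"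
      by simp
  qed
  also have "\<dots> \<le> (\<integral>\<^sup>+x. ennreal (1 + real (\<Sum>i\<in>I. b i k)) * (\<integral>\<^sup>+y. indicator {y. \<forall>i\<in>I. \<bar>a i x * y ^ b i k\<bar> \<le> M i} y \<partial>lborel) \<partial>?P)"
  proof (rule nn_integral_mono)
    fix x
    have "{y. \<forall>i\<in>I. \<bar>a i x * y ^ b i k\<bar> \<le> M i} \<in> sets lborel" using I by measurable
    then show "emeasure lborel {y. \<forall>i\<in>I. \<bar>poly (p i x) y\<bar> \<le> M i}
      \<le> ennreal (1 + real (\<Sum>i\<in>I. b i k)) * (\<integral>\<^sup>+y. indicator {y. \<forall>i\<in>I. \<bar>a i x * y ^ b i k\<bar> \<le> M i} y \<partial>lborel)"
      using emeasure_poly_sublevels_le_monom[OF I, of "\<lambda>i. p i x" "\<lambda>i. b i k" M] p(1)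
      by (simp add: a_def)
  qed
  also have "\<dots> = ennreal (1 + real (\<Sum>i\<in>I. b i k)) * (\<integral>\<^sup>+x. \<integral>\<^sup>+y. indicator {(x, y). \<forall>i\<in>I. \<bar>a i x * y ^ b i k\<bar> \<le> M i} (x, y) \<partial>lborel \<partial>?P)"
  proof -
    have ind: "indicator {y. \<forall>i\<in>I. \<bar>a i x * y ^ b i k\<bar> \<le> M i} y
      = (indicator {(x, y). \<forall>i\<in>I. \<bar>a i x * y ^ b i k\<bar> \<le> M i} (x, y) :: ennreal)" for x y
      by (simp add: indicator_def)
    have "(\<lambda>(x, y). indicator {(x, y). \<forall>i\<in>I. \<bar>a i x * y ^ b i k\<bar> \<le> M i} (x, y) :: ennreal)
      \<in> borel_measurable (?P \<Otimes>\<^sub>M lborel)"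
      using I by (auto intro!: borel_measurable_indicator')
    then show ?thesis
      unfolding ind
      by (intro nn_integral_cmult sigma_finite_measure.borel_measurable_nn_integral[OF sigma_finite_lborel])
  qed
  \<comment> \<open>From here on \<open>y\<close> is fixed first and the remaining variables are
    integrated inside.\<close>
  also have "(\<integral>\<^sup>+x. \<integral>\<^sup>+y. indicator {(x, y). \<forall>i\<in>I. \<bar>a i x * y ^ b i k\<bar> \<le> M i} (x, y) \<partial>lborel \<partial>?P)
     = (\<integral>\<^sup>+y. \<integral>\<^sup>+x. indicator {(x, y). \<forall>i\<in>I. \<bar>a i x * y ^ b i k\<bar> \<le> M i} (x, y) \<partial>?P \<partial>lborel)"
    by (rule pair_sigma_finite.Fubini'[symmetric])
       (use I in \<open>auto intro!: pair_sigma_finite.intro lborel_product.sigma_finite sigma_finite_lborel borel_measurable_indicator'\<close>)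
  also have "\<dots> \<le> (\<integral>\<^sup>+y. ennreal (K ks) * (\<integral>\<^sup>+x. indicator {x. \<forall>i\<in>I. (\<Prod>k\<in>set (k # ks). \<bar>x k\<bar> ^ b i k) \<le> M i} (x(k := y)) \<partial>?P) \<partial>lborel)"
  proof (rule nn_integral_mono_AE)
    show "AE y in lborel. (\<integral>\<^sup>+x. indicator {(x, y). \<forall>i\<in>I. \<bar>a i x * y ^ b i k\<bar> \<le> M i} (x, y) \<partial>?P)
      \<le> ennreal (K ks) * (\<integral>\<^sup>+x. indicator {x. \<forall>i\<in>I. (\<Prod>k\<in>set (k # ks). \<bar>x k\<bar> ^ b i k) \<le> M i} (x(k := y)) \<partial>?P)"
      \<comment> \<open>The excluded value \<open>0\<close> is where the division by the power of
        \<open>\<bar>y\<bar>\<close> would fail.\<close>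
      using AE_lborel_singleton[of 0]
    proof eventually_elim
      case (elim y)
      have "(\<integral>\<^sup>+x. indicator {(x, y). \<forall>i\<in>I. \<bar>a i x * y ^ b i k\<bar> \<le> M i} (x, y) \<partial>?P)
         = (\<integral>\<^sup>+x. indicator {x. \<forall>i\<in>I. \<bar>a i x\<bar> \<le> M i / \<bar>y\<bar> ^ b i k} x \<partial>?P)"
        using elim by (intro nn_integral_cong) (auto simp: indicator_def abs_mult power_abs field_simps)
      also have "\<dots> \<le> ennreal (K ks) * (\<integral>\<^sup>+x. indicator {x. \<forall>i\<in>I. (\<Prod>k\<in>set ks. \<bar>x k\<bar> ^ b i k) \<le> M i / \<bar>y\<bar> ^ b i k} x \<partial>?P)"
        unfolding K_def using Cons.prems p(4) by (intro Cons.IH) (auto simp: a_def[abs_def])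
      also have "(\<integral>\<^sup>+x. indicator {x. \<forall>i\<in>I. (\<Prod>k\<in>set ks. \<bar>x k\<bar> ^ b i k) \<le> M i / \<bar>y\<bar> ^ b i k} x \<partial>?P)
          = (\<integral>\<^sup>+x. indicator {x. \<forall>i\<in>I. (\<Prod>k\<in>set (k # ks). \<bar>x k\<bar> ^ b i k) \<le> M i} (x(k := y)) \<partial>?P)"
      proof (rule nn_integral_cong)
        fix x
        have "(\<Prod>l\<in>set (k # ks). \<bar>(x(k := y)) l\<bar> ^ b i l) = \<bar>y\<bar> ^ b i k * (\<Prod>l\<in>set ks. \<bar>x l\<bar> ^ b i l)" for i
        proof -
          have "(\<Prod>l\<in>set ks. \<bar>(x(k := y)) l\<bar> ^ b i l) = (\<Prod>l\<in>set ks. \<bar>x l\<bar> ^ b i l)"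
            using k by (intro prod.cong) auto
          then show ?thesis using k by simp
        qed
        then show "indicator {x. \<forall>i\<in>I. (\<Prod>k\<in>set ks. \<bar>x k\<bar> ^ b i k) \<le> M i / \<bar>y\<bar> ^ b i k} x
          = (indicator {x. \<forall>i\<in>I. (\<Prod>k\<in>set (k # ks). \<bar>x k\<bar> ^ b i k) \<le> M i} (x(k := y)) :: ennreal)"
          using elim by (auto simp: indicator_def field_simps)
      qed
      finally show ?case .
    qed
  qed
  also have "\<dots> = ennreal (K ks) * (\<integral>\<^sup>+x. indicator {x. \<forall>i\<in>I. (\<Prod>k\<in>set (k # ks). \<bar>x k\<bar> ^ b i k) \<le> M i} x \<partial>PiM (set (k # ks)) (\<lambda>_. lborel))"
  proof -
    have "(\<lambda>x. indicator {x. \<forall>i\<in>I. (\<Prod>k\<in>insert k (set ks). \<bar>x k\<bar> ^ b i k) \<le> M i} x :: ennreal) \<in> borel_measurable (PiM (insert k (set ks)) (\<lambda>_. lborel))"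
      using I by (intro borel_measurable_indicator') measurable
    from lborel_product.product_nn_integral_insert_cmult[OF _ k this]
    show ?thesis
      unfolding set_simps by (simp only: finite_set)
  qed
  finally show ?case
    using K0 unfolding K_def[symmetric] K
    by (simp add: ennreal_mult mult.assoc mult_left_mono)
qed

subsection \<open>Integrals of monomials\<close>

lemma nn_integral_exp_abs_less_top:
  assumes "\<epsilon> > 0"
  shows "(\<integral>\<^sup>+y. ennreal (exp (- \<epsilon> * \<bar>y\<bar>)) \<partial>lborel) < \<infinity>"
proof -
  let ?h = "\<lambda>y::real. ennreal (indicator {0..} y * exp (- \<epsilon> * y))"
  have "((\<lambda>y. exp (- \<epsilon> * y)) has_integral exp (- \<epsilon> * 0) / \<epsilon>) {0..}"
    by (rule has_integral_exp_minus_to_infinity[OF assms])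
  from nn_integral_has_integral_lebesgue[OF _ this]
  have "(\<integral>\<^sup>+y. ?h y \<partial>lborel) = ennreal (1 / \<epsilon>)"
    by (simp add: nn_integral_completion)
  then have fin: "(\<integral>\<^sup>+y. ?h y \<partial>lborel) < \<infinity>" by simp
  have "(\<integral>\<^sup>+y. ennreal (exp (- \<epsilon> * \<bar>y\<bar>)) \<partial>lborel) \<le> (\<integral>\<^sup>+y. ?h y + ?h (- y) \<partial>lborel)"
    by (intro nn_integral_mono) (auto simp: indicator_def abs_if not_le intro: order_trans[OF _ add_increasing2])
  also have "\<dots> = (\<integral>\<^sup>+y. ?h y \<partial>lborel) + (\<integral>\<^sup>+y. ?h (- y) \<partial>lborel)"
    by (rule nn_integral_add) auto
  also have "(\<integral>\<^sup>+y. ?h (- y) \<partial>lborel) = (\<integral>\<^sup>+y. ?h y \<partial>lborel)"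
    by (subst nn_integral_real_affine[of ?h "-1" 0]) auto
  also have "(\<integral>\<^sup>+y. ?h y \<partial>lborel) + (\<integral>\<^sup>+y. ?h y \<partial>lborel) < \<infinity>"
    using fin by (simp only: infinity_ennreal_def ennreal_add_less_top)
  finally show ?thesis .
qed

lemma nn_integral_exp_sum_abs_less_top:
  assumes "\<epsilon> > 0"
  shows "(\<integral>\<^sup>+y. ennreal (exp (- \<epsilon> * (\<Sum>k\<in>UNIV. \<bar>(y :: real ^ 'n::finite) $ k\<bar>))) \<partial>lborel) < \<infinity>"
proof -
  have "(\<integral>\<^sup>+y. ennreal (exp (- \<epsilon> * (\<Sum>k\<in>UNIV. \<bar>(y :: real ^ 'n) $ k\<bar>))) \<partial>lborel)
      = (\<integral>\<^sup>+y. (\<Prod>k\<in>UNIV. ennreal (exp (- \<epsilon> * \<bar>y k\<bar>))) \<partial>PiM (UNIV :: 'n set) (\<lambda>_. lborel))"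
    by (subst nn_integral_lborel_vec)
       (auto intro!: nn_integral_cong simp: prod_ennreal exp_sum[symmetric] sum_distrib_left sum_negf)
  also have "\<dots> = (\<Prod>k\<in>(UNIV :: 'n set). \<integral>\<^sup>+y. ennreal (exp (- \<epsilon> * \<bar>y\<bar>)) \<partial>lborel)"
    by (rule lborel_product.product_nn_integral_prod) auto
  also have "\<dots> < \<infinity>"
    using nn_integral_exp_abs_less_top[OF assms] by (auto simp: less_top[symmetric] power_eq_top_ennreal)
  finally show ?thesis .
qed

text \<open>Puts the change of variables theorem for absolutely integrable vector-valued functions
  into the form for nonnegative integrals. Finiteness on the parameter side supplies the
  integrability, and \<open>H\<close> is treated as a function with one component.\<close>

lemma nn_integral_range_change_of_variables:
  fixes g :: "real ^ 'n::{finite,wellorder} \<Rightarrow> real ^ 'n::_"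
  assumes der: "\<And>x. (g has_derivative g' x) (at x)" and inj: "inj g"
    and [measurable]: "H \<in> borel_measurable borel" "E \<in> borel_measurable borel" "range g \<in> sets borel"
    and H: "\<And>t. H t \<ge> 0" and E: "\<And>x. E x = \<bar>det (matrix (g' x))\<bar> * H (g x)"
    and fin: "(\<integral>\<^sup>+x. ennreal (E x) \<partial>lborel) < \<infinity>"
  shows "(\<integral>\<^sup>+t. ennreal (H t) * indicator (range g) t \<partial>lborel) = (\<integral>\<^sup>+x. ennreal (E x) \<partial>lborel)"
proof -
  have E0: "E x \<ge> 0" for x using H by (simp add: E)
  have iE: "integrable lborel E"
    using fin E0 by (intro integrableI_nonneg) auto
  then have aE: "E absolutely_integrable_on UNIV"
    by (simp add: set_integrable_def integrable_completion)
  define f where "f t = (\<chi> i. H t :: real ^ 1)" for t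
  have fE: "\<bar>det (matrix (g' x))\<bar> *\<^sub>R f (g x) = (\<chi> i. E x)" for x
    by (simp add: f_def E vec_eq_iff)
  have "(\<lambda>x. \<bar>det (matrix (g' x))\<bar> *\<^sub>R f (g x)) absolutely_integrable_on UNIV"
    unfolding fE using aE by (subst absolutely_integrable_on_1_iff) simp
  with has_absolute_integral_change_of_variables[of UNIV g g' f] der inj
  have 1: "f absolutely_integrable_on range g"
    "integral (range g) f = integral UNIV (\<lambda>x. \<bar>det (matrix (g' x))\<bar> *\<^sub>R f (g x))"
    by (auto intro: has_derivative_at_withinI)
  from 1(1) have aH: "H absolutely_integrable_on range g"
    by (subst (asm) absolutely_integrable_on_1_iff) (simp add: f_def)
  have iH: "integral (range g) H = integral UNIV E"
    using 1(2) unfolding fE by (simp add: integral_on_1_eq f_def vec_eq_iff)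
  have "(\<integral>\<^sup>+t. ennreal (H t) * indicator (range g) t \<partial>lborel) = (\<integral>\<^sup>+t. ennreal (indicator (range g) t *\<^sub>R H t) \<partial>lebesgue)"
    by (auto simp: nn_integral_completion indicator_def intro!: nn_integral_cong)
  also have "\<dots> = ennreal (\<integral>t. indicator (range g) t *\<^sub>R H t \<partial>lebesgue)"
    using aH H by (intro nn_integral_eq_integral) (auto simp: set_integrable_def)
  also have "(\<integral>t. indicator (range g) t *\<^sub>R H t \<partial>lebesgue) = integral (range g) H"
    using set_lebesgue_integral_eq_integral(2)[OF aH] by (simp add: set_lebesgue_integral_def)
  also have "\<dots> = (\<integral>x. E x \<partial>lebesgue)"
    unfolding iH using set_lebesgue_integral_eq_integral(2)[OF aE] by (simp add: set_lebesgue_integral_def)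
  also have "ennreal \<dots> = (\<integral>\<^sup>+x. ennreal (E x) \<partial>lborel)"
    using iE E0 by (simp add: integral_completion nn_integral_eq_integral)
  finally show ?thesis .
qed

lemma AE_lborel_vec_nonzero: "AE t::real ^ 'n::finite in lborel. \<forall>k. t $ k \<noteq> 0"
proof -
  have "AE t::real ^ 'n in lborel. t $ k \<noteq> 0" for k
  proof (rule AE_I)
    have "{t :: real ^ 'n. t $ k = 0} = {t. \<forall>i. t $ i \<in> (if i = k then {0} else UNIV)}"
      by auto
    then show "emeasure lborel {t :: real ^ 'n. t $ k = 0} = 0"
      by (simp only:, subst emeasure_lborel_vec_box) (auto intro!: exI[of _ k])
  qed auto
  then show ?thesis by (simp add: AE_all_countable)
qed

text \<open>On each open orthant, \<open>t\<close> is parametrized by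
  \<open>y = B *v L t + \<kappa>\<close>, where \<open>L t\<close> is the vector of the logarithms
  of the \<open>\<bar>t $ l\<bar>\<close>. The Jacobian of the exponential cancels the weight, the
  linear map contributes \<open>\<bar>det C\<bar>\<close> with \<open>C\<close> inverse to
  \<open>B\<close>, and the shift disappears; this is why \<open>D\<close> does not depend on
  \<open>\<kappa>\<close>.\<close>

lemma nn_integral_log_linear_le:
  fixes B :: "real ^ 'n::{finite,wellorder} ^ 'n::_"
  assumes \<epsilon>: "\<epsilon> > 0" and B: "span (rows B) = UNIV"
  obtains D where "D \<ge> 0" "\<And>\<kappa>. (\<integral>\<^sup>+t. ennreal ((\<Prod>k\<in>UNIV. inverse \<bar>t $ k\<bar>) *
      exp (- \<epsilon> * (\<Sum>k\<in>UNIV. \<bar>(B *v (\<chi> l. ln \<bar>t $ l\<bar>) + \<kappa>) $ k\<bar>))) \<partial>lborel) \<le> ennreal D"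
proof -
  from B obtain C where CB: "C ** B = mat 1"
    using matrix_left_invertible_span_rows by blast
  then have BC: "B ** C = mat 1" by (rule matrix_left_right_inverse1)
  define I where "I = (\<integral>\<^sup>+y. ennreal (exp (- \<epsilon> * (\<Sum>k\<in>UNIV. \<bar>(y :: real ^ 'n::_) $ k\<bar>))) \<partial>lborel)"
  have I: "I < \<infinity>" unfolding I_def by (rule nn_integral_exp_sum_abs_less_top[OF \<epsilon>])
  \<comment> \<open>One contribution for each orthant; an orthant is encoded by its set of positive
    coordinates.\<close>
  define D where "D = of_nat (card (UNIV :: 'n set set)) * (ennreal \<bar>det C\<bar> * I)"
  have D: "D < \<infinity>"
    using I by (simp only: D_def infinity_ennreal_def ennreal_mult_less_top of_nat_less_top ennreal_less_top simp_thms)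
  have "(\<integral>\<^sup>+t. ennreal ((\<Prod>k\<in>UNIV. inverse \<bar>t $ k\<bar>) *
      exp (- \<epsilon> * (\<Sum>k\<in>UNIV. \<bar>(B *v (\<chi> l. ln \<bar>t $ l\<bar>) + \<kappa>) $ k\<bar>))) \<partial>lborel) \<le> D" for \<kappa>
  proof -
    define L where "L t = (\<chi> l. ln \<bar>t $ l\<bar>)" for t :: "real ^ 'n::_"
    define H where "H t = (\<Prod>k\<in>UNIV. inverse \<bar>t $ k\<bar>) * exp (- \<epsilon> * (\<Sum>k\<in>UNIV. \<bar>(B *v L t + \<kappa>) $ k\<bar>))" for t
    define \<sigma> where "\<sigma> S l = (if l \<in> S then 1 else - 1 :: real)" for S and l :: 'n
    have \<sigma>: "\<bar>\<sigma> S l\<bar> = 1" "\<sigma> S l * \<sigma> S l = 1" for S l by (auto simp: \<sigma>_def)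
    define X where "X y = C *v (y - \<kappa>)" for y
    define g where "g S y = (\<chi> l. \<sigma> S l * exp (X y $ l))" for S y
    define g' where "g' S y h = (\<chi> l. (\<sigma> S l * exp (X y $ l)) * (C *v h) $ l)" for S y h
    define E where "E y = \<bar>det C\<bar> * exp (- \<epsilon> * (\<Sum>k\<in>UNIV. \<bar>y $ k\<bar>))" for y :: "real ^ 'n::_"
    have BX: "B *v X y = y - \<kappa>" for y
      by (simp add: X_def matrix_vector_mul_assoc BC)
    have XB: "X (B *v z + \<kappa>) = z" for z
      by (simp add: X_def matrix_vector_mul_assoc CB)
    have Lg: "L (g S y) = X y" for S y
      by (simp add: L_def g_def vec_eq_iff abs_mult \<sigma>)
    have [measurable]: "L \<in> borel_measurable borel"
      unfolding L_def by measurable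
    have [measurable]: "(\<lambda>z. B *v z) \<in> borel_measurable borel"
      by (intro borel_measurable_continuous_onI continuous_intros)
    have Hm[measurable]: "H \<in> borel_measurable borel"
      unfolding H_def by measurable
    have H0: "H t \<ge> 0" for t
      unfolding H_def by (intro mult_nonneg_nonneg prod_nonneg) auto
    have Em[measurable]: "E \<in> borel_measurable borel"
      unfolding E_def by measurable
    have EI: "(\<integral>\<^sup>+y. ennreal (E y) \<partial>lborel) = ennreal \<bar>det C\<bar> * I"
      unfolding E_def I_def by (simp add: ennreal_mult nn_integral_cmult)
    have rg: "range (g S) = {t. \<forall>l. \<sigma> S l * t $ l > 0}" for S
    proof (intro set_eqI iffI)
      fix t assume "t \<in> range (g S)"
      then show "t \<in> {t. \<forall>l. \<sigma> S l * t $ l > 0}"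
        by (auto simp: g_def mult.assoc[symmetric] \<sigma>)
    next
      fix t assume t: "t \<in> {t. \<forall>l. \<sigma> S l * t $ l > 0}"
      have "\<sigma> S l * \<bar>t $ l\<bar> = t $ l" "t $ l \<noteq> 0" for l
        using t[simplified, rule_format, of l] by (auto simp: \<sigma>_def abs_if split: if_splits)
      then have "g S (B *v L t + \<kappa>) = t"
        by (simp add: g_def XB vec_eq_iff L_def)
      then show "t \<in> range (g S)" by (metis rangeI)
    qed
    have piece: "(\<integral>\<^sup>+t. ennreal (H t) * indicator (range (g S)) t \<partial>lborel) = ennreal \<bar>det C\<bar> * I" for S
    proof -
      have der: "(g S has_derivative g' S y) (at y)" for y
      proof -
        have d: "((\<lambda>y. X y $ l) has_derivative (\<lambda>h. (C *v h) $ l)) (at y)" for l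
        proof -
          have "bounded_linear (\<lambda>h. (C *v h) $ l)"
            by (intro bounded_linear_compose[OF bounded_linear_vec_nth] matrix_vector_mul_bounded_linear)
          moreover have "(\<lambda>y. X y $ l) = (\<lambda>y. (C *v y) $ l - (C *v \<kappa>) $ l)"
            by (simp add: X_def matrix_vector_mult_diff_distrib)
          ultimately show ?thesis
            by (auto intro!: derivative_eq_intros bounded_linear_imp_has_derivative)
        qed
        show ?thesis
          unfolding has_derivative_componentwise_within[of "g S"]
        proof
          fix b :: "real ^ 'n::_" assume "b \<in> Basis"
          then obtain l where b: "b = axis l 1" by (auto simp: Basis_vec_def)
          show "((\<lambda>y. g S y \<bullet> b) has_derivative (\<lambda>h. g' S y h \<bullet> b)) (at y)"
            unfolding b g_def g'_def by (auto simp: inner_axis intro!: derivative_eq_intros d)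
        qed
      qed
      have inj: "inj (g S)"
      proof (rule injI)
        fix y z assume "g S y = g S z"
        then have "X y = X z" using Lg by metis
        then show "y = z" using BX by (metis diff_add_cancel)
      qed
      have E: "E y = \<bar>det (matrix (g' S y))\<bar> * H (g S y)" for y
      proof -
        have "matrix (g' S y) = (\<chi> l. (\<sigma> S l * exp (X y $ l)) *s C $ l)"
          by (simp add: matrix_def g'_def vec_eq_iff matrix_vector_mult_basis column_def)
        then have "det (matrix (g' S y)) = (\<Prod>l\<in>UNIV. \<sigma> S l * exp (X y $ l)) * det C"
          by (simp add: det_rows_mul)
        then have det: "\<bar>det (matrix (g' S y))\<bar> = (\<Prod>l\<in>UNIV. exp (X y $ l)) * \<bar>det C\<bar>"
          by (simp add: abs_mult abs_prod \<sigma>)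
        have "(\<Prod>k\<in>UNIV. inverse \<bar>g S y $ k\<bar>) * (\<Prod>l\<in>UNIV. exp (X y $ l)) = 1"
          by (simp add: prod.distrib[symmetric] g_def abs_mult \<sigma>)
        then show ?thesis
          unfolding H_def Lg BX det E_def by (simp add: mult_ac)
      qed
      have rm: "range (g S) \<in> sets borel" unfolding rg by measurable
      have "(\<integral>\<^sup>+y. ennreal (E y) \<partial>lborel) < \<infinity>"
        unfolding EI using I by (simp add: ennreal_mult_less_top)
      from nn_integral_range_change_of_variables[OF der inj Hm Em rm H0 E this]
      have "(\<integral>\<^sup>+t. ennreal (H t) * indicator (range (g S)) t \<partial>lborel) = (\<integral>\<^sup>+y. ennreal (E y) \<partial>lborel)" .
      then show ?thesis by (simp add: EI)
    qed
    have "(\<integral>\<^sup>+t. ennreal (H t) \<partial>lborel) \<le> (\<integral>\<^sup>+t. (\<Sum>S\<in>UNIV. ennreal (H t) * indicator (range (g S)) t) \<partial>lborel)"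
    proof (rule nn_integral_mono_AE)
      show "AE t in lborel. ennreal (H t) \<le> (\<Sum>S\<in>UNIV. ennreal (H t) * indicator (range (g S)) t)"
        using AE_lborel_vec_nonzero
      proof eventually_elim
        case (elim t)
        have "t \<in> range (g {l. t $ l > 0})"
          using elim by (auto simp: rg \<sigma>_def not_less order_le_less)
        then have "ennreal (H t) = ennreal (H t) * indicator (range (g {l. t $ l > 0})) t" by simp
        also have "\<dots> \<le> (\<Sum>S\<in>UNIV. ennreal (H t) * indicator (range (g S)) t)"
          by (rule member_le_sum) auto
        finally show ?case .
      qed
    qed
    also have "\<dots> = (\<Sum>S\<in>UNIV. \<integral>\<^sup>+t. ennreal (H t) * indicator (range (g S)) t \<partial>lborel)"
      unfolding rg by (rule nn_integral_sum) measurable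
    also have "\<dots> = D" by (simp add: piece D_def)
    finally show ?thesis unfolding H_def L_def .
  qed
  with D show ?thesis
    by (intro that[of "enn2real D"]) (auto simp: ennreal_enn2real)
qed

text \<open>Layer-cake formula: the integral is the integral over \<open>y > 0\<close> of the
  measures of the superlevel sets, so a comparison of these sets carries over, even between
  different measure spaces. Negative values are cut off by \<open>ennreal\<close>.\<close>

lemma nn_integral_le_superlevels:
  fixes F :: "'a \<Rightarrow> real" and G :: "'b \<Rightarrow> real"
  assumes "sigma_finite_measure M" "sigma_finite_measure M'"
    and [measurable]: "F \<in> borel_measurable M" "G \<in> borel_measurable M'"
    and le: "\<And>y. y > 0 \<Longrightarrow> (\<integral>\<^sup>+x. indicator {x. y \<le> F x} x \<partial>M) \<le> K * (\<integral>\<^sup>+x. indicator {x. y \<le> G x} x \<partial>M')"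
  shows "(\<integral>\<^sup>+x. ennreal (F x) \<partial>M) \<le> K * (\<integral>\<^sup>+x. ennreal (G x) \<partial>M')"
proof -
  have cake: "(\<integral>\<^sup>+x. ennreal (H x) \<partial>L) = (\<integral>\<^sup>+y. indicator {0<..} y * (\<integral>\<^sup>+x. indicator {x. y \<le> H x} x \<partial>L) \<partial>lborel)"
    and meas: "(\<lambda>y. \<integral>\<^sup>+x. indicator {x. y \<le> H x} x \<partial>L) \<in> borel_measurable borel"
    if "sigma_finite_measure L" and [measurable]: "H \<in> borel_measurable L" for L :: "'c measure" and H :: "'c \<Rightarrow> real"
  proof -
    have meas2: "(\<lambda>(y, x). indicator {x. y \<le> H x} x :: ennreal) \<in> borel_measurable (lborel \<Otimes>\<^sub>M L)"
      by (simp add: indicator_def) measurable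
    from sigma_finite_measure.borel_measurable_nn_integral[OF that(1) this]
    show m: "(\<lambda>y. \<integral>\<^sup>+x. indicator {x. y \<le> H x} x \<partial>L) \<in> borel_measurable borel" by simp
    have "(\<integral>\<^sup>+x. ennreal (H x) \<partial>L) = (\<integral>\<^sup>+x. \<integral>\<^sup>+y. indicator {0<..} y * indicator {x. y \<le> H x} x \<partial>lborel \<partial>L)"
    proof (rule nn_integral_cong)
      fix x
      have "(\<integral>\<^sup>+y. indicator {0<..} y * indicator {x. y \<le> H x} x \<partial>lborel) = (\<integral>\<^sup>+y. indicator {0<..H x} y \<partial>lborel)"
        by (intro nn_integral_cong) (auto simp: indicator_def)
      also have "\<dots> = ennreal (H x)"
        by (cases "H x \<ge> 0") (auto simp: ennreal_neg)
      finally show "ennreal (H x) = (\<integral>\<^sup>+y. indicator {0<..} y * indicator {x. y \<le> H x} x \<partial>lborel)" by simp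
    qed
    also have "\<dots> = (\<integral>\<^sup>+y. \<integral>\<^sup>+x. indicator {0<..} y * indicator {x. y \<le> H x} x \<partial>L \<partial>lborel)"
    proof (rule pair_sigma_finite.Fubini')
      show "pair_sigma_finite lborel L"
        using that(1) by (intro pair_sigma_finite.intro sigma_finite_lborel)
      show "(\<lambda>(y, x). indicator {0<..} y * indicator {x. y \<le> H x} x :: ennreal) \<in> borel_measurable (lborel \<Otimes>\<^sub>M L)"
        by (simp add: indicator_def) measurable
    qed
    also have "\<dots> = (\<integral>\<^sup>+y. indicator {0<..} y * (\<integral>\<^sup>+x. indicator {x. y \<le> H x} x \<partial>L) \<partial>lborel)"
      by (intro nn_integral_cong nn_integral_cmult) (simp add: indicator_def)
    finally show "(\<integral>\<^sup>+x. ennreal (H x) \<partial>L) = \<dots>" .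
  qed
  note [measurable] = meas[OF assms(2,4)]
  have "(\<integral>\<^sup>+x. ennreal (F x) \<partial>M) = (\<integral>\<^sup>+y. indicator {0<..} y * (\<integral>\<^sup>+x. indicator {x. y \<le> F x} x \<partial>M) \<partial>lborel)"
    by (rule cake[OF assms(1,3)])
  also have "\<dots> \<le> (\<integral>\<^sup>+y. K * (indicator {0<..} y * (\<integral>\<^sup>+x. indicator {x. y \<le> G x} x \<partial>M')) \<partial>lborel)"
    by (intro nn_integral_mono) (use le in \<open>simp add: indicator_def\<close>)
  also have "\<dots> = K * (\<integral>\<^sup>+y. indicator {0<..} y * (\<integral>\<^sup>+x. indicator {x. y \<le> G x} x \<partial>M') \<partial>lborel)"
    by (rule nn_integral_cmult) measurable
  also have "\<dots> = K * (\<integral>\<^sup>+x. ennreal (G x) \<partial>M')"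
    by (simp only: cake[OF assms(2,4)])
  finally show ?thesis .
qed

text \<open>
  With \<open>Z i\<close> the logarithm of the \<open>i\<close>-th monomial and \<open>m\<close> the maximum, \<open>\<Sum>i. m - Z i\<close> dominates
  \<open>\<bar>Z (\<sigma> k) - Z i0\<bar>\<close> for each \<open>k\<close>, and \<open>Z i0\<close> does not depend on \<open>t\<close>.
\<close>

lemma powr_Max_monomials_le:
  fixes \<beta> :: "'i \<Rightarrow> nat ^ 'n::finite" and t :: "real ^ 'n"
  assumes I: "finite I" and i0: "i0 \<in> I" and w: "w > 0"
    and \<beta>: "(\<Sum>i\<in>I. \<beta> i) = (\<chi> k. w)" and c: "\<And>i. i \<in> I \<Longrightarrow> c i > 0" and \<beta>0: "\<beta> i0 = 0"
    and \<sigma>: "\<And>k::'n. \<sigma> k \<in> I" and t: "\<And>k. t $ k \<noteq> 0"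
  shows "Max ((\<lambda>i. c i * (\<Prod>k\<in>UNIV. \<bar>t $ k\<bar> ^ (\<beta> i $ k))) ` I) powr (- (real (card I) / real w))
    \<le> (\<Prod>i\<in>I. c i powr (- 1 / real w)) * ((\<Prod>k\<in>UNIV. inverse \<bar>t $ k\<bar>) *
        exp (- (1 / (real CARD('n) * real w)) * (\<Sum>k\<in>UNIV. \<bar>(\<Sum>l\<in>UNIV. real (\<beta> (\<sigma> k) $ l) * ln \<bar>t $ l\<bar>) + (ln (c (\<sigma> k)) - ln (c i0))\<bar>)))"
    (is "?\<Phi> powr _ \<le> _")
proof -
  let ?n = "real CARD('n)"
  define z where "z i = c i * (\<Prod>k\<in>UNIV. \<bar>t $ k\<bar> ^ (\<beta> i $ k))" for i
  define Z where "Z i = ln (z i)" for i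
  have z0: "z i > 0" if "i \<in> I" for i
    unfolding z_def using c[OF that] t by (intro mult_pos_pos prod_pos) auto
  have Z: "Z i = ln (c i) + (\<Sum>k\<in>UNIV. real (\<beta> i $ k) * ln \<bar>t $ k\<bar>)" if "i \<in> I" for i
    unfolding Z_def z_def using c[OF that] t
    by (subst ln_mult) (auto intro!: prod_pos simp: ln_prod ln_realpow)
  have \<Phi>: "z i \<le> ?\<Phi>" if "i \<in> I" for i
    using I that by (intro Max_ge) (auto simp: z_def)
  have \<Phi>0: "?\<Phi> > 0" using z0[OF i0] \<Phi>[OF i0] by linarith
  define m where "m = ln ?\<Phi>"
  have Zm: "Z i \<le> m" if "i \<in> I" for i
    unfolding Z_def m_def using \<Phi>[OF that] z0[OF that] by simp
  \<comment> \<open>All terms on the right are nonnegative; those at \<open>\<sigma> k\<close> and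
    \<open>i0\<close> alone dominate the difference.\<close>
  have diff: "\<bar>Z (\<sigma> k) - Z i0\<bar> \<le> (\<Sum>i\<in>I. m - Z i)" for k
  proof -
    have "(\<Sum>i\<in>{\<sigma> k, i0}. m - Z i) \<le> (\<Sum>i\<in>I. m - Z i)"
      using I i0 \<sigma>[of k] Zm by (intro sum_mono2) auto
    then show ?thesis
      using Zm[OF i0] Zm[OF \<sigma>[of k]] by (cases "\<sigma> k = i0") auto
  qed
  have "(\<Sum>k\<in>UNIV. \<bar>Z (\<sigma> k) - Z i0\<bar>) \<le> (\<Sum>k\<in>(UNIV :: 'n set). \<Sum>i\<in>I. m - Z i)"
    by (intro sum_mono diff)
  then have sum: "(\<Sum>k\<in>UNIV. \<bar>Z (\<sigma> k) - Z i0\<bar>) \<le> ?n * (\<Sum>i\<in>I. m - Z i)"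
    by simp
  \<comment> \<open>The factor \<open>1 / ?n\<close> averages over \<open>k\<close>; the factor
    \<open>1 / w\<close> makes the coefficient of each \<open>ln \<bar>t $ k\<bar>\<close> equal to
    \<open>1\<close> below.\<close>
  have "(1 / (?n * real w)) * (\<Sum>k\<in>UNIV. \<bar>Z (\<sigma> k) - Z i0\<bar>) \<le> (1 / (?n * real w)) * (?n * (\<Sum>i\<in>I. m - Z i))"
    by (intro mult_left_mono sum) auto
  also have "\<dots> = (\<Sum>i\<in>I. m - Z i) / real w" by simp
  \<comment> \<open>The scaling condition enters: the exponents of each variable add up to
    \<open>w\<close>. This sum of logarithms becomes the product of the
    \<open>inverse \<bar>t $ k\<bar>\<close>.\<close>
  also have "(\<Sum>i\<in>I. m - Z i) = real (card I) * m - (\<Sum>i\<in>I. ln (c i)) - real w * (\<Sum>k\<in>UNIV. ln \<bar>t $ k\<bar>)"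
  proof -
    have wk: "(\<Sum>i\<in>I. real (\<beta> i $ k)) = real w" for k
      using arg_cong[OF \<beta>, of "\<lambda>v. real (v $ k)"] by (simp add: sum_component)
    have "(\<Sum>i\<in>I. \<Sum>k\<in>UNIV. real (\<beta> i $ k) * ln \<bar>t $ k\<bar>) = (\<Sum>k\<in>UNIV. \<Sum>i\<in>I. real (\<beta> i $ k) * ln \<bar>t $ k\<bar>)"
      by (rule sum.swap)
    also have "\<dots> = real w * (\<Sum>k\<in>UNIV. ln \<bar>t $ k\<bar>)"
      by (simp add: sum_distrib_right[symmetric] wk sum_distrib_left)
    finally show ?thesis by (simp add: Z sum_subtractf sum.distrib)
  qed
  finally have main: "- (real (card I) / real w) * m \<le> - (1 / real w) * (\<Sum>i\<in>I. ln (c i)) - (\<Sum>k\<in>UNIV. ln \<bar>t $ k\<bar>)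
      - (1 / (?n * real w)) * (\<Sum>k\<in>UNIV. \<bar>Z (\<sigma> k) - Z i0\<bar>)"
    using w by (simp add: diff_divide_distrib)
  have ZZ: "Z (\<sigma> k) - Z i0 = (\<Sum>l\<in>UNIV. real (\<beta> (\<sigma> k) $ l) * ln \<bar>t $ l\<bar>) + (ln (c (\<sigma> k)) - ln (c i0))" for k
    using \<beta>0 by (simp add: Z[OF \<sigma>] Z[OF i0])
  have "?\<Phi> powr (- (real (card I) / real w)) = exp (- (real (card I) / real w) * m)"
    using \<Phi>0 by (simp add: powr_def m_def)
  also have "\<dots> \<le> exp (- (1 / real w) * (\<Sum>i\<in>I. ln (c i)) - (\<Sum>k\<in>UNIV. ln \<bar>t $ k\<bar>)
      - (1 / (?n * real w)) * (\<Sum>k\<in>UNIV. \<bar>Z (\<sigma> k) - Z i0\<bar>))"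
    using main by (simp only: exp_le_cancel_iff)
  also have "\<dots> = exp (\<Sum>i\<in>I. (- 1 / real w) * ln (c i)) * (exp (\<Sum>k\<in>UNIV. - ln \<bar>t $ k\<bar>) *
        exp (- (1 / (?n * real w)) * (\<Sum>k\<in>UNIV. \<bar>Z (\<sigma> k) - Z i0\<bar>)))"
    by (simp add: exp_add[symmetric] sum_distrib_left[symmetric] sum_negf sum_divide_distrib[symmetric])
  also have "exp (\<Sum>i\<in>I. (- 1 / real w) * ln (c i)) = (\<Prod>i\<in>I. c i powr (- 1 / real w))"
    using I c by (subst exp_sum) (auto simp: powr_def intro!: prod.cong dest: c)
  also have "exp (\<Sum>k\<in>UNIV. - ln \<bar>t $ k\<bar>) = (\<Prod>k\<in>UNIV. inverse \<bar>t $ k\<bar>)"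
    using t by (subst exp_sum) (auto simp: exp_minus intro!: prod.cong)
  finally show ?thesis unfolding ZZ .
qed

text \<open>A basis extracted from the family has as many elements as there are coordinates, so it
  can be indexed by \<open>'n\<close> and read as the rows of a square matrix.\<close>

lemma spanning_subfamily:
  fixes v :: "'i \<Rightarrow> real ^ 'n::finite"
  assumes "finite I" "span (v ` I) = UNIV"
  obtains \<sigma> where "\<And>k::'n. \<sigma> k \<in> I" "span (rows (\<chi> k. v (\<sigma> k))) = UNIV"
proof -
  obtain S where S: "S \<subseteq> v ` I" "v ` I \<subseteq> span S" "card S = dim (v ` I)"
    by (rule basis_exists)
  have "dim (v ` I) = CARD('n)"
    unfolding dim_span[of "v ` I", symmetric] assms(2) by simp
  moreover have "finite S" using S(1) assms(1) finite_subset by blast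
  ultimately obtain h where h: "bij_betw h (UNIV :: 'n set) S"
    using finite_same_card_bij[of "UNIV :: 'n set" S] S(3) by auto
  have "\<forall>k. \<exists>i. i \<in> I \<and> v i = h k"
  proof
    fix k
    have "h k \<in> v ` I" using bij_betw_apply[OF h UNIV_I] S(1) by blast
    then show "\<exists>i. i \<in> I \<and> v i = h k" by (auto simp: image_iff)
  qed
  then obtain \<sigma> where \<sigma>: "\<And>k. \<sigma> k \<in> I" "\<And>k. v (\<sigma> k) = h k" by metis
  have "rows (\<chi> k. v (\<sigma> k)) = S"
    using h by (auto simp: rows_def row_def \<sigma>(2) bij_betw_def)
  moreover have "span S = UNIV"
    using span_mono[OF S(2)] unfolding span_span assms(2) by auto
  ultimately show ?thesis using that \<sigma>(1) by metis
qed

text \<open>The coefficients only shift the logarithms of the monomials. The bound in logarithmic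
  coordinates is uniform in such a shift \<open>\<kappa>\<close>, so the dependence on
  \<open>c\<close> is confined to the product.\<close>

lemma nn_integral_Max_monomials_le:
  fixes \<beta> :: "'i \<Rightarrow> nat ^ 'n::{finite,wellorder}"
  assumes I: "finite I" and i0: "i0 \<in> I" and w: "w > 0"
    and \<beta>: "(\<Sum>i\<in>I. \<beta> i) = (\<chi> k. w)" and \<beta>0: "\<beta> i0 = 0"
    and span: "span ((\<lambda>i. (\<chi> k. real (\<beta> i $ k)) :: real ^ 'n::_) ` I) = UNIV"
  obtains D where "D \<ge> 0" "\<And>c. (\<And>i. i \<in> I \<Longrightarrow> c i > 0) \<Longrightarrow>
    (\<integral>\<^sup>+t. ennreal (Max ((\<lambda>i. c i * (\<Prod>k\<in>UNIV. \<bar>(t :: real ^ 'n::_) $ k\<bar> ^ (\<beta> i $ k))) ` I) powr (- (real (card I) / real w))) \<partial>lborel)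
      \<le> ennreal (D * (\<Prod>i\<in>I. c i powr (- 1 / real w)))"
proof -
  define v where "v i = (\<chi> k. real (\<beta> i $ k))" for i
  obtain \<sigma> where \<sigma>: "\<And>k::'n. \<sigma> k \<in> I" "span (rows (\<chi> k. v (\<sigma> k))) = UNIV"
    using spanning_subfamily[OF I, of v] span unfolding v_def by blast
  define B where "B = (\<chi> k. v (\<sigma> k))"
  have \<epsilon>: "1 / (real CARD('n) * real w) > 0" using w by simp
  obtain D where D: "D \<ge> 0" "\<And>\<kappa>. (\<integral>\<^sup>+t. ennreal ((\<Prod>k\<in>UNIV. inverse \<bar>t $ k\<bar>) *
      exp (- (1 / (real CARD('n) * real w)) * (\<Sum>k\<in>UNIV. \<bar>(B *v (\<chi> l. ln \<bar>t $ l\<bar>) + \<kappa>) $ k\<bar>))) \<partial>lborel) \<le> ennreal D"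
    using nn_integral_log_linear_le[OF \<epsilon> \<sigma>(2)[folded B_def]] by blast
  show thesis
  proof (rule that[OF D(1)])
    fix c :: "'i \<Rightarrow> real" assume c: "\<And>i. i \<in> I \<Longrightarrow> c i > 0"
    define P where "P = (\<Prod>i\<in>I. c i powr (- 1 / real w))"
    have P: "P \<ge> 0" unfolding P_def by (intro prod_nonneg) auto
    define L where "L t = (\<chi> l. ln \<bar>t $ l\<bar>)" for t :: "real ^ 'n::_"
    define \<kappa> where "\<kappa> = (\<chi> k. ln (c (\<sigma> k)) - ln (c i0))"
    define H where "H t = (\<Prod>k\<in>UNIV. inverse \<bar>t $ k\<bar>) *
      exp (- (1 / (real CARD('n) * real w)) * (\<Sum>k\<in>UNIV. \<bar>(B *v L t + \<kappa>) $ k\<bar>))" for t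
    have [measurable]: "L \<in> borel_measurable borel"
      unfolding L_def by measurable
    have [measurable]: "(\<lambda>z. B *v z) \<in> borel_measurable borel"
      by (intro borel_measurable_continuous_onI continuous_intros)
    have [measurable]: "H \<in> borel_measurable borel"
      unfolding H_def by measurable
    have "(\<integral>\<^sup>+t. ennreal (Max ((\<lambda>i. c i * (\<Prod>k\<in>UNIV. \<bar>t $ k\<bar> ^ (\<beta> i $ k))) ` I) powr (- (real (card I) / real w))) \<partial>lborel)
        \<le> (\<integral>\<^sup>+t. ennreal P * ennreal (H t) \<partial>lborel)"
    proof (rule nn_integral_mono_AE)
      show "AE t in lborel. ennreal (Max ((\<lambda>i. c i * (\<Prod>k\<in>UNIV. \<bar>t $ k\<bar> ^ (\<beta> i $ k))) ` I) powr (- (real (card I) / real w)))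
          \<le> ennreal P * ennreal (H t)"
        using AE_lborel_vec_nonzero
      proof eventually_elim
        case (elim t)
        have "Max ((\<lambda>i. c i * (\<Prod>k\<in>UNIV. \<bar>t $ k\<bar> ^ (\<beta> i $ k))) ` I) powr (- (real (card I) / real w)) \<le> P * H t"
          using powr_Max_monomials_le[OF I i0 w \<beta> c \<beta>0 \<sigma>(1), where t = t] elim
          by (simp add: P_def H_def B_def v_def matrix_vector_mult_def L_def \<kappa>_def)
        then show ?case
          using P by (simp add: ennreal_mult'[symmetric] ennreal_leI)
      qed
    qed
    also have "\<dots> = ennreal P * (\<integral>\<^sup>+t. ennreal (H t) \<partial>lborel)"
      by (rule nn_integral_cmult) measurable
    also have "\<dots> \<le> ennreal P * ennreal D"
      unfolding H_def L_def by (intro mult_left_mono D(2)) simp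
    also have "\<dots> = ennreal (D * P)" using P D(1) by (simp add: ennreal_mult mult.commute)
    finally show "(\<integral>\<^sup>+t. ennreal (Max ((\<lambda>i. c i * (\<Prod>k\<in>UNIV. \<bar>t $ k\<bar> ^ (\<beta> i $ k))) ` I) powr (- (real (card I) / real w))) \<partial>lborel)
      \<le> ennreal (D * (\<Prod>i\<in>I. c i powr (- 1 / real w)))" unfolding P_def .
  qed
qed

subsection \<open>Weighted inequalities for prescribed leading monomials\<close>

lemma le_powr_minus_iff:
  fixes x y s :: real
  assumes "x > 0" "y > 0" "s > 0"
  shows "y \<le> x powr (- s) \<longleftrightarrow> x \<le> y powr (- (1 / s))"
proof -
  have "y \<le> x powr (- s) \<longleftrightarrow> ln y \<le> ln (x powr (- s))"
    using assms by (subst ln_le_cancel_iff) auto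
  also have "\<dots> \<longleftrightarrow> ln x \<le> - (1 / s) * ln y"
    using assms by (simp add: ln_powr field_simps) linarith
  also have "\<dots> \<longleftrightarrow> ln x \<le> ln (y powr (- (1 / s)))"
    using assms by (simp add: ln_powr)
  also have "\<dots> \<longleftrightarrow> x \<le> y powr (- (1 / s))"
    using assms by (subst ln_le_cancel_iff) auto
  finally show ?thesis .
qed

text \<open>At exponent zero the leading coefficient is the whole function. This makes the member
  with index \<open>i0\<close> the constant \<open>1\<close>, which keeps the maximum of a weighted
  family away from zero.\<close>

lemma lead_zero:
  assumes "lead ks b f" "\<And>k. k \<in> set ks \<Longrightarrow> b k = 0"
  shows "f x = 1"
  using assms
proof (induction ks arbitrary: f)
  case (Cons k ks)
  then obtain p where p: "\<And>x. degree (p x) \<le> b k" "\<And>x. f x = poly (p x) (x k)"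
    "lead ks b (\<lambda>x. coeff (p x) (b k))" by auto
  have "coeff (p x) 0 = 1"
    using Cons.IH[OF p(3)] Cons.prems(2) by simp
  moreover have "degree (p x) = 0"
    using p(1)[of x] Cons.prems(2) by simp
  ultimately have "p x = [:1:]" by (metis degree_0_id)
  then show ?case by (simp add: p(2))
qed simp

text \<open>Admissibility as seen by the analytic part: the \<open>\<beta> i\<close> are the leading
  exponents of the pivots, \<open>w\<close> comes from scaling, \<open>i0\<close> from
  nondegeneracy, and \<open>ks\<close> lists the variables from the most to the least
  significant.\<close>

locale balanced_exponents =
  fixes I :: "'i set" and \<beta> :: "'i \<Rightarrow> nat ^ 'n::{finite,wellorder}" and w :: nat and i0 :: 'i
    and ks :: "'n list"
  assumes I: "finite I" and i0: "i0 \<in> I" and w: "w > 0"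
    and \<beta>: "(\<Sum>i\<in>I. \<beta> i) = (\<chi> k. w)" and \<beta>0: "\<beta> i0 = 0"
    and span: "span ((\<lambda>i. (\<chi> k. real (\<beta> i $ k)) :: real ^ 'n::_) ` I) = UNIV"
    and ks: "distinct ks" "set ks = UNIV"
begin

text \<open>The lower terms are subject to measurability only, so that a pivot belongs to the class
  whatever the earlier points are. Bounds uniform over the class are then uniform in these
  points.\<close>

definition leading :: "'i \<Rightarrow> (real ^ 'n::_ \<Rightarrow> real) set" where
  "leading i = {R \<in> borel_measurable borel. lead ks (($) (\<beta> i)) (\<lambda>x. R (\<chi> k. x k))}"

lemma leading_i0: "R \<in> leading i0 \<Longrightarrow> R t = 1"
  using lead_zero[of ks "($) (\<beta> i0)" "\<lambda>x. R (\<chi> k. x k)" "($) t"] by (simp add: leading_def \<beta>0)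

lemma card_pos: "card I > 0"
  using I i0 by (auto simp: card_gt_0_iff)

text \<open>A superlevel set of the integrand is the common sublevel set of the
  \<open>\<bar>R i\<bar>\<close>, with bounds depending on \<open>c\<close>. Passing to the leading
  monomials costs the factor \<open>K0\<close> on each such set, hence also on the integral, and the
  monomial case supplies \<open>D\<close>.\<close>

lemma nn_integral_Max_leading_le:
  obtains K where "K \<ge> 0" "\<And>R c. \<lbrakk>\<And>i. i \<in> I \<Longrightarrow> R i \<in> leading i; \<And>i. i \<in> I \<Longrightarrow> c i > 0\<rbrakk> \<Longrightarrow>
    (\<integral>\<^sup>+t. ennreal (Max ((\<lambda>i. c i * \<bar>R i t\<bar>) ` I) powr (- (real (card I) / real w))) \<partial>lborel)
      \<le> ennreal (K * (\<Prod>i\<in>I. c i powr (- 1 / real w)))"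
proof -
  let ?s = "real (card I) / real w"
  have s: "?s > 0" using w card_pos by simp
  define K0 where "K0 = (\<Prod>k\<in>set ks. 1 + real (\<Sum>i\<in>I. \<beta> i $ k))"
  have K0: "K0 \<ge> 0" unfolding K0_def by (intro prod_nonneg) (auto intro!: add_nonneg_nonneg sum_nonneg)
  obtain D where D: "D \<ge> 0" "\<And>c. (\<And>i. i \<in> I \<Longrightarrow> c i > 0) \<Longrightarrow>
    (\<integral>\<^sup>+t. ennreal (Max ((\<lambda>i. c i * (\<Prod>k\<in>UNIV. \<bar>(t :: real ^ 'n::_) $ k\<bar> ^ (\<beta> i $ k))) ` I) powr (- ?s)) \<partial>lborel)
      \<le> ennreal (D * (\<Prod>i\<in>I. c i powr (- 1 / real w)))"
    using nn_integral_Max_monomials_le[OF I i0 w \<beta> \<beta>0 span] by blast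
  show thesis
  proof (rule that[of "K0 * D"])
    show "K0 * D \<ge> 0" using K0 D by simp
    fix R c assume R: "\<And>i. i \<in> I \<Longrightarrow> R i \<in> leading i" and c: "\<And>i. i \<in> I \<Longrightarrow> c i > (0 :: real)"
    define Q where "Q i t = (\<Prod>k\<in>UNIV. \<bar>t $ k\<bar> ^ (\<beta> i $ k))" for i and t :: "real ^ 'n::_"
    define F where "F S t = Max ((\<lambda>i. c i * \<bar>S i t\<bar>) ` I)" for S :: "'i \<Rightarrow> real ^ 'n::_ \<Rightarrow> real" and t
    have [measurable]: "R i \<in> borel_measurable borel" if "i \<in> I" for i
      using R[OF that] by (simp add: leading_def)
    have [measurable]: "Q i \<in> borel_measurable borel" for i
      unfolding Q_def by measurable
    \<comment> \<open>The value \<open>1\<close> at \<open>i0\<close> makes the maximum positive.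
      This matters because \<open>0 powr x\<close> is \<open>0\<close> and not infinity.\<close>
    have F_iff: "y \<le> F S t powr (- ?s) \<longleftrightarrow> (\<forall>i\<in>I. \<bar>S i t\<bar> \<le> y powr (- (1 / ?s)) / c i)"
      if "y > 0" "S i0 t = 1" for S y t
    proof -
      have "c i0 * \<bar>S i0 t\<bar> \<le> F S t"
        unfolding F_def using I i0 by (intro Max_ge) auto
      then have "F S t > 0" using c[OF i0] that(2) by simp
      then have "y \<le> F S t powr (- ?s) \<longleftrightarrow> F S t \<le> y powr (- (1 / ?s))"
        using that(1) s by (rule le_powr_minus_iff)
      also have "\<dots> \<longleftrightarrow> (\<forall>i\<in>I. c i * \<bar>S i t\<bar> \<le> y powr (- (1 / ?s)))"
        unfolding F_def using I i0 by (subst Max_le_iff) auto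
      also have "\<dots> \<longleftrightarrow> (\<forall>i\<in>I. \<bar>S i t\<bar> \<le> y powr (- (1 / ?s)) / c i)"
        using c by (intro ball_cong refl) (simp add: pos_le_divide_eq mult.commute)
      finally show ?thesis .
    qed
    have Fm: "(\<lambda>t. F S t powr (- ?s)) \<in> borel_measurable lborel"
      if [measurable]: "\<And>i. i \<in> I \<Longrightarrow> S i \<in> borel_measurable borel" for S
      unfolding F_def using I by measurable
    have FR: "(\<lambda>t. F R t powr (- ?s)) \<in> borel_measurable lborel"
      by (rule Fm) measurable
    have FQ: "(\<lambda>t. F Q t powr (- ?s)) \<in> borel_measurable lborel"
      by (rule Fm) measurable
    have transfer: "(\<integral>\<^sup>+t. indicator {t. y \<le> F S t powr (- ?s)} t \<partial>lborel)
      = (\<integral>\<^sup>+x. indicator {x. \<forall>i\<in>I. \<bar>S i (\<chi> k. x k)\<bar> \<le> y powr (- (1 / ?s)) / c i} x \<partial>PiM UNIV (\<lambda>_. lborel))"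
      if y: "y > 0" and S: "\<And>t. S i0 t = 1" and Sm[measurable]: "\<And>i. i \<in> I \<Longrightarrow> S i \<in> borel_measurable borel" for S y
    proof -
      have "{t. y \<le> F S t powr (- ?s)} \<in> sets borel"
        using Fm[OF Sm] by measurable
      then have "(\<integral>\<^sup>+t. indicator {t. y \<le> F S t powr (- ?s)} t \<partial>lborel)
        = (\<integral>\<^sup>+x. indicator {t. y \<le> F S t powr (- ?s)} (\<chi> k. x k) \<partial>PiM UNIV (\<lambda>_. lborel))"
        by (intro nn_integral_lborel_vec) simp
      also have "\<dots> = (\<integral>\<^sup>+x. indicator {x. \<forall>i\<in>I. \<bar>S i (\<chi> k. x k)\<bar> \<le> y powr (- (1 / ?s)) / c i} x \<partial>PiM UNIV (\<lambda>_. lborel))"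
        by (intro nn_integral_cong) (simp add: indicator_def F_iff[OF y] S)
      finally show ?thesis .
    qed
    have "(\<integral>\<^sup>+t. ennreal (F R t powr (- ?s)) \<partial>lborel) \<le> ennreal K0 * (\<integral>\<^sup>+t. ennreal (F Q t powr (- ?s)) \<partial>lborel)"
    proof (rule nn_integral_le_superlevels)
      fix y :: real assume y: "y > 0"
      have "(\<integral>\<^sup>+t. indicator {t. y \<le> F R t powr (- ?s)} t \<partial>lborel)
        = (\<integral>\<^sup>+x. indicator {x. \<forall>i\<in>I. \<bar>R i (\<chi> k. x k)\<bar> \<le> y powr (- (1 / ?s)) / c i} x \<partial>PiM UNIV (\<lambda>_. lborel))"
        by (rule transfer[OF y]) (use R leading_i0 i0 in auto)
      also have "\<dots> \<le> ennreal K0 * (\<integral>\<^sup>+x. indicator {x. \<forall>i\<in>I. (\<Prod>k\<in>UNIV. \<bar>x k\<bar> ^ (\<beta> i $ k)) \<le> y powr (- (1 / ?s)) / c i} x \<partial>PiM UNIV (\<lambda>_. lborel))"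
        using nn_integral_sublevels_le_monom[OF I ks(1), of "\<lambda>i. ($) (\<beta> i)" "\<lambda>i x. R i (\<chi> k. x k)" "\<lambda>i. y powr (- (1 / ?s)) / c i"] R
        by (simp add: leading_def ks K0_def)
      also have "(\<integral>\<^sup>+x. indicator {x. \<forall>i\<in>I. (\<Prod>k\<in>UNIV. \<bar>x k\<bar> ^ (\<beta> i $ k)) \<le> y powr (- (1 / ?s)) / c i} x \<partial>PiM UNIV (\<lambda>_. lborel))
          = (\<integral>\<^sup>+t. indicator {t. y \<le> F Q t powr (- ?s)} t \<partial>lborel)"
        by (subst transfer[OF y]) (auto simp: Q_def \<beta>0 abs_prod)
      finally show "(\<integral>\<^sup>+t. indicator {t. y \<le> F R t powr (- ?s)} t \<partial>lborel)
        \<le> ennreal K0 * (\<integral>\<^sup>+t. indicator {t. y \<le> F Q t powr (- ?s)} t \<partial>lborel)" .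
    qed (rule sigma_finite_lborel FR FQ)+
    also have "\<dots> \<le> ennreal K0 * ennreal (D * (\<Prod>i\<in>I. c i powr (- 1 / real w)))"
      using D(2)[OF c] by (intro mult_left_mono) (simp_all add: F_def Q_def abs_prod)
    also have "\<dots> = ennreal (K0 * D * (\<Prod>i\<in>I. c i powr (- 1 / real w)))"
      using K0 D(1) by (simp add: ennreal_mult[symmetric] prod_nonneg mult.assoc)
    finally show "(\<integral>\<^sup>+t. ennreal (Max ((\<lambda>i. c i * \<bar>R i t\<bar>) ` I) powr (- ?s)) \<partial>lborel)
      \<le> ennreal (K0 * D * (\<Prod>i\<in>I. c i powr (- 1 / real w)))" unfolding F_def .
  qed
qed

text \<open>With \<open>N = card I\<close>, distinguishing whether
  \<open>g t powr (w / N) * \<Phi> t\<close> is at least \<open>1\<close> gives the pointwise bound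
  by two terms. The first integrates to at most the sum of the \<open>c i * a i\<close>, the second
  is controlled by the product of the \<open>c i\<close>; the \<open>c i\<close> are chosen to
  balance all contributions.\<close>

lemma nn_integral_le_prod_weights:
  obtains C where "C \<ge> 0" "\<And>g R a. \<lbrakk>g \<in> borel_measurable borel; \<And>t. g t \<ge> 0;
      \<And>i. i \<in> I \<Longrightarrow> R i \<in> leading i; \<And>i. i \<in> I \<Longrightarrow> a i > 0;
      \<And>i. i \<in> I \<Longrightarrow> (\<integral>\<^sup>+t. ennreal (g t powr (real (w + card I) / real (card I))) * ennreal \<bar>R i t\<bar> \<partial>lborel) \<le> ennreal (a i)\<rbrakk>
    \<Longrightarrow> (\<integral>\<^sup>+t. ennreal (g t) \<partial>lborel) \<le> ennreal (C * (\<Prod>i\<in>I. a i) powr (1 / real (w + card I)))"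
proof -
  obtain K where K: "K \<ge> 0" "\<And>R c. \<lbrakk>\<And>i. i \<in> I \<Longrightarrow> R i \<in> leading i; \<And>i. i \<in> I \<Longrightarrow> c i > 0\<rbrakk> \<Longrightarrow>
    (\<integral>\<^sup>+t. ennreal (Max ((\<lambda>i. c i * \<bar>R i t\<bar>) ` I) powr (- (real (card I) / real w))) \<partial>lborel)
      \<le> ennreal (K * (\<Prod>i\<in>I. c i powr (- 1 / real w)))"
    using nn_integral_Max_leading_le by blast
  let ?N = "real (card I)" and ?w = "real w" and ?q = "real (w + card I)"
  let ?p = "?q / ?N"
  have pos: "?N > 0" "?w > 0" "?q > 0" using w card_pos by auto
  show thesis
  proof (rule that[of "?N + K"])
    show "?N + K \<ge> 0" using K by simp
    fix g R a
    assume [measurable]: "g \<in> borel_measurable borel" and g: "\<And>t. g t \<ge> (0 :: real)"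
      and R: "\<And>i. i \<in> I \<Longrightarrow> R i \<in> leading i" and a: "\<And>i. i \<in> I \<Longrightarrow> a i > 0"
      and le: "\<And>i. i \<in> I \<Longrightarrow> (\<integral>\<^sup>+t. ennreal (g t powr ?p) * ennreal \<bar>R i t\<bar> \<partial>lborel) \<le> ennreal (a i)"
    have Rm[measurable]: "R i \<in> borel_measurable borel" if "i \<in> I" for i
      using R[OF that] by (simp add: leading_def)
    define A where "A = (\<Prod>i\<in>I. a i)"
    have A: "A > 0" unfolding A_def using a by (intro prod_pos) auto
    \<comment> \<open>With \<open>c i = \<mu> / a i\<close> each of the \<open>N\<close> weighted
      terms contributes \<open>\<mu>\<close>. The product of the \<open>c i powr (- 1 / w)\<close>
      is \<open>(\<mu> ^ N / A) powr (- 1 / w)\<close>, which equals \<open>\<mu>\<close> as well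
      when \<open>A = \<mu> ^ (w + N)\<close>.\<close>
    define \<mu> where "\<mu> = A powr (1 / ?q)"
    have \<mu>: "\<mu> > 0" using A by (simp add: \<mu>_def)
    define c where "c i = \<mu> / a i" for i
    have c: "c i > 0" if "i \<in> I" for i using a[OF that] \<mu> by (simp add: c_def)
    define \<Phi> where "\<Phi> t = Max ((\<lambda>i. c i * \<bar>R i t\<bar>) ` I)" for t
    have \<Phi>0: "\<Phi> t > 0" for t
    proof -
      have "c i0 * \<bar>R i0 t\<bar> \<le> \<Phi> t"
        unfolding \<Phi>_def using I i0 by (intro Max_ge) auto
      then show ?thesis using c[OF i0] leading_i0[OF R[OF i0], of t] by simp
    qed
    have \<Phi>_le: "\<Phi> t \<le> (\<Sum>i\<in>I. c i * \<bar>R i t\<bar>)" for t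
    proof -
      have "0 \<le> c i * \<bar>R i t\<bar>" if "i \<in> I" for i using c[OF that] by simp
      then show ?thesis
        unfolding \<Phi>_def using I i0 by (intro Max.boundedI) (auto intro!: member_le_sum)
    qed
    have pw: "g t \<le> g t powr ?p * \<Phi> t + \<Phi> t powr (- (?N / ?w))" for t
    proof (cases "g t = 0")
      case False
      then have g0: "g t > 0" using g[of t] by simp
      have p: "?p = 1 + ?w / ?N" using pos by (simp add: add_divide_distrib)
      show ?thesis
      proof (cases "1 \<le> g t powr (?w / ?N) * \<Phi> t")
        case True
        have "g t * 1 \<le> g t * (g t powr (?w / ?N) * \<Phi> t)"
          using True g0 by (intro mult_left_mono) auto
        also have "\<dots> = g t powr ?p * \<Phi> t"
          unfolding p using g0 by (simp add: powr_add)
        finally show ?thesis by (simp add: add_increasing2)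
      next
        case False
        then have "\<Phi> t \<le> g t powr (- (1 / (?N / ?w)))"
          using g0 by (simp add: powr_minus field_simps)
        then have "g t \<le> \<Phi> t powr (- (?N / ?w))"
          using le_powr_minus_iff[OF \<Phi>0 g0, of "?N / ?w"] pos by simp
        then show ?thesis using \<Phi>0[of t] by (simp add: add_increasing)
      qed
    qed simp
    have "(\<integral>\<^sup>+t. ennreal (g t) \<partial>lborel)
      \<le> (\<integral>\<^sup>+t. (\<Sum>i\<in>I. ennreal (c i) * (ennreal (g t powr ?p) * ennreal \<bar>R i t\<bar>)) + ennreal (\<Phi> t powr (- (?N / ?w))) \<partial>lborel)"
    proof (rule nn_integral_mono)
      fix t
      have "g t \<le> (\<Sum>i\<in>I. c i * (g t powr ?p * \<bar>R i t\<bar>)) + \<Phi> t powr (- (?N / ?w))"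
      proof -
        have "(\<Sum>i\<in>I. c i * (g t powr ?p * \<bar>R i t\<bar>)) = g t powr ?p * (\<Sum>i\<in>I. c i * \<bar>R i t\<bar>)"
          by (simp only: sum_distrib_left mult.left_commute)
        then show ?thesis
          using pw[of t] mult_left_mono[OF \<Phi>_le[of t], of "g t powr ?p"] by simp
      qed
      then have "ennreal (g t) \<le> ennreal ((\<Sum>i\<in>I. c i * (g t powr ?p * \<bar>R i t\<bar>)) + \<Phi> t powr (- (?N / ?w)))"
        by (rule ennreal_leI)
      also have "\<dots> = (\<Sum>i\<in>I. ennreal (c i) * (ennreal (g t powr ?p) * ennreal \<bar>R i t\<bar>)) + ennreal (\<Phi> t powr (- (?N / ?w)))"
        using c by (subst ennreal_plus)
          (auto intro!: sum_nonneg simp: sum_ennreal[symmetric] ennreal_mult less_imp_le intro: sum.cong)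
      finally show "ennreal (g t) \<le> \<dots>" .
    qed
    also have "\<dots> = (\<Sum>i\<in>I. ennreal (c i) * (\<integral>\<^sup>+t. ennreal (g t powr ?p) * ennreal \<bar>R i t\<bar> \<partial>lborel)) + (\<integral>\<^sup>+t. ennreal (\<Phi> t powr (- (?N / ?w))) \<partial>lborel)"
    proof -
      have "\<Phi> \<in> borel_measurable borel" unfolding \<Phi>_def using I by measurable
      then show ?thesis
        by (subst nn_integral_add) (auto simp: nn_integral_sum nn_integral_cmult intro!: sum.cong)
    qed
    also have "\<dots> \<le> (\<Sum>i\<in>I. ennreal (c i) * ennreal (a i)) + ennreal (K * (\<Prod>i\<in>I. c i powr (- 1 / ?w)))"
      unfolding \<Phi>_def by (intro add_mono sum_mono mult_left_mono le K(2) R c) auto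
    also have "(\<Sum>i\<in>I. ennreal (c i) * ennreal (a i)) = (\<Sum>i\<in>I. ennreal \<mu>)"
    proof (rule sum.cong)
      fix i assume "i \<in> I"
      from a[OF this] show "ennreal (c i) * ennreal (a i) = ennreal \<mu>"
        using \<mu> by (simp add: c_def ennreal_mult[symmetric])
    qed simp
    also have "\<dots> = ennreal (?N * \<mu>)"
      using \<mu> by (simp add: ennreal_mult ennreal_of_nat_eq_real_of_nat)
    also have "(\<Prod>i\<in>I. c i powr (- 1 / ?w)) = \<mu>"
    proof -
      have "(\<Prod>i\<in>I. c i powr (- 1 / ?w)) = (\<Prod>i\<in>I. c i) powr (- 1 / ?w)"
        by (rule prod_powr_distrib[symmetric])
      also have "(\<Prod>i\<in>I. c i) = \<mu> powr ?N / A"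
        using \<mu> by (simp add: c_def prod_dividef A_def powr_realpow)
      also have "\<mu> powr ?N / A = A powr (?N / ?q - 1)"
        unfolding \<mu>_def powr_powr powr_diff using A by simp
      also have "(A powr (?N / ?q - 1)) powr (- 1 / ?w) = A powr ((?N / ?q - 1) * (- 1 / ?w))"
        by (rule powr_powr)
      also have "(?N / ?q - 1) * (- 1 / ?w) = 1 / ?q"
        using pos by (simp add: field_simps)
      finally show ?thesis by (simp add: \<mu>_def)
    qed
    also have "ennreal (?N * \<mu>) + ennreal (K * \<mu>) = ennreal ((?N + K) * \<mu>)"
      using \<mu> K(1) by (subst ennreal_plus[symmetric]) (auto simp: distrib_right)
    finally show "(\<integral>\<^sup>+t. ennreal (g t) \<partial>lborel) \<le> ennreal ((?N + K) * (\<Prod>i\<in>I. a i) powr (1 / ?q))"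
      by (simp add: \<mu>_def A_def)
  qed
qed

text \<open>The infimum removes the dependence on the earlier points: it bounds the integral of
  \<open>G\<close> against any pivot of index \<open>i\<close> from below.\<close>

definition weight :: "'i \<Rightarrow> (real ^ 'n::_ \<Rightarrow> ennreal) \<Rightarrow> ennreal" where
  "weight i G = (INF R\<in>leading i. \<integral>\<^sup>+t. G t * ennreal \<bar>R t\<bar> \<partial>lborel)"

text \<open>Functions \<open>R i\<close> that attain the infima up to an error
  \<open>\<delta>\<close> are inserted into the preceding inequality. The error also keeps the
  numbers \<open>a i\<close> positive when a weight is \<open>0\<close>; at the end it tends to
  \<open>0\<close>.\<close>

lemma power_nn_integral_le_prod_weight:
  obtains C where "C \<ge> 0" "\<And>g. \<lbrakk>g \<in> borel_measurable borel; \<And>t. g t \<ge> 0;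
      \<And>i. i \<in> I \<Longrightarrow> weight i (\<lambda>t. ennreal (g t powr (real (w + card I) / real (card I)))) < \<infinity>\<rbrakk>
    \<Longrightarrow> (\<integral>\<^sup>+t. ennreal (g t) \<partial>lborel) ^ (w + card I)
      \<le> ennreal C * (\<Prod>i\<in>I. weight i (\<lambda>t. ennreal (g t powr (real (w + card I) / real (card I)))))"
proof -
  let ?q = "w + card I"
  let ?p = "real ?q / real (card I)"
  obtain C where C: "C \<ge> 0" "\<And>g R a. \<lbrakk>g \<in> borel_measurable borel; \<And>t. g t \<ge> 0;
      \<And>i. i \<in> I \<Longrightarrow> R i \<in> leading i; \<And>i. i \<in> I \<Longrightarrow> a i > 0;
      \<And>i. i \<in> I \<Longrightarrow> (\<integral>\<^sup>+t. ennreal (g t powr ?p) * ennreal \<bar>R i t\<bar> \<partial>lborel) \<le> ennreal (a i)\<rbrakk>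
    \<Longrightarrow> (\<integral>\<^sup>+t. ennreal (g t) \<partial>lborel) \<le> ennreal (C * (\<Prod>i\<in>I. a i) powr (1 / real ?q))"
    using nn_integral_le_prod_weights by blast
  show thesis
  proof (rule that[of "C ^ ?q"])
    show "C ^ ?q \<ge> 0" using C by simp
    fix g :: "real ^ 'n::_ \<Rightarrow> real"
    assume gm: "g \<in> borel_measurable borel" and g: "\<And>t. g t \<ge> 0"
      and fin: "\<And>i. i \<in> I \<Longrightarrow> weight i (\<lambda>t. ennreal (g t powr ?p)) < \<infinity>"
    define W where "W i = weight i (\<lambda>t. ennreal (g t powr ?p))" for i
    define m where "m i = enn2real (W i)" for i
    have m: "W i = ennreal (m i)" "m i \<ge> 0" if "i \<in> I" for i
      using fin[OF that] by (auto simp: m_def W_def)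
    have bound: "(\<integral>\<^sup>+t. ennreal (g t) \<partial>lborel) \<le> ennreal (C * (\<Prod>i\<in>I. m i + \<delta>) powr (1 / real ?q))"
      if \<delta>: "\<delta> > 0" for \<delta>
    proof -
      have "\<exists>R. R \<in> leading i \<and> (\<integral>\<^sup>+t. ennreal (g t powr ?p) * ennreal \<bar>R t\<bar> \<partial>lborel) \<le> ennreal (m i + \<delta>)" if "i \<in> I" for i
      proof -
        have "W i < ennreal (m i + \<delta>)"
          using m[OF that] \<delta> by (simp add: ennreal_lessI)
        then show ?thesis
          unfolding W_def weight_def INF_less_iff by (blast intro: less_imp_le)
      qed
      then have "\<forall>i\<in>I. \<exists>R. R \<in> leading i \<and> (\<integral>\<^sup>+t. ennreal (g t powr ?p) * ennreal \<bar>R t\<bar> \<partial>lborel) \<le> ennreal (m i + \<delta>)"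
        by blast
      from bchoice[OF this] obtain R
        where R: "\<forall>i\<in>I. R i \<in> leading i \<and> (\<integral>\<^sup>+t. ennreal (g t powr ?p) * ennreal \<bar>R i t\<bar> \<partial>lborel) \<le> ennreal (m i + \<delta>)" ..
      show ?thesis
      proof (rule C(2)[OF gm g])
        fix i assume i: "i \<in> I"
        show "R i \<in> leading i" using R i by blast
        show "m i + \<delta> > 0" using m(2)[OF i] \<delta> by simp
        show "(\<integral>\<^sup>+t. ennreal (g t powr ?p) * ennreal \<bar>R i t\<bar> \<partial>lborel) \<le> ennreal (m i + \<delta>)"
          using R i by blast
      qed
    qed
    define x where "x = enn2real (\<integral>\<^sup>+t. ennreal (g t) \<partial>lborel)"
    have x: "(\<integral>\<^sup>+t. ennreal (g t) \<partial>lborel) = ennreal x" "x \<ge> 0"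
      using le_less_trans[OF bound[of 1] ennreal_less_top] by (auto simp: x_def)
    have "x ^ ?q \<le> C ^ ?q * (\<Prod>i\<in>I. m i + \<delta>)" if \<delta>: "\<delta> > 0" for \<delta>
    proof -
      have P: "(\<Prod>i\<in>I. m i + \<delta>) > 0"
        using m \<delta> by (intro prod_pos) (auto intro: add_nonneg_pos)
      have "x \<le> C * (\<Prod>i\<in>I. m i + \<delta>) powr (1 / real ?q)"
        using bound[OF \<delta>] C(1) unfolding x by (simp add: ennreal_le_iff)
      then have "x ^ ?q \<le> (C * (\<Prod>i\<in>I. m i + \<delta>) powr (1 / real ?q)) ^ ?q"
        using x(2) by (intro power_mono)
      also have "\<dots> = C ^ ?q * (\<Prod>i\<in>I. m i + \<delta>)"
        using P w by (simp add: power_mult_distrib powr_power)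
      finally show ?thesis .
    qed
    then have ev: "\<forall>\<^sub>F \<delta> in at_right 0. x ^ ?q \<le> C ^ ?q * (\<Prod>i\<in>I. m i + \<delta>)"
      by (intro eventually_mono[OF eventually_at_right_less])
    have "((\<lambda>\<delta>. C ^ ?q * (\<Prod>i\<in>I. m i + \<delta>)) \<longlongrightarrow> C ^ ?q * (\<Prod>i\<in>I. m i + 0)) (at_right 0)"
      by (intro tendsto_intros)
    from tendsto_lowerbound[OF this ev] have "x ^ ?q \<le> C ^ ?q * (\<Prod>i\<in>I. m i)"
      by simp
    then have "ennreal (x ^ ?q) \<le> ennreal (C ^ ?q) * (\<Prod>i\<in>I. ennreal (m i))"
      using C(1) m(2) by (subst prod_ennreal) (auto simp: ennreal_mult[symmetric] prod_nonneg ennreal_leI)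
    also have "(\<Prod>i\<in>I. ennreal (m i)) = (\<Prod>i\<in>I. W i)"
      using m by (intro prod.cong) auto
    finally show "(\<integral>\<^sup>+t. ennreal (g t) \<partial>lborel) ^ ?q \<le> ennreal (C ^ ?q) * (\<Prod>i\<in>I. weight i (\<lambda>t. ennreal (g t powr ?p)))"
      using x by (simp add: W_def ennreal_power)
  qed
qed

end

subsection \<open>The multilinear form\<close>

lemma eliminate_cong:
  assumes "\<And>i. i < l \<Longrightarrow> s i = s' i"
  shows "eliminate \<phi> l s j k t = eliminate \<phi> l s' j k t"
  using assms by (induction l arbitrary: k t) auto

lemma pivot_cong:
  assumes "\<And>k. k < i \<Longrightarrow> s k = s' k"
  shows "pivot \<phi> i s t = pivot \<phi> i s' t"
  unfolding pivot_def by (intro prod.cong eliminate_cong assms refl)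

text \<open>Each stage subtracts a multiple of a function built with index below \<open>l\<close>.
  The coefficients depend on the points but not on \<open>t\<close>, also at a vanishing pivot,
  where the quotient is \<open>0\<close>.\<close>

lemma eliminate_eq_plus_lower:
  "\<exists>c. \<forall>t. eliminate \<phi> l s j k t = \<phi> j k t + (\<Sum>i<l. c i * \<phi> j i t)"
proof (induction l arbitrary: k)
  case (Suc l)
  obtain c where c: "\<And>t. eliminate \<phi> l s j k t = \<phi> j k t + (\<Sum>i<l. c i * \<phi> j i t)"
    using Suc by blast
  obtain b where b: "\<And>t. eliminate \<phi> l s j l t = \<phi> j l t + (\<Sum>i<l. b i * \<phi> j i t)"
    using Suc by blast
  define r where "r = eliminate \<phi> l s j k (s l) / eliminate \<phi> l s j l (s l)"
  have "eliminate \<phi> (Suc l) s j k t = \<phi> j k t + (\<Sum>i<Suc l. (if i = l then - r else c i - r * b i) * \<phi> j i t)" for t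
  proof -
    have "(\<Sum>i<l. (if i = l then - r else c i - r * b i) * \<phi> j i t)
        = (\<Sum>i<l. (c i - r * b i) * \<phi> j i t)"
      by (intro sum.cong) auto
    also have "\<dots> = (\<Sum>i<l. c i * \<phi> j i t) - r * (\<Sum>i<l. b i * \<phi> j i t)"
      by (simp add: left_diff_distrib sum_subtractf sum_distrib_left mult.assoc)
    finally have "(\<Sum>i<l. (if i = l then - r else c i - r * b i) * \<phi> j i t)
        = (\<Sum>i<l. c i * \<phi> j i t) - r * (\<Sum>i<l. b i * \<phi> j i t)" .
    moreover have "eliminate \<phi> (Suc l) s j k t = eliminate \<phi> l s j k t - r * eliminate \<phi> l s j l t"
      by (simp add: r_def)
    ultimately show ?thesis by (simp add: c b algebra_simps)
  qed
  then show ?case by (intro exI allI)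
qed auto

lemma borel_measurable_eliminate:
  fixes \<phi> :: "'m \<Rightarrow> nat \<Rightarrow> 't::topological_space \<Rightarrow> real"
  assumes \<phi>: "\<And>j k. \<phi> j k \<in> borel_measurable borel"
    and S: "\<And>i. i < l \<Longrightarrow> (\<lambda>x. S x i) \<in> borel_measurable M" and T: "T \<in> borel_measurable M"
  shows "(\<lambda>x. eliminate \<phi> l (S x) j k (T x)) \<in> borel_measurable M"
  using S T
proof (induction l arbitrary: k T)
  case 0
  then show ?case by (simp add: measurable_compose[OF _ \<phi>])
next
  case (Suc l)
  have "(\<lambda>x. eliminate \<phi> l (S x) j i (T x)) \<in> borel_measurable M"
    "(\<lambda>x. eliminate \<phi> l (S x) j i (S x l)) \<in> borel_measurable M" for i
    using Suc by (auto intro!: Suc.IH)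
  note [measurable] = this
  show ?case by simp
qed

lemma borel_measurable_monomial[measurable]: "(\<lambda>t. monomial t \<alpha>) \<in> borel_measurable borel"
  unfolding monomial_def by measurable

text \<open>\<open>\<alpha> j i\<close> is the \<open>i\<close>-th multiindex of the
  \<open>j\<close>-th slice, counted from \<open>0\<close>. The exponents \<open>\<beta> i\<close>
  of the parent locale are the sums over \<open>j\<close>, and the index with exponent zero is
  \<open>0\<close>.\<close>

locale newton_exponents =
  balanced_exponents "{..<N}" "\<lambda>i. \<Sum>j\<in>UNIV. \<alpha> j i" w 0 ks
  for N :: nat and \<alpha> :: "'m::finite \<Rightarrow> nat \<Rightarrow> nat ^ 'n::{finite,wellorder}" and w :: nat and ks :: "'n list" +
  assumes lex: "\<And>j k i. k < i \<Longrightarrow> i < N \<Longrightarrow> lex_less ks (($) (\<alpha> j k)) (($) (\<alpha> j i))"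
begin

abbreviation \<phi> :: "'m \<Rightarrow> nat \<Rightarrow> real ^ 'n::_ \<Rightarrow> real" where
  "\<phi> j k t \<equiv> monomial t (\<alpha> j k)"

lemma borel_measurable_pivot:
  assumes "\<And>k. k < i \<Longrightarrow> (\<lambda>x. S x k) \<in> borel_measurable M" "T \<in> borel_measurable M"
  shows "(\<lambda>x. pivot \<phi> i (S x) (T x)) \<in> borel_measurable M"
  unfolding pivot_def using assms by (intro borel_measurable_prod borel_measurable_eliminate) auto

text \<open>Each factor is the monomial with exponent \<open>\<alpha> j i\<close> plus multiples of
  monomials that precede it in the dictionary order; multiplying over \<open>j\<close> adds the
  leading exponents.\<close>

lemma pivot_leading:
  assumes "i < N"
  shows "pivot \<phi> i s \<in> leading i"
proof -
  have "lead ks (($) (\<alpha> j i)) (\<lambda>x. eliminate \<phi> i s j i (\<chi> k. x k))" for j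
  proof -
    obtain c where "\<forall>t. eliminate \<phi> i s j i t = \<phi> j i t + (\<Sum>k<i. c k * \<phi> j k t)"
      using eliminate_eq_plus_lower[of \<phi> i s j i] ..
    moreover have "lead ks (($) (\<alpha> j i)) (\<lambda>x. (\<Prod>l\<in>set ks. x l ^ (\<alpha> j i $ l)) + (\<Sum>k<i. c k * (\<Prod>l\<in>set ks. x l ^ (\<alpha> j k $ l))))"
    proof (rule lead_monom_plus_lower)
      show "lex_less ks (($) (\<alpha> j k)) (($) (\<alpha> j i))" if "k \<in> {..<i}" for k
        using that assms by (intro lex) simp_all
    qed (use ks in simp_all)
    ultimately show ?thesis by (simp add: ks monomial_def)
  qed
  then have "lead ks (\<lambda>k. \<Sum>j\<in>UNIV. \<alpha> j i $ k) (\<lambda>x. pivot \<phi> i s (\<chi> k. x k))"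
    unfolding pivot_def by (intro lead_prod finite)
  moreover have "($) (\<Sum>j\<in>UNIV. \<alpha> j i) = (\<lambda>k. \<Sum>j\<in>UNIV. \<alpha> j i $ k)"
    by (simp add: fun_eq_iff sum_component)
  moreover have "pivot \<phi> i s \<in> borel_measurable borel"
    by (rule borel_measurable_pivot) simp_all
  ultimately show ?thesis by (simp add: leading_def)
qed

text \<open>The alternant weight is written through the pivots, of which the \<open>i\<close>-th one
  at \<open>s i\<close> depends only on \<open>s 0, ..., s i\<close>. Thus the form can be
  integrated from the last variable backwards.\<close>

definition multilinear :: "nat \<Rightarrow> (real ^ 'n::_ \<Rightarrow> ennreal) \<Rightarrow> ennreal" where
  "multilinear n G = (\<integral>\<^sup>+s. (\<Prod>i<n. G (s i) * ennreal \<bar>pivot \<phi> i s (s i)\<bar>) \<partial>PiM {..<n} (\<lambda>_. lborel))"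

lemma borel_measurable_multilinear_integrand:
  assumes S: "\<And>i. i < n \<Longrightarrow> (\<lambda>x. S x i) \<in> borel_measurable M"
  shows "(\<lambda>x. \<Prod>i<n. ennreal \<bar>pivot \<phi> i (S x) (S x i)\<bar>) \<in> borel_measurable M"
  using S by (intro borel_measurable_prod_ennreal measurable_compose[OF _ measurable_ennreal] borel_measurable_abs borel_measurable_pivot) auto

lemma component_measurable:
  "i < n \<Longrightarrow> (\<lambda>s. s i) \<in> borel_measurable (PiM {..<n} (\<lambda>_. lborel :: 'c::euclidean_space measure))"
  using measurable_component_singleton[of i "{..<n}" "\<lambda>_. lborel"] by simp

text \<open>With the earlier points fixed, the last pivot is a member of \<open>leading n\<close>,
  so the integral in the last variable is at least \<open>weight n G\<close>. This bound does not
  involve the earlier points, and what remains is the form with one variable less.\<close>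

lemma multilinear_ge_prod_weight:
  assumes [measurable]: "G \<in> borel_measurable borel"
  shows "n \<le> N \<Longrightarrow> (\<Prod>i<n. weight i G) \<le> multilinear n G"
proof (induction n)
  case 0
  then show ?case by (simp add: multilinear_def space_PiM_empty)
next
  case (Suc n)
  have meas: "(\<lambda>s. \<Prod>i<n. G (s i) * ennreal \<bar>pivot \<phi> i s (s i)\<bar>) \<in> borel_measurable (PiM {..<n} (\<lambda>_. lborel))" for n
    unfolding prod.distrib
  proof (rule borel_measurable_times_ennreal)
    have "(\<lambda>s. G (s i)) \<in> borel_measurable (PiM {..<n} (\<lambda>_. lborel))" if "i \<in> {..<n}" for i
      using that by (intro measurable_compose[OF component_measurable assms]) simp
    then show "(\<lambda>s. \<Prod>i<n. G (s i)) \<in> borel_measurable (PiM {..<n} (\<lambda>_. lborel))"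
      by (rule borel_measurable_prod_ennreal)
    show "(\<lambda>s. \<Prod>i<n. ennreal \<bar>pivot \<phi> i s (s i)\<bar>) \<in> borel_measurable (PiM {..<n} (\<lambda>_. lborel))"
      by (rule borel_measurable_multilinear_integrand) (rule component_measurable)
  qed
  let ?S = "PiM {..<n} (\<lambda>_. lborel :: (real ^ 'n::_) measure)"
  define Q where "Q s = (\<Prod>i<n. G (s i) * ennreal \<bar>pivot \<phi> i s (s i)\<bar>)" for s
  define h where "h s t = G t * ennreal \<bar>pivot \<phi> n s t\<bar>" for s t
  have Qm: "Q \<in> borel_measurable ?S"
    unfolding Q_def by (rule meas)
  have step: "(\<Prod>i<Suc n. G ((s(n := t)) i) * ennreal \<bar>pivot \<phi> i (s(n := t)) ((s(n := t)) i)\<bar>) = Q s * h s t" for s t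
  proof -
    have "pivot \<phi> i (s(n := t)) x = pivot \<phi> i s x" if "i \<le> n" for i x
      using that by (intro pivot_cong) auto
    then show ?thesis by (simp add: Q_def h_def)
  qed
  have hm: "h s \<in> borel_measurable lborel" for s
  proof -
    have "pivot \<phi> n s \<in> borel_measurable lborel"
      using pivot_leading[of n s] Suc.prems by (simp add: leading_def)
    then have "(\<lambda>t. ennreal \<bar>pivot \<phi> n s t\<bar>) \<in> borel_measurable lborel"
      by (intro measurable_compose[OF _ measurable_ennreal] borel_measurable_abs)
    moreover have "G \<in> borel_measurable lborel" using assms by simp
    ultimately show ?thesis
      unfolding h_def by (intro borel_measurable_times_ennreal)
  qed
  have hw: "weight n G \<le> (\<integral>\<^sup>+t. h s t \<partial>lborel)" for s
  proof -
    have "pivot \<phi> n s \<in> leading n"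
      using Suc.prems by (intro pivot_leading) simp
    then show ?thesis
      unfolding weight_def h_def by (rule INF_lower)
  qed
  have "multilinear n G * weight n G = (\<integral>\<^sup>+s. Q s * weight n G \<partial>?S)"
    unfolding multilinear_def Q_def[symmetric] by (rule nn_integral_multc[OF Qm, symmetric])
  also have "\<dots> \<le> (\<integral>\<^sup>+s. Q s * (\<integral>\<^sup>+t. h s t \<partial>lborel) \<partial>?S)"
    by (intro nn_integral_mono mult_left_mono hw) simp
  also have "\<dots> = (\<integral>\<^sup>+s. \<integral>\<^sup>+t. Q s * h s t \<partial>lborel \<partial>?S)"
    by (simp only: nn_integral_cmult[OF hm])
  also have "\<dots> = multilinear (Suc n) G"
    unfolding multilinear_def step[symmetric] unfolding lessThan_Suc
    by (rule lborel_product.product_nn_integral_insert[symmetric])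
       (use meas[of "Suc n"] in \<open>simp_all add: lessThan_Suc\<close>)
  finally have "multilinear n G * weight n G \<le> multilinear (Suc n) G" .
  moreover have "(\<Prod>i<Suc n. weight i G) \<le> multilinear n G * weight n G"
    using mult_right_mono[OF Suc.IH, of "weight n G"] Suc.prems by (simp add: mult.commute)
  ultimately show ?case by (rule order_trans[rotated])
qed

text \<open>Fubini moves the integral over \<open>u\<close> inside. For fixed points, elimination
  bounds it by the product of the integrals of \<open>F (s i, v)\<close> over \<open>v\<close>, and
  integrating this over the points separates into \<open>N\<close> equal factors.\<close>

lemma nn_integral_multilinear_le:
  fixes F :: "(real ^ 'n::_) \<times> (real ^ 'm) \<Rightarrow> ennreal" and A :: "((nat ^ 'n::_) \<times> 'm) set"
  assumes [measurable]: "F \<in> borel_measurable borel"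
    and inj: "\<And>j. inj_on (\<alpha> j) {..<N}" and A: "\<And>j. slice A j = \<alpha> j ` {..<N}"
  shows "(\<lambda>u. multilinear N (\<lambda>t. F (t, \<chi> j. \<Sum>a\<in>slice A j. u (a, j) * monomial t a)))
      \<in> borel_measurable (PiM A (\<lambda>_. lborel))" (is ?measurable)
    and "(\<integral>\<^sup>+u. multilinear N (\<lambda>t. F (t, \<chi> j. \<Sum>a\<in>slice A j. u (a, j) * monomial t a)) \<partial>PiM A (\<lambda>_. lborel))
    \<le> (\<integral>\<^sup>+z. F z \<partial>lborel) ^ N" (is ?le)
proof -
  \<comment> \<open>The position of a multiindex in the enumeration of its slice, which decides the
    block of the coefficient.\<close>
  define \<kappa> where "\<kappa> x = the_inv_into {..<N} (\<alpha> (snd x)) (fst x)" for x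
  have \<kappa>: "\<kappa> (\<alpha> j k, j) = k" if "k < N" for j k
    using that inj by (simp add: \<kappa>_def the_inv_into_f_f)
  have Aeq: "A = (\<lambda>(k, j). (\<alpha> j k, j)) ` ({..<N} \<times> UNIV)"
  proof -
    have "x \<in> A \<longleftrightarrow> fst x \<in> \<alpha> (snd x) ` {..<N}" for x
      unfolding A[symmetric] by (simp add: slice_def)
    then show ?thesis by (auto simp: image_iff)
  qed
  have bij: "bij_betw (\<lambda>x. (\<kappa> x, snd x)) A ({..<N} \<times> UNIV)"
    by (rule bij_betw_byWitness[where f' = "\<lambda>(k, j). (\<alpha> j k, j)"]) (auto simp: Aeq \<kappa>)
  have P: "(\<Sum>a\<in>slice A j. u (a, j) * monomial t a) = (\<Sum>k<N. u (\<alpha> j k, j) * \<phi> j k t)" for u t j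
    unfolding A using inj by (simp add: sum.reindex)
  define G where "G u s = (\<Prod>i<N. F (s i, \<chi> j. \<Sum>k<N. u (\<alpha> j k, j) * \<phi> j k (s i)) * ennreal \<bar>pivot \<phi> i s (s i)\<bar>)"
    for u s
  have finA: "finite A" unfolding Aeq by simp
  let ?U = "PiM A (\<lambda>_. lborel :: real measure)" and ?S = "PiM {..<N} (\<lambda>_. lborel :: (real ^ 'n::_) measure)"
  have Gm: "(\<lambda>(u, s). G u s) \<in> borel_measurable (?U \<Otimes>\<^sub>M ?S)"
  proof -
    have [measurable]: "(\<lambda>x. snd x i) \<in> borel_measurable (?U \<Otimes>\<^sub>M ?S)" if "i < N" for i
      by (rule measurable_compose[OF measurable_snd component_measurable[OF that]])
    have "(\<lambda>u. u (\<alpha> j k, j)) \<in> borel_measurable ?U" if "k < N" for j k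
    proof -
      have "(\<alpha> j k, j) \<in> A" using that by (auto simp: Aeq)
      from measurable_component_singleton[OF this, of "\<lambda>_. lborel :: real measure"] show ?thesis by simp
    qed
    from measurable_compose[OF measurable_fst this]
    have [measurable]: "(\<lambda>x. fst x (\<alpha> j k, j)) \<in> borel_measurable (?U \<Otimes>\<^sub>M ?S)" if "k < N" for j k
      using that by auto
    have [measurable]: "(\<lambda>x. \<chi> j. \<Sum>k<N. fst x (\<alpha> j k, j) * \<phi> j k (snd x i)) \<in> borel_measurable (?U \<Otimes>\<^sub>M ?S)" if "i < N" for i
      using that by measurable
    have F: "(\<lambda>x. F (snd x i, \<chi> j. \<Sum>k<N. fst x (\<alpha> j k, j) * \<phi> j k (snd x i))) \<in> borel_measurable (?U \<Otimes>\<^sub>M ?S)" if "i < N" for i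
      using that by (intro measurable_compose[OF borel_measurable_Pair assms(1)]) measurable
    show ?thesis
      unfolding G_def prod.distrib case_prod_beta
    proof (rule borel_measurable_times_ennreal)
      show "(\<lambda>x. \<Prod>i<N. F (snd x i, \<chi> j. \<Sum>k<N. fst x (\<alpha> j k, j) * \<phi> j k (snd x i))) \<in> borel_measurable (?U \<Otimes>\<^sub>M ?S)"
        by (rule borel_measurable_prod_ennreal) (simp add: F)
      show "(\<lambda>x. \<Prod>i<N. ennreal \<bar>pivot \<phi> i (snd x) (snd x i)\<bar>) \<in> borel_measurable (?U \<Otimes>\<^sub>M ?S)"
        by (rule borel_measurable_multilinear_integrand) (rule measurable_compose[OF measurable_snd component_measurable])
    qed
  qed
  from sigma_finite_measure.borel_measurable_nn_integral[OF lborel_product.sigma_finite Gm]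
  show ?measurable
    unfolding multilinear_def G_def P by simp
  have "(\<integral>\<^sup>+u. multilinear N (\<lambda>t. F (t, \<chi> j. \<Sum>a\<in>slice A j. u (a, j) * monomial t a)) \<partial>?U)
      = (\<integral>\<^sup>+u. \<integral>\<^sup>+s. G u s \<partial>?S \<partial>?U)"
    unfolding multilinear_def G_def P ..
  also have "\<dots> = (\<integral>\<^sup>+s. \<integral>\<^sup>+u. G u s \<partial>?U \<partial>?S)"
    by (rule pair_sigma_finite.Fubini'[OF _ Gm, symmetric])
       (auto intro!: pair_sigma_finite.intro lborel_product.sigma_finite finA)
  also have "\<dots> \<le> (\<integral>\<^sup>+s. (\<Prod>i<N. \<integral>\<^sup>+v. F (s i, v) \<partial>lborel) \<partial>?S)"
  proof (rule nn_integral_mono)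
    fix s assume s: "s \<in> space ?S"
    have "(\<lambda>u. G u s) \<in> borel_measurable ?U"
      using measurable_compose[OF measurable_Pair2'[OF s] Gm] by simp
    then have "(\<integral>\<^sup>+u. G u s \<partial>?U) = (\<integral>\<^sup>+V. G (\<lambda>x\<in>A. (V (\<kappa> x) :: real ^ 'm) $ snd x) s \<partial>PiM {..<N} (\<lambda>_. lborel))"
      by (rule nn_integral_PiM_blocks[OF bij])
    also have "\<dots> = (\<integral>\<^sup>+V. (\<Prod>i<N. ennreal \<bar>pivot \<phi> i s (s i)\<bar>) *
        (\<Prod>i<N. F (s i, \<chi> j. 0 + (\<Sum>k<N. (V k :: real ^ 'm) $ j * \<phi> j k (s i)))) \<partial>PiM {..<N} (\<lambda>_. lborel))"
    proof (rule nn_integral_cong)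
      fix V :: "nat \<Rightarrow> real ^ 'm"
      have V: "(\<lambda>x\<in>A. V (\<kappa> x) $ snd x) (\<alpha> j k, j) = V k $ j" if "k < N" for j k
      proof -
        have "(\<alpha> j k, j) \<in> A" using that by (auto simp: Aeq)
        then show ?thesis using \<kappa>[OF that] by simp
      qed
      have "(\<Sum>k<N. (\<lambda>x\<in>A. V (\<kappa> x) $ snd x) (\<alpha> j k, j) * \<phi> j k t) = 0 + (\<Sum>k<N. V k $ j * \<phi> j k t)" for j t
        unfolding add_0_left by (intro sum.cong refl) (simp only: V lessThan_iff)
      then show "G (\<lambda>x\<in>A. V (\<kappa> x) $ snd x) s = (\<Prod>i<N. ennreal \<bar>pivot \<phi> i s (s i)\<bar>) *
        (\<Prod>i<N. F (s i, \<chi> j. 0 + (\<Sum>k<N. V k $ j * \<phi> j k (s i))))"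
        unfolding G_def by (simp only: prod.distrib mult.commute)
    qed
    also have "\<dots> = (\<Prod>i<N. ennreal \<bar>pivot \<phi> i s (s i)\<bar>) *
      (\<integral>\<^sup>+V. (\<Prod>i<N. F (s i, \<chi> j. 0 + (\<Sum>k<N. (V k :: real ^ 'm) $ j * \<phi> j k (s i)))) \<partial>PiM {..<N} (\<lambda>_. lborel))"
      by (rule nn_integral_cmult) measurable
    also have "\<dots> \<le> (\<Prod>i<N. \<integral>\<^sup>+v. F (s i, v) \<partial>lborel)"
      \<comment> \<open>Stage \<open>0\<close> with zero offsets, where \<open>eliminate\<close> is
        \<open>\<phi>\<close> itself.\<close>
      using nn_integral_eliminate_le[of "\<lambda>i v. F (s i, v)" 0 N \<phi> s "\<lambda>i j. 0"]
      by (simp add: atLeast0LessThan)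
    finally show "(\<integral>\<^sup>+u. G u s \<partial>?U) \<le> (\<Prod>i<N. \<integral>\<^sup>+v. F (s i, v) \<partial>lborel)" .
  qed
  also have "\<dots> = (\<Prod>i<N. \<integral>\<^sup>+t. \<integral>\<^sup>+v. F (t, v) \<partial>lborel \<partial>lborel)"
    by (rule lborel_product.product_nn_integral_prod) auto
  also have "\<dots> = (\<integral>\<^sup>+z. F z \<partial>lborel) ^ N"
  proof -
    have "F \<in> borel_measurable (lborel \<Otimes>\<^sub>M lborel)"
      unfolding lborel_prod by simp
    from lborel.nn_integral_fst[OF this] show ?thesis
      by (simp add: lborel_prod)
  qed
  finally show ?le .
qed

section \<open>Truncation, to remove the finiteness condition on the weights\<close>

lemma ennreal_SUP_power_le:
  fixes x :: "nat \<Rightarrow> ennreal"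
  assumes le: "\<And>k. x k ^ q \<le> B" and q: "q > 0"
  shows "(SUP k. x k) ^ q \<le> B"
proof (cases B)
  case (real b)
  have "x k \<le> ennreal (root q b)" for k
  proof (cases "x k")
    case (real r)
    have "r ^ q \<le> b"
      using le[of k] \<open>B = ennreal b\<close> \<open>0 \<le> b\<close> real by (simp add: ennreal_power)
    then have "root q (r ^ q) \<le> root q b" using q by simp
    then show ?thesis using real q by (simp add: real_root_power_cancel ennreal_leI)
  next
    case top
    then show ?thesis using le[of k] real q by (simp add: top_power_ennreal top_unique)
  qed
  then have "(SUP k. x k) ^ q \<le> ennreal (root q b) ^ q"
    by (intro power_mono SUP_least) auto
  also have "\<dots> = B" using real q by (simp add: ennreal_power)
  finally show ?thesis .
qed simp

lemma weight_less_top: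
  assumes g: "\<And>t. g t \<ge> 0" "\<And>t. g t \<le> b" "\<And>t. norm t > b \<Longrightarrow> g t = 0" and i: "i < N" and r: "r \<ge> 0"
  shows "weight i (\<lambda>t. ennreal (g t powr r)) < \<infinity>"
proof -
  let ?R = "\<lambda>t. monomial t (\<Sum>j\<in>UNIV. \<alpha> j i)"
  have "?R \<in> leading i"
    using lead_monom_plus_lower[of "{}" ks _ "($) (\<Sum>j\<in>UNIV. \<alpha> j i)"] ks
    by (simp add: leading_def monomial_def[abs_def] borel_measurable_monomial[unfolded monomial_def[abs_def]])
  then have "weight i (\<lambda>t. ennreal (g t powr r)) \<le> (\<integral>\<^sup>+t. ennreal (g t powr r) * ennreal \<bar>?R t\<bar> \<partial>lborel)"
    unfolding weight_def by (rule INF_lower)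
  also have "\<dots> < \<infinity>"
  proof -
    have "continuous_on (cball 0 b) ?R"
      unfolding monomial_def by (intro continuous_intros)
    then have "bounded (?R ` cball 0 b)"
      by (intro compact_imp_bounded compact_continuous_image) auto
    then obtain c where "\<forall>y\<in>?R ` cball 0 b. norm y \<le> c"
      unfolding bounded_iff ..
    then have c: "\<bar>?R t\<bar> \<le> c" if "t \<in> cball 0 b" for t
      using that by simp
    have "(\<integral>\<^sup>+t. ennreal (g t powr r) * ennreal \<bar>?R t\<bar> \<partial>lborel)
        \<le> (\<integral>\<^sup>+t. (ennreal (b powr r) * ennreal c) * indicator (cball (0 :: real ^ 'n::_) b) t \<partial>lborel)"
    proof (rule nn_integral_mono)
      fix t
      show "ennreal (g t powr r) * ennreal \<bar>?R t\<bar> \<le> (ennreal (b powr r) * ennreal c) * indicator (cball 0 b) t"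
      proof (cases "t \<in> cball 0 b")
        case True
        then show ?thesis
          using g r c[OF True] by (auto intro!: mult_mono ennreal_leI powr_mono2)
      next
        case False
        then show ?thesis using g(3)[of t] by simp
      qed
    qed
    also have "\<dots> = ennreal (b powr r) * ennreal c * emeasure lborel (cball (0 :: real ^ 'n::_) b)"
      by (rule nn_integral_cmult_indicator) simp
    also have "\<dots> < \<infinity>"
      using emeasure_lborel_cball_finite[of "0 :: real ^ 'n::_" b] by (simp add: ennreal_mult_less_top)
    finally show ?thesis .
  qed
  finally show ?thesis .
qed

end

context newton_exponents
begin

text \<open>Truncation in height and to balls makes the weights finite. The inequality with weights
  then applies with a constant independent of the truncation, the product of the weights is at most
  the multilinear form of \<open>g\<close>, and monotone convergence recovers
  \<open>g\<close>.\<close>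

lemma power_nn_integral_le_multilinear:
  obtains C where "C \<ge> 0" "\<And>g. \<lbrakk>g \<in> borel_measurable borel; \<And>t. g t \<ge> 0\<rbrakk>
    \<Longrightarrow> (\<integral>\<^sup>+t. ennreal (g t) \<partial>lborel) ^ (w + N)
      \<le> ennreal C * multilinear N (\<lambda>t. ennreal (g t powr (real (w + N) / real N)))"
proof -
  let ?p = "real (w + N) / real N"
  obtain C where C: "C \<ge> 0" "\<And>g. \<lbrakk>g \<in> borel_measurable borel; \<And>t. g t \<ge> 0;
      \<And>i. i \<in> {..<N} \<Longrightarrow> weight i (\<lambda>t. ennreal (g t powr (real (w + card {..<N}) / real (card {..<N})))) < \<infinity>\<rbrakk>
    \<Longrightarrow> (\<integral>\<^sup>+t. ennreal (g t) \<partial>lborel) ^ (w + card {..<N})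
      \<le> ennreal C * (\<Prod>i<N. weight i (\<lambda>t. ennreal (g t powr (real (w + card {..<N}) / real (card {..<N})))))"
    using power_nn_integral_le_prod_weight by blast
  show thesis
  proof (rule that[OF C(1)])
    fix g :: "real ^ 'n::_ \<Rightarrow> real"
    assume gm[measurable]: "g \<in> borel_measurable borel" and g: "\<And>t. g t \<ge> 0"
    let ?J = "multilinear N (\<lambda>t. ennreal (g t powr ?p))"
    define h where "h k t = min (g t) (real k) * indicator (cball 0 (real k)) t" for k t
    have hm[measurable]: "h k \<in> borel_measurable borel" for k
      unfolding h_def by (intro borel_measurable_times borel_measurable_min borel_measurable_indicator gm) simp_all
    have h: "h k t \<ge> 0" "h k t \<le> real k" "norm t > real k \<Longrightarrow> h k t = 0" "h k t \<le> g t" for k t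
      using g[of t] by (auto simp: h_def indicator_def)
    have "(\<integral>\<^sup>+t. ennreal (h k t) \<partial>lborel) ^ (w + N) \<le> ennreal C * ?J" for k
    proof -
      have "weight i (\<lambda>t. ennreal (h k t powr ?p)) < \<infinity>" if "i < N" for i
        by (rule weight_less_top[OF h(1-3) that]) simp_all
      then have "(\<integral>\<^sup>+t. ennreal (h k t) \<partial>lborel) ^ (w + N) \<le> ennreal C * (\<Prod>i<N. weight i (\<lambda>t. ennreal (h k t powr ?p)))"
        using C(2)[OF hm h(1), of k] by simp
      also have "\<dots> \<le> ennreal C * multilinear N (\<lambda>t. ennreal (h k t powr ?p))"
        by (intro mult_left_mono multilinear_ge_prod_weight) simp_all
      also have "\<dots> \<le> ennreal C * ?J"
      proof -
        have "ennreal (h k t powr ?p) \<le> ennreal (g t powr ?p)" for t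
          by (intro ennreal_leI powr_mono2 h) simp
        then show ?thesis
          unfolding multilinear_def
          by (intro mult_left_mono nn_integral_mono prod_mono_ennreal mult_right_mono) simp_all
      qed
      finally show ?thesis .
    qed
    then have "(SUP k. \<integral>\<^sup>+t. ennreal (h k t) \<partial>lborel) ^ (w + N) \<le> ennreal C * ?J"
      using w by (intro ennreal_SUP_power_le) simp_all
    also have "(SUP k. \<integral>\<^sup>+t. ennreal (h k t) \<partial>lborel) = (\<integral>\<^sup>+t. (SUP k. ennreal (h k t)) \<partial>lborel)"
    proof (rule nn_integral_monotone_convergence_SUP[symmetric])
      show "incseq (\<lambda>k t. ennreal (h k t))"
        unfolding incseq_def le_fun_def
      proof (intro allI impI ennreal_leI)
        fix k l :: nat and t assume "k \<le> l"
        then have "real k \<le> real l" by simp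
        then show "h k t \<le> h l t"
          using g[of t] by (auto simp: h_def indicator_def)
      qed
    qed simp
    also have "\<dots> = (\<integral>\<^sup>+t. ennreal (g t) \<partial>lborel)"
    proof (rule nn_integral_cong)
      fix t
      \<comment> \<open>At this index the truncation leaves the value at \<open>t\<close>
        unchanged.\<close>
      obtain k where k: "max (g t) (norm t) \<le> real k" using real_arch_simple by blast
      have "(SUP k. ennreal (h k t)) \<le> ennreal (g t)"
        by (intro SUP_least ennreal_leI h)
      moreover have "ennreal (g t) = ennreal (h k t)" using k by (simp add: h_def)
      then have "ennreal (g t) \<le> (SUP k. ennreal (h k t))"
        by (auto intro: SUP_upper2)
      ultimately show "(SUP k. ennreal (h k t)) = ennreal (g t)" by (rule antisym)
    qed
    finally show "(\<integral>\<^sup>+t. ennreal (g t) \<partial>lborel) ^ (w + N) \<le> ennreal C * ?J" .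
  qed
qed

end

subsection \<open>Admissible sets\<close>

text \<open>In a sorted list every entry before \<open>k\<close> is smaller than \<open>k\<close>,
  so \<open>k\<close> is the first place of disagreement.\<close>

lemma lex_less_sorted:
  assumes "sorted ks" "distinct ks" "k \<in> set ks" "f k < g k" "\<And>l. l < k \<Longrightarrow> f l = g l"
  shows "lex_less ks f g"
  using assms
proof (induction ks)
  case (Cons x ks)
  show ?case
  proof (cases "x = k")
    case False
    then have "x < k" using Cons.prems by auto
    then show ?thesis using Cons False by auto
  qed (use Cons.prems in simp)
qed simp

lemma dict_less_imp_lex_less:
  "dict_less \<alpha> \<beta> \<Longrightarrow> lex_less (sorted_list_of_set UNIV) (($) \<alpha>) (($) \<beta>)"
  unfolding dict_less_def less_fun_def by (auto intro!: lex_less_sorted)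

lemma dict_less_zero: "\<not> dict_less \<alpha> 0"
  by (auto simp: dict_less_def less_fun_def)

lemma dict_enumerates_inj_on:
  assumes "dict_enumerates a N S"
  shows "inj_on a {1..N}"
proof (rule linorder_inj_onI)
  fix i j assume ij: "i < j" "i \<in> {1..N}" "j \<in> {1..N}"
  then have "dict_less (a i) (a j)"
    using assms unfolding dict_enumerates_def monotone_on_def by blast
  then show "a i \<noteq> a j"
    by (auto simp: dict_less_def less_fun_def)
qed auto

text \<open>The enumerations are shifted to start at \<open>0\<close>. Nondegeneracy puts the zero
  multiindex, the least one in the dictionary order, at position \<open>0\<close> of every slice,
  which provides the index with exponent zero.\<close>

lemma admissible_newton_exponents:
  fixes A :: "((nat ^ 'n::{finite,wellorder}) \<times> 'm::finite) set"
  assumes "admissible A N w"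
  obtains \<alpha> :: "'m \<Rightarrow> nat \<Rightarrow> nat ^ 'n::_"
    where "newton_exponents N \<alpha> w (sorted_list_of_set UNIV)"
      "\<And>j. inj_on (\<alpha> j) {..<N}" "\<And>j. slice A j = \<alpha> j ` {..<N}"
proof -
  obtain a where en: "\<And>j. dict_enumerates (a j) N (slice A j)"
    and sp: "span ((\<lambda>j. (\<chi> i. real ((\<Sum>k\<in>UNIV. a k j) $ i)) :: real ^ 'n::_) ` {1..N}) = UNIV"
    using assms unfolding admissible_def strengthened_spanning_def by blast
  define \<alpha> where "\<alpha> j k = a j (Suc k)" for j k
  have Suc: "Suc ` {..<N} = {1..N}"
    by (auto simp: image_Suc_lessThan)
  have inj: "inj_on (\<alpha> j) {..<N}" for j
    using comp_inj_on[of Suc "{..<N}" "a j"] dict_enumerates_inj_on[OF en[of j]]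
    by (simp add: Suc \<alpha>_def[abs_def] comp_def)
  have sl: "slice A j = \<alpha> j ` {..<N}" for j
  proof -
    have "\<alpha> j ` {..<N} = a j ` (Suc ` {..<N})" by (auto simp: \<alpha>_def)
    then show ?thesis using en[of j] unfolding Suc dict_enumerates_def by simp
  qed
  have z: "0 \<in> slice A j" for j using assms by (simp add: admissible_def)
  have N: "N > 0" using z[of undefined] unfolding sl by auto
  have less: "dict_less (\<alpha> j k) (\<alpha> j i)" if "k < i" "i < N" for j k i
    using en[of j] that unfolding dict_enumerates_def monotone_on_def \<alpha>_def by auto
  have \<alpha>0: "\<alpha> j 0 = 0" for j
  proof -
    obtain i where i: "i < N" "\<alpha> j i = 0" using z[of j] unfolding sl by force
    then have "\<not> 0 < i" using less[of 0 i j] dict_less_zero by metis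
    then show ?thesis using i by simp
  qed
  have sum: "(\<Sum>i<N. \<Sum>j\<in>UNIV. \<alpha> j i) = (\<chi> k. w)"
  proof -
    have "(\<Sum>i<N. \<Sum>j\<in>UNIV. \<alpha> j i) = (\<Sum>j\<in>UNIV. \<Sum>i<N. \<alpha> j i)"
      by (rule sum.swap)
    also have "\<dots> = (\<Sum>j\<in>UNIV. \<Sum>x\<in>slice A j. x)"
      unfolding sl by (simp add: sum.reindex[OF inj])
    finally show ?thesis using assms by (simp add: admissible_def)
  qed
  have sp': "span ((\<lambda>i. (\<chi> k. real ((\<Sum>j\<in>UNIV. \<alpha> j i) $ k)) :: real ^ 'n::_) ` {..<N}) = UNIV"
    using sp unfolding Suc[symmetric] image_image \<alpha>_def .
  \<comment> \<open>For \<open>w = 0\<close> all exponents would vanish and could not span a space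
    of positive dimension.\<close>
  have w: "w > 0"
  proof (rule ccontr)
    assume "\<not> w > 0"
    then have "(\<Sum>i<N. \<Sum>j\<in>UNIV. \<alpha> j i) $ k = 0" for k using sum by simp
    then have zero: "(\<Sum>j\<in>UNIV. \<alpha> j i) $ k = 0" if "i < N" for i k
      using that by (simp add: sum_component)
    have "(\<lambda>i. (\<chi> k. real ((\<Sum>j\<in>UNIV. \<alpha> j i) $ k)) :: real ^ 'n::_) ` {..<N} \<subseteq> {0}"
      using zero by (auto simp: vec_eq_iff)
    from span_mono[OF this] have "(UNIV :: (real ^ 'n::_) set) \<subseteq> {0}"
      unfolding sp' by simp
    then have "axis undefined 1 \<in> {0 :: real ^ 'n::_}" by blast
    then show False by (simp add: axis_eq_0_iff)
  qed
  have "newton_exponents N \<alpha> w (sorted_list_of_set UNIV)"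
  proof
    show "lex_less (sorted_list_of_set UNIV) (($) (\<alpha> j k)) (($) (\<alpha> j i))" if "k < i" "i < N" for j k i
      using less[OF that] by (rule dict_less_imp_lex_less)
  qed (use N w sum sp' \<alpha>0 in auto)
  then show thesis using that inj sl by blast
qed

section \<open>From Borel functions to Lebesgue measurable functions\<close>

lemma (in complete_measure) borel_measurable_AE_cong:
  fixes f g :: "'a \<Rightarrow> 'b::topological_space"
  assumes f: "f \<in> borel_measurable M" and eq: "AE x in M. f x = g x"
  shows "g \<in> borel_measurable M"
proof (rule measurableI)
  fix S :: "'b set" assume S: "S \<in> sets borel"
  show "g -` S \<inter> space M \<in> sets M"
  proof (rule in_sets_AE)
    show "AE x in M. x \<in> f -` S \<inter> space M \<longleftrightarrow> x \<in> g -` S \<inter> space M"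
      using eq by eventually_elim auto
    show "f -` S \<inter> space M \<in> sets M" using f S by (rule measurable_sets)
  qed auto
qed auto

text \<open>For fixed \<open>u\<close> the inequality for one function is applied to the norm of
  \<open>h\<close> along the graph of the polynomial map with coefficients \<open>u\<close>; the
  result is then integrated over \<open>u\<close>. Borel measurability of \<open>h\<close> ensures
  measurability along every graph.\<close>

lemma admissible_mixed_norm_bound:
  fixes A :: "((nat ^ 'n::{finite,wellorder}) \<times> 'm::finite) set"
  assumes "admissible A N w"
  obtains C where "C \<ge> 0" "\<And>h :: (real ^ 'n::_) \<times> (real ^ 'm) \<Rightarrow> complex. h \<in> borel_measurable borel \<Longrightarrow>
    (\<integral>\<^sup>+u. (\<integral>\<^sup>+t. ennreal (norm (h (t, \<chi> j. \<Sum>\<alpha>\<in>slice A j. u (\<alpha>, j) * monomial t \<alpha>))) \<partial>lborel) ^ (w + N) \<partial>PiM A (\<lambda>_. lborel))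
      \<le> ennreal C * (\<integral>\<^sup>+z. ennreal (norm (h z) powr (real (w + N) / real N)) \<partial>lborel) ^ N"
    "N > 0" "w > 0"
proof -
  obtain \<alpha> :: "'m \<Rightarrow> nat \<Rightarrow> nat ^ 'n::_"
    where ne: "newton_exponents N \<alpha> w (sorted_list_of_set UNIV)"
      and inj: "\<And>j. inj_on (\<alpha> j) {..<N}" and sl: "\<And>j. slice A j = \<alpha> j ` {..<N}"
    using admissible_newton_exponents[OF assms] by blast
  interpret newton_exponents N \<alpha> w "sorted_list_of_set UNIV" by (rule ne)
  obtain C where C: "C \<ge> 0" "\<And>g. \<lbrakk>g \<in> borel_measurable borel; \<And>t. g t \<ge> 0\<rbrakk>
    \<Longrightarrow> (\<integral>\<^sup>+t. ennreal (g t) \<partial>lborel) ^ (w + N)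
      \<le> ennreal C * multilinear N (\<lambda>t. ennreal (g t powr (real (w + N) / real N)))"
    using power_nn_integral_le_multilinear by blast
  show thesis
  proof (rule that[OF C(1) _ _ w])
    show "N > 0" using i0 by simp
    fix h :: "(real ^ 'n::_) \<times> (real ^ 'm) \<Rightarrow> complex" assume hm[measurable]: "h \<in> borel_measurable borel"
    define F where "F z = ennreal (norm (h z) powr (real (w + N) / real N))" for z
    have [measurable]: "F \<in> borel_measurable borel"
      unfolding F_def by measurable
    define P where "P u t = (\<chi> j. \<Sum>\<alpha>\<in>slice A j. u (\<alpha>, j) * monomial t \<alpha> :: real ^ 'm)" for u and t :: "real ^ 'n::_"
    have Pm: "P u \<in> borel_measurable borel" for u
      unfolding P_def by measurable
    have "(\<integral>\<^sup>+u. (\<integral>\<^sup>+t. ennreal (norm (h (t, P u t))) \<partial>lborel) ^ (w + N) \<partial>PiM A (\<lambda>_. lborel))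
        \<le> (\<integral>\<^sup>+u. ennreal C * multilinear N (\<lambda>t. F (t, P u t)) \<partial>PiM A (\<lambda>_. lborel))"
    proof (rule nn_integral_mono)
      fix u
      have "(\<lambda>t. norm (h (t, P u t))) \<in> borel_measurable borel"
      proof -
        have "(\<lambda>t. (t, P u t)) \<in> borel_measurable borel"
          by (intro borel_measurable_Pair Pm) simp
        from measurable_compose[OF this measurable_compose[OF hm borel_measurable_norm]] show ?thesis .
      qed
      from C(2)[OF this] show "(\<integral>\<^sup>+t. ennreal (norm (h (t, P u t))) \<partial>lborel) ^ (w + N) \<le> ennreal C * multilinear N (\<lambda>t. F (t, P u t))"
        unfolding F_def by simp
    qed
    also have "\<dots> = ennreal C * (\<integral>\<^sup>+u. multilinear N (\<lambda>t. F (t, P u t)) \<partial>PiM A (\<lambda>_. lborel))"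
      unfolding P_def by (intro nn_integral_cmult nn_integral_multilinear_le(1) inj sl) measurable
    also have "\<dots> \<le> ennreal C * (\<integral>\<^sup>+z. F z \<partial>lborel) ^ N"
      unfolding P_def by (intro mult_left_mono nn_integral_multilinear_le(2) inj sl) simp_all
    finally show "(\<integral>\<^sup>+u. (\<integral>\<^sup>+t. ennreal (norm (h (t, \<chi> j. \<Sum>\<alpha>\<in>slice A j. u (\<alpha>, j) * monomial t \<alpha>))) \<partial>lborel) ^ (w + N) \<partial>PiM A (\<lambda>_. lborel))
      \<le> ennreal C * (\<integral>\<^sup>+z. ennreal (norm (h z) powr (real (w + N) / real N)) \<partial>lborel) ^ N"
      unfolding P_def F_def .
  qed
qed

lemma completion_ex_borel_measurable_complex:
  fixes g :: "'a \<Rightarrow> complex"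
  assumes "g \<in> borel_measurable (completion M)"
  obtains g' where "g' \<in> borel_measurable M" "AE x in M. g x = g' x"
proof -
  have "(\<lambda>x. Re (g x)) \<in> borel_measurable (completion M)" "(\<lambda>x. Im (g x)) \<in> borel_measurable (completion M)"
    using assms by measurable
  then obtain r i where ri: "r \<in> borel_measurable M" "AE x in M. Re (g x) = r x"
    "i \<in> borel_measurable M" "AE x in M. Im (g x) = i x"
    using completion_ex_borel_measurable_real by metis
  note [measurable] = ri(1,3)
  show thesis
  proof (rule that)
    show "(\<lambda>x. complex_of_real (r x) + \<i> * complex_of_real (i x)) \<in> borel_measurable M"
      by measurable
    show "AE x in M. g x = complex_of_real (r x) + \<i> * complex_of_real (i x)"
      using ri(2,4) by eventually_elim (simp add: complex_eq_iff)
  qed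
qed

lemma borel_measurable_graph_point:
  fixes A :: "((nat ^ 'n::finite) \<times> 'm::finite) set"
  shows "(\<lambda>x. (snd x, \<chi> j. \<Sum>\<alpha>\<in>slice A j. fst x (\<alpha>, j) * monomial (snd x) \<alpha>))
    \<in> borel_measurable (PiM A (\<lambda>_. lborel) \<Otimes>\<^sub>M (lborel :: (real ^ 'n) measure))"
proof -
  let ?M = "PiM A (\<lambda>_. lborel :: real measure) \<Otimes>\<^sub>M (lborel :: (real ^ 'n) measure)"
  have snd: "snd \<in> borel_measurable ?M"
    using measurable_snd[of "PiM A (\<lambda>_. lborel :: real measure)" "lborel :: (real ^ 'n) measure"] by simp
  have "(\<lambda>x. fst x (\<alpha>, j) * monomial (snd x) \<alpha>) \<in> borel_measurable ?M" if "\<alpha> \<in> slice A j" for \<alpha> j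
  proof (rule borel_measurable_times)
    have "(\<alpha>, j) \<in> A" using that by (simp add: slice_def)
    from measurable_compose[OF measurable_fst measurable_component_singleton[OF this, of "\<lambda>_. lborel"]]
    show "(\<lambda>x. fst x (\<alpha>, j)) \<in> borel_measurable ?M" by simp
    show "(\<lambda>x. monomial (snd x) \<alpha>) \<in> borel_measurable ?M"
      by (rule measurable_compose[OF snd borel_measurable_monomial])
  qed
  then have "(\<lambda>x. \<chi> j. \<Sum>\<alpha>\<in>slice A j. fst x (\<alpha>, j) * monomial (snd x) \<alpha>) \<in> borel_measurable ?M"
    by (intro borel_measurable_vec_lambda borel_measurable_sum)
  with snd show ?thesis by (rule borel_measurable_Pair)
qed

text \<open>The first conclusion says that the integral defining the operator converges for almost
  all coefficients, so that its value there is not the default \<open>0\<close> of a divergent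
  integral. The proof passes to a Borel representative of \<open>f\<close>. Since a graph is itself
  a null set, it must be shown that the exceptional set is negligible along almost every
  graph.\<close>

theorem theorem2:
  fixes A :: "((nat ^ 'n::{finite,wellorder}) \<times> 'm::finite) set" and d N w :: nat
  assumes "d > 0"
    and "A \<subseteq> multiindices d \<times> UNIV"
    and "admissible A N w"
  shows "\<exists>C\<ge>0. \<forall>f \<in> Lp_space (real (w + N) / real N) (lebesgue :: ((real ^ 'n::_) \<times> (real ^ 'm)) measure).
     (AE u in coeff_measure A.
        integrable lebesgue (\<lambda>t. f (t, \<chi> j. \<Sum>\<alpha>\<in>slice A j. u (\<alpha>, j) * monomial t \<alpha>))) \<and>
     T_op A f \<in> Lp_space (real (w + N)) (coeff_measure A) \<and>
     Lp_norm (real (w + N)) (coeff_measure A) (T_op A f)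
       \<le> C * Lp_norm (real (w + N) / real N) lebesgue f"
proof -
  let ?q = "real (w + N)"
  let ?p = "?q / real N"
  define P where "P u t = (\<chi> j. \<Sum>\<alpha>\<in>slice A j. u (\<alpha>, j) * monomial t \<alpha> :: real ^ 'm)"
    for u and t :: "real ^ 'n::_"
  define U where "U = PiM A (\<lambda>_. lborel :: real measure)"
  obtain C where C: "C \<ge> 0" "\<And>h :: (real ^ 'n::_) \<times> (real ^ 'm) \<Rightarrow> complex. h \<in> borel_measurable borel \<Longrightarrow>
      (\<integral>\<^sup>+u. (\<integral>\<^sup>+t. ennreal (norm (h (t, P u t))) \<partial>lborel) ^ (w + N) \<partial>U)
        \<le> ennreal C * (\<integral>\<^sup>+z. ennreal (norm (h z) powr ?p) \<partial>lborel) ^ N"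
    and N: "N > 0" and w: "w > 0"
    using admissible_mixed_norm_bound[OF assms(3)] unfolding P_def U_def by blast
  have coeff: "coeff_measure A = completion U"
    by (simp add: coeff_measure_def U_def)
  have Q: "(\<lambda>x. (snd x, P (fst x) (snd x))) \<in> borel_measurable (U \<Otimes>\<^sub>M lborel)"
    unfolding P_def U_def by (rule borel_measurable_graph_point)
  have joint: "(\<lambda>(u, t). h (t, P u t)) \<in> borel_measurable (U \<Otimes>\<^sub>M lborel)"
    if "h \<in> borel_measurable borel" for h :: "(real ^ 'n::_) \<times> (real ^ 'm) \<Rightarrow> complex"
    using measurable_compose[OF Q that] by (simp add: case_prod_beta)
  have measurable_slice: "(\<lambda>t. h (t, P u t)) \<in> borel_measurable lborel"
    if "h \<in> borel_measurable borel" for u and h :: "(real ^ 'n::_) \<times> (real ^ 'm) \<Rightarrow> complex"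
  proof -
    have "P u \<in> borel_measurable lborel"
      unfolding P_def by measurable
    then have "(\<lambda>t. (t, P u t)) \<in> borel_measurable lborel"
      by (intro borel_measurable_Pair) simp_all
    from measurable_compose[OF this that] show ?thesis .
  qed
  define S where "S h u = (\<integral>\<^sup>+t. ennreal (norm (h (t, P u t))) \<partial>lborel)"
    for h :: "(real ^ 'n::_) \<times> (real ^ 'm) \<Rightarrow> complex" and u
  have Sm: "(\<lambda>u. S h u ^ (w + N)) \<in> borel_measurable U" if "h \<in> borel_measurable borel" for h
  proof -
    have "(\<lambda>(u, t). ennreal (norm (h (t, P u t)))) \<in> borel_measurable (U \<Otimes>\<^sub>M lborel)"
      using measurable_compose[OF measurable_compose[OF joint[OF that] borel_measurable_norm] measurable_ennreal]
      by (simp add: case_prod_beta)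
    from sigma_finite_measure.borel_measurable_nn_integral[OF sigma_finite_lborel this]
    have "S h \<in> borel_measurable U" by (simp add: S_def[abs_def])
    then show ?thesis by (intro borel_measurable_power_ennreal)
  qed
  \<comment> \<open>The bound is applied to the indicator of \<open>Z\<close>, whose integral
    vanishes; so for almost every \<open>u\<close> the graph meets \<open>Z\<close> only for a null
    set of \<open>t\<close>.\<close>
  have null: "AE u in U. AE t in lborel. (t, P u t) \<notin> Z" if Z: "Z \<in> null_sets lborel" for Z
  proof -
    have Zm: "Z \<in> sets borel" using Z by auto
    let ?h = "indicator Z :: (real ^ 'n::_) \<times> (real ^ 'm) \<Rightarrow> complex"
    have hm: "?h \<in> borel_measurable borel" using Zm by simp
    have "(\<integral>\<^sup>+z. ennreal (norm (?h z) powr ?p) \<partial>lborel) = (\<integral>\<^sup>+z. indicator Z z \<partial>lborel)"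
      using N by (intro nn_integral_cong) (simp add: indicator_def)
    also have "\<dots> = 0" using Z by (subst nn_integral_indicator) auto
    finally have "(\<integral>\<^sup>+u. S ?h u ^ (w + N) \<partial>U) = 0"
      using C(2)[OF hm] N by (simp add: S_def zero_power)
    then have "AE u in U. S ?h u ^ (w + N) = 0"
      using Sm[OF hm] by (simp add: nn_integral_0_iff_AE)
    then show ?thesis
    proof eventually_elim
      case (elim u)
      then have "(\<integral>\<^sup>+t. ennreal (norm (?h (t, P u t))) \<partial>lborel) = 0" by (simp add: S_def)
      then have "AE t in lborel. ennreal (norm (?h (t, P u t))) = 0"
        using measurable_compose[OF measurable_compose[OF measurable_slice[OF hm] borel_measurable_norm] measurable_ennreal]
        by (simp add: nn_integral_0_iff_AE)
      then show ?case by eventually_elim (simp add: indicator_def split: if_splits)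
    qed
  qed
  show ?thesis
  \<comment> \<open>The bound for \<open>q\<close>-th powers has the constant \<open>C\<close>, so
    the norm gets its \<open>q\<close>-th root.\<close>
  proof (intro exI[of _ "C powr (1 / ?q)"] conjI ballI)
    show "C powr (1 / ?q) \<ge> 0" by simp
    fix f :: "(real ^ 'n::_) \<times> (real ^ 'm) \<Rightarrow> complex"
    assume "f \<in> Lp_space ?p lebesgue"
    then have fm: "f \<in> borel_measurable lebesgue" and fi: "integrable lebesgue (\<lambda>z. norm (f z) powr ?p)"
      by (auto simp: Lp_space_def)
    obtain f' where f'm: "f' \<in> borel_measurable lborel" and ff': "AE z in lborel. f z = f' z"
      using completion_ex_borel_measurable_complex[OF fm] by blast
    have f'm': "f' \<in> borel_measurable borel" using f'm by simp
    obtain Z where Z0: "\<And>z. z \<in> space lborel - Z \<Longrightarrow> f z = f' z" and Z: "Z \<in> null_sets lborel"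
      using AE_E3[OF ff'] by blast
    have fZ: "f z = f' z" if "z \<notin> Z" for z
      using Z0[of z] that by simp
    define Y where "Y = (\<integral>z. norm (f z) powr ?p \<partial>lebesgue)"
    have Y: "Y \<ge> 0" unfolding Y_def by simp
    have "(\<integral>\<^sup>+z. ennreal (norm (f' z) powr ?p) \<partial>lborel) = (\<integral>\<^sup>+z. ennreal (norm (f z) powr ?p) \<partial>lborel)"
      using ff' by (intro nn_integral_cong_AE) (auto elim!: eventually_mono)
    also have "\<dots> = (\<integral>\<^sup>+z. ennreal (norm (f z) powr ?p) \<partial>lebesgue)"
      by (simp add: nn_integral_completion)
    also have "\<dots> = ennreal Y"
      unfolding Y_def by (rule nn_integral_eq_integral[OF fi]) simp
    finally have norm_f': "(\<integral>\<^sup>+z. ennreal (norm (f' z) powr ?p) \<partial>lborel) = ennreal Y" .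
    have bound: "(\<integral>\<^sup>+u. S f' u ^ (w + N) \<partial>U) \<le> ennreal (C * Y ^ N)"
      using C(2)[OF f'm'] C(1) Y unfolding norm_f' S_def by (simp add: ennreal_power ennreal_mult)
    then have "(\<integral>\<^sup>+u. S f' u ^ (w + N) \<partial>U) \<noteq> \<infinity>"
      by (auto simp: top_unique)
    from nn_integral_noteq_infinite[OF Sm[OF f'm'] this]
    have Sfin: "AE u in U. S f' u < \<infinity>"
    proof eventually_elim
      case (elim u)
      then show ?case using w by (auto simp: power_eq_top_ennreal less_top[symmetric])
    qed
    define T' where "T' u = (\<integral>t. f' (t, P u t) \<partial>lborel)" for u
    have T'm: "T' \<in> borel_measurable U"
      unfolding T'_def using joint[OF f'm']
      by (rule sigma_finite_measure.borel_measurable_lebesgue_integral[OF sigma_finite_lborel])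
    \<comment> \<open>For such \<open>u\<close>, \<open>f\<close> and \<open>f'\<close> agree along
      the graph for almost all \<open>t\<close>, so integrability, value and size of the integral
      can be read off from \<open>f'\<close>.\<close>
    have good: "AE u in U. integrable lebesgue (\<lambda>t. f (t, P u t)) \<and> T_op A f u = T' u \<and> ennreal (norm (T' u)) \<le> S f' u"
      using Sfin null[OF Z]
    proof eventually_elim
      case (elim u)
      have f'u: "(\<lambda>t. f' (t, P u t)) \<in> borel_measurable lborel" by (rule measurable_slice[OF f'm'])
      have i: "integrable lborel (\<lambda>t. f' (t, P u t))"
        using f'u elim(1) by (intro integrableI_bounded) (simp_all add: S_def)
      have ae: "AE t in lebesgue. f' (t, P u t) = f (t, P u t)"
        using elim(2) by (intro AE_completion) (auto elim!: eventually_mono simp: fZ)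
      have f'c: "(\<lambda>t. f' (t, P u t)) \<in> borel_measurable lebesgue"
        using f'u by (rule measurable_completion)
      have fc: "(\<lambda>t. f (t, P u t)) \<in> borel_measurable lebesgue"
        by (rule completion.borel_measurable_AE_cong[OF f'c ae])
      have "integrable lebesgue (\<lambda>t. f' (t, P u t))"
        using i f'u by (simp add: integrable_completion)
      then have "integrable lebesgue (\<lambda>t. f (t, P u t))"
        using integrable_cong_AE[OF f'c fc ae] by simp
      moreover have "T_op A f u = T' u"
        using integral_cong_AE[OF f'c fc ae] integral_completion[OF f'u]
        by (simp add: T_op_def T'_def P_def)
      moreover have "ennreal (norm (T' u)) \<le> S f' u"
        unfolding T'_def S_def by (rule integral_norm_bound_ennreal[OF i])
      ultimately show ?case by blast
    qed
    then have "AE u in U. integrable lebesgue (\<lambda>t. f (t, P u t))"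
      by (rule eventually_mono) simp
    then have "AE u in completion U. integrable lebesgue (\<lambda>t. f (t, P u t))"
      by (rule AE_completion)
    then show "AE u in coeff_measure A.
        integrable lebesgue (\<lambda>t. f (t, \<chi> j. \<Sum>\<alpha>\<in>slice A j. u (\<alpha>, j) * monomial t \<alpha>))"
      unfolding coeff P_def .
    have Tm: "T_op A f \<in> borel_measurable (completion U)"
    proof (rule completion.borel_measurable_AE_cong)
      show "T' \<in> borel_measurable (completion U)" by (rule measurable_completion[OF T'm])
      have "AE u in U. T' u = T_op A f u"
        using good by (rule eventually_mono) simp
      then show "AE u in completion U. T' u = T_op A f u"
        by (rule AE_completion)
    qed
    define X where "X = (\<integral>\<^sup>+u. ennreal (norm (T_op A f u) powr ?q) \<partial>completion U)"
    have "X = (\<integral>\<^sup>+u. ennreal (norm (T_op A f u) powr ?q) \<partial>U)"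
      by (simp add: X_def nn_integral_completion)
    also have "\<dots> \<le> (\<integral>\<^sup>+u. S f' u ^ (w + N) \<partial>U)"
    proof (rule nn_integral_mono_AE)
      show "AE u in U. ennreal (norm (T_op A f u) powr ?q) \<le> S f' u ^ (w + N)"
        using good
      proof eventually_elim
        case (elim u)
        have "ennreal (norm (T' u) powr ?q) = ennreal (norm (T' u)) ^ (w + N)"
          using w by (subst powr_realpow') (simp_all add: ennreal_power)
        also have "\<dots> \<le> S f' u ^ (w + N)"
          using elim by (intro power_mono) simp_all
        finally show ?case using elim by simp
      qed
    qed
    also note bound
    finally have X: "X \<le> ennreal (C * Y ^ N)" .
    have Ti: "integrable (completion U) (\<lambda>u. norm (T_op A f u) powr ?q)"
    proof (rule integrableI_nonneg)
      show "(\<lambda>u. norm (T_op A f u) powr ?q) \<in> borel_measurable (completion U)"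
        using Tm by measurable
      show "(\<integral>\<^sup>+u. ennreal (norm (T_op A f u) powr ?q) \<partial>completion U) < \<infinity>"
        using le_less_trans[OF X ennreal_less_top] by (simp add: X_def)
    qed simp
    show "T_op A f \<in> Lp_space ?q (coeff_measure A)"
      using Tm Ti by (simp add: Lp_space_def coeff)
    have "ennreal (\<integral>u. norm (T_op A f u) powr ?q \<partial>completion U) = X"
      unfolding X_def by (rule nn_integral_eq_integral[OF Ti, symmetric]) simp
    with X have "ennreal (\<integral>u. norm (T_op A f u) powr ?q \<partial>completion U) \<le> ennreal (C * Y ^ N)"
      by simp
    then have "(\<integral>u. norm (T_op A f u) powr ?q \<partial>completion U) \<le> C * Y ^ N"
      by (rule ennreal_le_iff[THEN iffD1, rotated]) (use C(1) Y in simp)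
    then have "Lp_norm ?q (coeff_measure A) (T_op A f) \<le> (C * Y ^ N) powr (1 / ?q)"
      unfolding Lp_norm_def coeff by (intro powr_mono2) simp_all
    \<comment> \<open>The exponents match because \<open>N / q = 1 / p\<close>.\<close>
    also have "\<dots> = C powr (1 / ?q) * (Y powr real N) powr (1 / ?q)"
      using C(1) Y N by (subst powr_realpow') (simp_all add: powr_mult)
    also have "\<dots> = C powr (1 / ?q) * Lp_norm ?p lebesgue f"
      unfolding Lp_norm_def Y_def[symmetric] powr_powr by simp
    finally show "Lp_norm ?q (coeff_measure A) (T_op A f) \<le> C powr (1 / ?q) * Lp_norm ?p lebesgue f" .
  qed
qed

end
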